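(* Let $D$ be a connected digraph, let $p \geq 1$ be an integer, and let $f=(f_1,\ldots,f_p):V(D) \to \mathbb{N}_0^p$ be a vector function such that $f_1(v) + f_2(v) + \ldots + f_p(v) \geq \max \{d_{D}^+(v), d_D^-(v)\}$ for all $v \in V(D)$. Then $D$ is not $f$-partitionable if and only if $(D,f)$ is a hard pair.
   Context: Digraphs are finite and have no loops and no parallel arcs, but two opposite arcs $uv$ and $vu$ between two vertices are allowed. $d_D^+(v)$ and $d_D^-(v)$ denote the out-degree and in-degree of $v$ in $D$; $|D|$ is the number of vertices. The underlying graph $G(D)$ is the simple undirected graph on $V(D)$ in which $u,v$ are adjacent iff at least one of $uv,vu$ is an arc; $D$ is connected if $G(D)$ is connected. A separating vertex of a connected digraph $D$ is a vertex $v$ such that $D-v$ is non-empty and not connected. "$D$ is a block" means that $D$ is connected and has no separating vertex (a single-vertex digraph is a block). $D$ is Eulerian if $d_D^+(v)=d_D^-(v)$ for every vertex $v$ (connectedness is not part of this definition). A bidirected graph is a digraph obtained from a simple undirected graph by replacing each edge by two opposite arcs; thus a bidirected complete graph comes from $K_n$ and a bidirected cycle of odd length from a cycle of odd length $\geq 3$. Degeneracy and partitions: for $h:V(D)\to\mathbb{N}_0$, a digraph $D$ is weakly $h$-degenerate if every non-empty subdigraph $D'$ of $D$ contains a vertex $v$ with $\min\{d_{D'}^+(v),d_{D'}^-(v)\}<h(v)$. A $p$-partition of $D$ is a sequence $(D_1,\ldots,D_p)$ of pairwise disjoint (possibly empty) induced subdigraphs of $D$ with $V(D)=V(D_1)\cup\ldots\cup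 V(D_p)$. For $f=(f_1,\ldots,f_p):V(D)\to\mathbb{N}_0^p$, an $f$-partition of $D$ is a $p$-partition $(D_1,\ldots,D_p)$ such that $D_i$ is weakly $f_i$-degenerate (with $f_i$ restricted to $V(D_i)$) for all $i\in\{1,\ldots,p\}$. $D$ is $f$-partitionable if it admits an $f$-partition. Hard pairs (defined recursively): for a connected digraph $D$ and $f:V(D)\to\mathbb{N}_0^p$, $(D,f)$ is a hard pair (and $D$ is $f$-hard) if one of the following holds. (H1) [type (M)] $D$ is a block, $D$ is Eulerian, and there is an index $j\in\{1,\ldots,p\}$ such that for every $v\in V(D)$, $f_j(v)=d_D^+(v)=d_D^-(v)$ and $f_i(v)=0$ for all $i\neq j$. (H2) [type (K)] $D$ is a bidirected complete graph and there are integers $n_1,\ldots,n_p\geq 0$, at least two of them non-zero, such that $n_1+\ldots+n_p=|D|-1$ and $f(v)=(n_1,\ldots,n_p)$ for all $v\in V(D)$. (H3) [type (C)] $D$ is a bidirected cycle of odd length and there are two indices $k\neq\ell$ in $\{1,\ldots,p\}$ such that for every $v\in V(D)$, $f_i(v)=1$ if $i\in\{k,\ell\}$ and $f_i(v)=0$ otherwise. (H4) [merging] There are two hard pairs $(D^1,f^1)$ and $(D^2,f^2)$ (with $D^1,D^2$ disjoint and $f^j:V(D^j)\to\mathbb{N}_0^p$) such that $D$ is obtained from $D^1$ and $D^2$ by identifying a vertex $v^1\in V(D^1)$ and a vertex $v^2\in V(D^2)$ to a new vertex $v$, and $f(w)=f^1(w)$ for $w\in V(D^1)\setminus\{v^1\}$,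 $f(w)=f^2(w)$ for $w\in V(D^2)\setminus\{v^2\}$, and $f(v)=f^1(v^1)+f^2(v^2)$. *)

theory Defs
  imports "Graph_Theory.Graph_Theory" "HOL-Library.Disjoint_Sets"
begin

text \<open>
  Finite digraphs without loops and parallel arcs, with opposite arcs allowed, are the
  \<^locale>\<open>pair_digraph\<close>s. The library's \<^const>\<open>connected\<close> refers to the underlying undirected graph
  and excludes the digraph without vertices.

  A vector function with \<open>p\<close> components is represented as \<open>f :: nat \<Rightarrow> 'a \<Rightarrow> nat\<close>, where
  \<open>f i\<close> is the \<open>i\<close>-th component; only indices \<open>i \<in> {1..p}\<close> and arguments in the vertex set
  are ever relevant.
\<close>

definition separating_vertex :: "'a pair_pre_digraph \<Rightarrow> 'a \<Rightarrow> bool" where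
  "separating_vertex D v \<longleftrightarrow> v \<in> pverts D
     \<and> verts (pre_digraph.del_vert (with_proj D) v) \<noteq> {}
     \<and> \<not> connected (pre_digraph.del_vert (with_proj D) v)"

definition block :: "'a pair_pre_digraph \<Rightarrow> bool" where
  "block D \<longleftrightarrow> connected (with_proj D) \<and> (\<nexists>v. separating_vertex D v)"

definition eulerian :: "'a pair_pre_digraph \<Rightarrow> bool" where
  "eulerian D \<longleftrightarrow> (\<forall>v \<in> pverts D. out_degree (with_proj D) v = in_degree (with_proj D) v)"

definition bidirected_complete :: "'a pair_pre_digraph \<Rightarrow> bool" where
  "bidirected_complete D \<longleftrightarrow> complete_digraph (card (pverts D)) (with_proj D)"

definition bidirected_cycle :: "nat \<Rightarrow> 'a pair_pre_digraph \<Rightarrow> bool" where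
  "bidirected_cycle n D \<longleftrightarrow> n \<ge> 3 \<and>
     (\<exists>vs. distinct vs \<and> length vs = n \<and> pverts D = set vs \<and>
       parcs D = (\<Union>i<n. {(vs ! i, vs ! (Suc i mod n)), (vs ! (Suc i mod n), vs ! i)}))"

definition weakly_degenerate :: "'a pair_pre_digraph \<Rightarrow> ('a \<Rightarrow> nat) \<Rightarrow> bool" where
  "weakly_degenerate D h \<longleftrightarrow>
     (\<forall>D' :: 'a pair_pre_digraph. subgraph (with_proj D') (with_proj D) \<and> pverts D' \<noteq> {} \<longrightarrow>
       (\<exists>v \<in> pverts D'. min (out_degree (with_proj D') v) (in_degree (with_proj D') v) < h v))"

definition digraph_partition ::
    "nat \<Rightarrow> 'a pair_pre_digraph \<Rightarrow> (nat \<Rightarrow> 'a pair_pre_digraph) \<Rightarrow> bool" where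
  "digraph_partition p D Ds \<longleftrightarrow>
     (\<forall>i \<in> {1..p}. induced_subgraph (with_proj (Ds i)) (with_proj D)) \<and>
     disjoint_family_on (\<lambda>i. pverts (Ds i)) {1..p} \<and>
     pverts D = (\<Union>i \<in> {1..p}. pverts (Ds i))"

definition partitionable :: "nat \<Rightarrow> 'a pair_pre_digraph \<Rightarrow> (nat \<Rightarrow> 'a \<Rightarrow> nat) \<Rightarrow> bool" where
  "partitionable p D f \<longleftrightarrow>
     (\<exists>Ds. digraph_partition p D Ds \<and> (\<forall>i \<in> {1..p}. weakly_degenerate (Ds i) (f i)))"

text \<open>
  \<open>identification D1 v1 \<phi>1 D2 v2 \<phi>2 D v\<close>: \<open>D\<close> arises from disjoint copies of \<open>D1\<close> and \<open>D2\<close>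
  by identifying \<open>v1\<close> and \<open>v2\<close> to \<open>v\<close>, where \<open>\<phi>1\<close> and \<open>\<phi>2\<close> map the vertices of the two
  digraphs to the vertices of \<open>D\<close> they become. With these explicit maps the vertex sets of \<open>D1\<close>
  and \<open>D2\<close> need not be disjoint as subsets of the vertex type, which might be too small for that.
\<close>

definition identification ::
    "'a pair_pre_digraph \<Rightarrow> 'a \<Rightarrow> ('a \<Rightarrow> 'a) \<Rightarrow> 'a pair_pre_digraph \<Rightarrow> 'a \<Rightarrow> ('a \<Rightarrow> 'a)
      \<Rightarrow> 'a pair_pre_digraph \<Rightarrow> 'a \<Rightarrow> bool" where
  "identification D1 v1 \<phi>1 D2 v2 \<phi>2 D v \<longleftrightarrow>
     v1 \<in> pverts D1 \<and> v2 \<in> pverts D2 \<and> \<phi>1 v1 = v \<and> \<phi>2 v2 = v \<and>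
     inj_on \<phi>1 (pverts D1) \<and> inj_on \<phi>2 (pverts D2) \<and>
     \<phi>1 ` pverts D1 \<inter> \<phi>2 ` pverts D2 = {v} \<and>
     pverts D = \<phi>1 ` pverts D1 \<union> \<phi>2 ` pverts D2 \<and>
     parcs D = map_prod \<phi>1 \<phi>1 ` parcs D1 \<union> map_prod \<phi>2 \<phi>2 ` parcs D2"

inductive hard_pair :: "nat \<Rightarrow> 'a pair_pre_digraph \<Rightarrow> (nat \<Rightarrow> 'a \<Rightarrow> nat) \<Rightarrow> bool"
  for p :: nat where
  type_M: "hard_pair p D f"
    if "pair_digraph D" and "block D" and "eulerian D" and "j \<in> {1..p}"
      and "\<forall>v \<in> pverts D. f j v = out_degree (with_proj D) v \<and> f j v = in_degree (with_proj D) v \<and>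
             (\<forall>i \<in> {1..p} - {j}. f i v = 0)"
| type_K: "hard_pair p D f"
    if "bidirected_complete D" and "card {i \<in> {1..p}. ns i \<noteq> 0} \<ge> 2"
      and "(\<Sum>i = 1..p. ns i) = card (pverts D) - 1"
      and "\<forall>v \<in> pverts D. \<forall>i \<in> {1..p}. f i v = ns i"
| type_C: "hard_pair p D f"
    if "bidirected_cycle n D" and "odd n" and "k \<in> {1..p}" and "l \<in> {1..p}" and "k \<noteq> l"
      and "\<forall>v \<in> pverts D. \<forall>i \<in> {1..p}. f i v = (if i \<in> {k, l} then 1 else 0)"
| merge: "hard_pair p D f"
    if "hard_pair p D1 f1" and "hard_pair p D2 f2"
      and "identification D1 v1 \<phi>1 D2 v2 \<phi>2 D v"
      and "\<forall>i \<in> {1..p}. \<forall>w \<in> pverts D1 - {v1}. f i (\<phi>1 w) = f1 i w"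
      and "\<forall>i \<in> {1..p}. \<forall>w \<in> pverts D2 - {v2}. f i (\<phi>2 w) = f2 i w"
      and "\<forall>i \<in> {1..p}. f i v = f1 i v1 + f2 i v2"

text \<open>
  Hard pairs are only meant for connected digraphs. The rules \<open>type_K\<close>, \<open>type_C\<close> and \<open>merge\<close>
  do not demand this explicitly, as it follows from their premises.
\<close>

lemma connected_pair_iff:
  "connected (with_proj D) \<longleftrightarrow> pverts D \<noteq> {} \<and>
     (\<forall>u \<in> pverts D. \<forall>v \<in> pverts D. (u, v) \<in> rtrancl_on (pverts D) (parcs D \<union> (parcs D)\<inverse>))"
proof -
  have "parcs (mk_symmetric (with_proj D)) = parcs D \<union> (parcs D)\<inverse>"
    by (auto simp: parcs_mk_symmetric)
  then show ?thesis
    by (simp add: connected_def strongly_connected_def reachable_def)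
qed

lemma rtrancl_on_map:
  assumes "(x, y) \<in> rtrancl_on A r"
    and "\<phi> ` A \<subseteq> B" and "\<And>a b. (a, b) \<in> r \<Longrightarrow> (\<phi> a, \<phi> b) \<in> s"
  shows "(\<phi> x, \<phi> y) \<in> rtrancl_on B s"
  using assms(1)
proof (induction rule: rtrancl_on_induct)
  case base then show ?case using assms(2) by auto
next
  case (step y z)
  then show ?case using assms(2,3) by (auto intro: rtrancl_on_into_rtrancl_on)
qed

lemma identification_digraph:
  assumes id: "identification D1 v1 \<phi>1 D2 v2 \<phi>2 D v"
    and D1: "pair_digraph D1" "connected (with_proj D1)"
    and D2: "pair_digraph D2" "connected (with_proj D2)"
  shows "pair_digraph D \<and> connected (with_proj D)"
proof
  interpret D1: pair_digraph D1 by fact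
  interpret D2: pair_digraph D2 by fact
  note id' = id[unfolded identification_def]
  show "pair_digraph D"
  proof
    show "fst e \<in> pverts D" "snd e \<in> pverts D" if "e \<in> parcs D" for e
      using that id' by (auto dest: D1.wellformed' D2.wellformed')
    show "finite (pverts D)" "finite (parcs D)"
      using id' D1.pair_finite_verts D2.pair_finite_verts D1.pair_finite_arcs D2.pair_finite_arcs
      by auto
    show "fst e \<noteq> snd e" if "e \<in> parcs D" for e
    proof -
      from that id' consider a b where "(a, b) \<in> parcs D1" "e = (\<phi>1 a, \<phi>1 b)"
        | a b where "(a, b) \<in> parcs D2" "e = (\<phi>2 a, \<phi>2 b)" by auto
      then show ?thesis
      proof cases
        case 1
        then show ?thesis using id' D1.no_loops' D1.wellformed' by (fastforce dest: inj_onD)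
      next
        case 2
        then show ?thesis using id' D2.no_loops' D2.wellformed' by (fastforce dest: inj_onD)
      qed
    qed
  qed
  let ?r = "rtrancl_on (pverts D) (parcs D \<union> (parcs D)\<inverse>)"
  have 1: "(\<phi>1 x, \<phi>1 y) \<in> ?r" if "x \<in> pverts D1" "y \<in> pverts D1" for x y
  proof (rule rtrancl_on_map[where \<phi> = \<phi>1])
    show "(x, y) \<in> rtrancl_on (pverts D1) (parcs D1 \<union> (parcs D1)\<inverse>)"
      using D1(2) that unfolding connected_pair_iff by blast
    show "\<phi>1 ` pverts D1 \<subseteq> pverts D"
      using id' by blast
    have "(\<phi>1 a, \<phi>1 b) \<in> parcs D" if "(a, b) \<in> parcs D1" for a b
    proof -
      have "map_prod \<phi>1 \<phi>1 (a, b) \<in> parcs D" using that id' by blast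
      then show ?thesis by simp
    qed
    then show "(\<phi>1 a, \<phi>1 b) \<in> parcs D \<union> (parcs D)\<inverse>"
      if "(a, b) \<in> parcs D1 \<union> (parcs D1)\<inverse>" for a b
      using that by blast
  qed
  have 2: "(\<phi>2 x, \<phi>2 y) \<in> ?r" if "x \<in> pverts D2" "y \<in> pverts D2" for x y
  proof (rule rtrancl_on_map[where \<phi> = \<phi>2])
    show "(x, y) \<in> rtrancl_on (pverts D2) (parcs D2 \<union> (parcs D2)\<inverse>)"
      using D2(2) that unfolding connected_pair_iff by blast
    show "\<phi>2 ` pverts D2 \<subseteq> pverts D"
      using id' by blast
    have "(\<phi>2 a, \<phi>2 b) \<in> parcs D" if "(a, b) \<in> parcs D2" for a b
    proof -
      have "map_prod \<phi>2 \<phi>2 (a, b) \<in> parcs D" using that id' by blast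
      then show ?thesis by simp
    qed
    then show "(\<phi>2 a, \<phi>2 b) \<in> parcs D \<union> (parcs D)\<inverse>"
      if "(a, b) \<in> parcs D2 \<union> (parcs D2)\<inverse>" for a b
      using that by blast
  qed
  have v: "v1 \<in> pverts D1" "v2 \<in> pverts D2" "\<phi>1 v1 = v" "\<phi>2 v2 = v"
    and D: "pverts D = \<phi>1 ` pverts D1 \<union> \<phi>2 ` pverts D2"
    using id' by simp_all
  have "(x, v) \<in> ?r \<and> (v, x) \<in> ?r" if x: "x \<in> pverts D" for x
  proof -
    from x D consider a where "a \<in> pverts D1" "x = \<phi>1 a" | b where "b \<in> pverts D2" "x = \<phi>2 b"
      by auto
    then show ?thesis
      by cases (use 1 2 v in metis)+
  qed
  moreover have "pverts D \<noteq> {}"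
    using v D by auto
  ultimately show "connected (with_proj D)"
    unfolding connected_pair_iff by (blast intro: rtrancl_on_trans)
qed

lemma bidirected_complete_digraph:
  assumes "bidirected_complete D" and "pverts D \<noteq> {}"
  shows "pair_digraph D \<and> connected (with_proj D)"
proof
  interpret graph "with_proj D"
    using assms(1) by (simp add: bidirected_complete_def complete_digraph_def)
  show "pair_digraph D"
    using finite_verts finite_arcs no_loops wellformed by unfold_locales auto
  have "parcs D = {(u, v). (u, v) \<in> pverts D \<times> pverts D \<and> u \<noteq> v}"
    using assms(1) by (simp add: bidirected_complete_def complete_digraph_def)
  then have "(u, v) \<in> rtrancl_on (pverts D) (parcs D \<union> (parcs D)\<inverse>)"
    if "u \<in> pverts D" "v \<in> pverts D" for u v
    using that by (cases "u = v") (auto intro: rtrancl_on_into_rtrancl_on)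
  then show "connected (with_proj D)"
    unfolding connected_pair_iff using assms(2) by blast
qed

lemma bidirected_cycle_digraph:
  assumes "bidirected_cycle n D"
  shows "pair_digraph D \<and> connected (with_proj D)"
proof
  from assms obtain vs where n: "n \<ge> 3" and vs: "distinct vs" "length vs = n" "pverts D = set vs"
    and arcs: "parcs D = (\<Union>i<n. {(vs ! i, vs ! (Suc i mod n)), (vs ! (Suc i mod n), vs ! i)})"
    unfolding bidirected_cycle_def by blast
  have suc: "Suc i mod n < n" for i using n by simp
  have ne: "vs ! i \<noteq> vs ! (Suc i mod n)" if "i < n" for i
    using that n vs suc[of i] by (auto simp: nth_eq_iff_index_eq mod_Suc)
  show "pair_digraph D"
  proof
    show "fst e \<in> pverts D" "snd e \<in> pverts D" if "e \<in> parcs D" for e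
      using that suc vs unfolding arcs by auto
    show "finite (pverts D)" "finite (parcs D)"
      using vs unfolding arcs by auto
    show "fst e \<noteq> snd e" if "e \<in> parcs D" for e
      using that ne unfolding arcs by fastforce
  qed
  let ?r = "rtrancl_on (pverts D) (parcs D \<union> (parcs D)\<inverse>)"
  have reach: "(vs ! 0, vs ! i) \<in> ?r \<and> (vs ! i, vs ! 0) \<in> ?r" if "i < n" for i
    using that
  proof (induction i)
    case 0
    then show ?case using vs n by auto
  next
    case (Suc i)
    then have *: "Suc i mod n = Suc i" by simp
    have "(vs ! i, vs ! Suc i) \<in> parcs D" "(vs ! Suc i, vs ! i) \<in> parcs D"
      unfolding arcs using Suc.prems * by (fastforce intro: bexI[of _ i])+
    then have "(vs ! i, vs ! Suc i) \<in> parcs D \<union> (parcs D)\<inverse>"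
      "(vs ! Suc i, vs ! i) \<in> parcs D \<union> (parcs D)\<inverse>" by auto
    moreover have "vs ! Suc i \<in> pverts D" using Suc.prems vs by auto
    ultimately show ?case using Suc
      by (auto intro: rtrancl_on_into_rtrancl_on converse_rtrancl_on_into_rtrancl_on)
  qed
  have "(x, vs ! 0) \<in> ?r \<and> (vs ! 0, x) \<in> ?r" if "x \<in> pverts D" for x
    using that reach vs by (auto simp: in_set_conv_nth)
  moreover have "pverts D \<noteq> {}" using vs n by auto
  ultimately show "connected (with_proj D)"
    unfolding connected_pair_iff by (blast intro: rtrancl_on_trans)
qed

lemma hard_pair_digraph:
  "hard_pair p D f \<Longrightarrow> pair_digraph D \<and> connected (with_proj D)"
proof (induction rule: hard_pair.induct)
  case (type_M D j f)
  then show ?case by (simp add: block_def)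
next
  case (type_K D ns f)
  have "pverts D \<noteq> {}"
  proof
    assume "pverts D = {}"
    with type_K have none: "{i \<in> {1..p}. ns i \<noteq> 0} = {}" by auto
    show False using type_K(2) unfolding none by simp
  qed
  with type_K show ?case using bidirected_complete_digraph by blast
next
  case (type_C n D k l f)
  then show ?case using bidirected_cycle_digraph by blast
next
  case merge
  then show ?case by (intro identification_digraph[OF merge.hyps(3)]) simp_all
qed

end

theory Submission
  imports Defs
begin

text \<open>
  An \<open>f\<close>-partition is treated as a colouring of the vertices with \<open>p\<close> colours in which every
  non-empty set \<open>T\<close> of vertices of colour \<open>i\<close> has a vertex whose out-degree or in-degree inside
  \<open>T\<close> is smaller than its budget \<open>f i\<close>.

  Hard pairs admit no such colouring: for the three basic types by counting, and for a merged pair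
  because the two colour classes that fail on the two sides meet in the merged vertex, where
  degrees and budgets both add up (\<open>merge_not_colorable\<close>).

  Conversely, let \<open>D\<close> be connected, with budgets summing up to at least the degrees, and not
  colourable. Greedy colouring shows that there is no slack: the budgets at a vertex sum up exactly to its
  out-degree and to its in-degree, and \<open>D - z\<close> is colourable for every \<open>z\<close>. Call \<open>z\<close> the
  hole of such a colouring. The hole sees exactly \<open>f i z\<close> out-neighbours and \<open>f i z\<close>
  in-neighbours of colour \<open>i\<close> (\<open>hole_degree\<close>), and therefore it can be moved to any
  neighbour \<open>u\<close> by giving \<open>z\<close> the colour of \<open>u\<close> (\<open>hole_move\<close>). All structure is read off from
  moving the hole around.

  If \<open>D\<close> has a separating vertex, the hole placed there shows how its budget is to be shared
  between the two sides; both sides are again uncolourable, and induction applies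
  (\<open>split_at_separating_vertex\<close>).

  Let \<open>D\<close> be a block. If the hole never sees two colours, all vertices have their whole budget in
  the same colour, which is type (M). Otherwise some induced cycle through the hole carries two
  colours. Driving the hole once around an induced cycle moves every colour on it by one vertex,
  while the hole must see the same numbers of colours as before. This forces the cycle to be odd and
  bidirected, with two alternating colours (\<open>alternating_rotation\<close>). Two such cycles can hardly
  overlap, because rotating one of them destroys the alternation on the other (\<open>no_ear\<close>,
  \<open>no_triangle_on_long_cycle\<close>). Hence a two-coloured cycle of length at least five is all of
  \<open>D\<close> and gives type (C). A two-coloured triangle lies in a largest two-coloured clique; an ear
  of this clique would either be excluded or enlarge it, so it is all of \<open>D\<close> and gives type (K).
\<close>

section \<open>Degenerate vertex sets and colourings\<close>

text \<open>
  Out-degrees and in-degrees inside a vertex set are the two instances \<open>R = E\<close> and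
  \<open>R = E\<inverse>\<close>, so that statements about both directions are proved once, for
  \<open>R \<in> {E, E\<inverse>}\<close>.
\<close>

definition deg :: "('a \<times> 'a) set \<Rightarrow> 'a set \<Rightarrow> 'a \<Rightarrow> nat" where
  "deg R T v = card {u \<in> T. (v, u) \<in> R}"

definition degenerate_on :: "('a \<times> 'a) set \<Rightarrow> 'a set \<Rightarrow> ('a \<Rightarrow> nat) \<Rightarrow> bool" where
  "degenerate_on E S h \<longleftrightarrow>
     (\<forall>T \<subseteq> S. T \<noteq> {} \<longrightarrow> (\<exists>v \<in> T. deg E T v < h v \<or> deg (E\<inverse>) T v < h v))"

definition f_coloring ::
    "nat \<Rightarrow> ('a \<times> 'a) set \<Rightarrow> (nat \<Rightarrow> 'a \<Rightarrow> nat) \<Rightarrow> 'a set \<Rightarrow> ('a \<Rightarrow> nat) \<Rightarrow> bool" where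
  "f_coloring p E f U \<phi> \<longleftrightarrow> (\<forall>u \<in> U. \<phi> u \<in> {1..p}) \<and>
     (\<forall>i \<in> {1..p}. degenerate_on E {u \<in> U. \<phi> u = i} (f i))"

lemma deg_mono: "finite T' \<Longrightarrow> T \<subseteq> T' \<Longrightarrow> R \<subseteq> R' \<Longrightarrow> deg R T v \<le> deg R' T' v"
  unfolding deg_def by (rule card_mono) auto

lemma deg_cong: "(\<And>u. u \<in> T \<Longrightarrow> (v, u) \<in> R \<longleftrightarrow> (v, u) \<in> R') \<Longrightarrow> deg R T v = deg R' T v"
  unfolding deg_def by (rule arg_cong[where f = card]) auto

lemma degenerate_on_mono: "degenerate_on E S h \<Longrightarrow> S' \<subseteq> S \<Longrightarrow> degenerate_on E S' h"
  unfolding degenerate_on_def by (meson subset_trans)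

lemma degenerate_on_zero:
  assumes "degenerate_on E S h" and "\<And>v. v \<in> S \<Longrightarrow> h v = 0"
  shows "S = {}"
proof (rule ccontr)
  assume "S \<noteq> {}"
  then obtain v where "v \<in> S" "deg E S v < h v \<or> deg (E\<inverse>) S v < h v"
    using assms(1) unfolding degenerate_on_def by blast
  then show False using assms(2) by auto
qed

lemma out_degree_eq_deg:
  assumes "pair_wf_digraph D"
  shows "out_degree (with_proj D) v = deg (parcs D) (pverts D) v"
proof -
  interpret pair_wf_digraph D by fact
  have "out_arcs (with_proj D) v = Pair v ` {u \<in> pverts D. (v, u) \<in> parcs D}"
    using in_arcsD2 by (auto simp: out_arcs_def)
  then show ?thesis
    unfolding out_degree_def deg_def by (simp add: card_image inj_on_def)
qed

lemma in_degree_eq_deg: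
  assumes "pair_wf_digraph D"
  shows "in_degree (with_proj D) v = deg ((parcs D)\<inverse>) (pverts D) v"
proof -
  interpret pair_wf_digraph D by fact
  have "in_arcs (with_proj D) v = (\<lambda>u. (u, v)) ` {u \<in> pverts D. (v, u) \<in> (parcs D)\<inverse>}"
    using in_arcsD1 by (auto simp: in_arcs_def)
  then show ?thesis
    unfolding in_degree_def deg_def by (simp add: card_image inj_on_def)
qed

text \<open>
  Deleting arcs only lowers degrees, so among all subdigraphs on a given vertex set the induced one is the
  critical test. Weak degeneracy thus becomes a property of vertex sets.
\<close>

lemma weakly_degenerate_induced_iff:
  assumes D: "pair_fin_digraph D" and H: "induced_subgraph (with_proj H) (with_proj D)"
  shows "weakly_degenerate H h \<longleftrightarrow> degenerate_on (parcs D) (pverts H) h"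
proof -
  interpret pair_fin_digraph D by fact
  have sub: "pverts H \<subseteq> pverts D"
    and arcs: "parcs H = {e \<in> parcs D. fst e \<in> pverts H \<and> snd e \<in> pverts H}"
    and wf: "wf_digraph (with_proj H)"
    using H by (auto simp: induced_subgraph_def subgraph_def)
  show ?thesis
  proof
    assume deg: "weakly_degenerate H h"
    show "degenerate_on (parcs D) (pverts H) h"
      unfolding degenerate_on_def
    proof (intro allI impI)
      fix T assume T: "T \<subseteq> pverts H" "T \<noteq> {}"
      define D' where "D' = \<lparr>pverts = T, parcs = parcs D \<inter> T \<times> T\<rparr>"
      have wf': "pair_wf_digraph D'" by unfold_locales (auto simp: D'_def)
      then have "subgraph (with_proj D') (with_proj H)"
        using wf T arcs by (auto simp: subgraph_def D'_def wf_digraph_wp_iff)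
      then obtain v where v: "v \<in> T"
        "min (out_degree (with_proj D') v) (in_degree (with_proj D') v) < h v"
        using deg T unfolding weakly_degenerate_def by (metis D'_def pair_pre_digraph.select_convs(1))
      have "deg (parcs D') T v = deg (parcs D) T v" "deg ((parcs D')\<inverse>) T v = deg ((parcs D)\<inverse>) T v"
        using v by (auto intro: deg_cong simp: D'_def)
      then have "deg (parcs D) T v < h v \<or> deg ((parcs D)\<inverse>) T v < h v"
        using v out_degree_eq_deg[OF wf', of v] in_degree_eq_deg[OF wf', of v]
        by (auto simp: D'_def min_def split: if_splits)
      with v show "\<exists>v\<in>T. deg (parcs D) T v < h v \<or> deg ((parcs D)\<inverse>) T v < h v" by blast
    qed
  next
    assume deg: "degenerate_on (parcs D) (pverts H) h"
    show "weakly_degenerate H h"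
      unfolding weakly_degenerate_def
    proof (intro allI impI, elim conjE)
      fix D' :: "'a pair_pre_digraph"
      assume D': "subgraph (with_proj D') (with_proj H)" and ne: "pverts D' \<noteq> {}"
      then have T: "pverts D' \<subseteq> pverts H" and A: "parcs D' \<subseteq> parcs D"
        and wf': "pair_wf_digraph D'"
        using arcs by (auto simp: subgraph_def wf_digraph_wp_iff)
      have fin: "finite (pverts D')"
        using T sub pair_finite_verts by (meson finite_subset)
      obtain v where "v \<in> pverts D'"
        "deg (parcs D) (pverts D') v < h v \<or> deg ((parcs D)\<inverse>) (pverts D') v < h v"
        using deg T ne unfolding degenerate_on_def by blast
      moreover have "deg (parcs D') (pverts D') v \<le> deg (parcs D) (pverts D') v"
        "deg ((parcs D')\<inverse>) (pverts D') v \<le> deg ((parcs D)\<inverse>) (pverts D') v"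
        using A fin by (auto intro!: deg_mono)
      ultimately show "\<exists>v\<in>pverts D'. min (out_degree (with_proj D') v) (in_degree (with_proj D') v) < h v"
        using out_degree_eq_deg[OF wf', of v] in_degree_eq_deg[OF wf', of v]
        by (intro bexI[of _ v]) (auto simp: min_def)
    qed
  qed
qed

lemma partitionable_iff_f_coloring:
  assumes D: "pair_digraph D"
  shows "partitionable p D f \<longleftrightarrow> (\<exists>\<phi>. f_coloring p (parcs D) f (pverts D) \<phi>)"
proof
  interpret pair_digraph D by fact
  have fin: "pair_fin_digraph D" ..
  assume "partitionable p D f"
  then obtain Ds where part: "digraph_partition p D Ds"
    and wd: "\<And>i. i \<in> {1..p} \<Longrightarrow> weakly_degenerate (Ds i) (f i)"
    unfolding partitionable_def by blast
  from part have Ds: "\<And>i. i \<in> {1..p} \<Longrightarrow> induced_subgraph (with_proj (Ds i)) (with_proj D)"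
    and cover: "pverts D = (\<Union>i \<in> {1..p}. pverts (Ds i))"
    by (simp_all add: digraph_partition_def)
  have "\<exists>i. i \<in> {1..p} \<and> u \<in> pverts (Ds i)" if "u \<in> pverts D" for u
    using cover that by blast
  then obtain \<phi> where \<phi>: "\<And>u. u \<in> pverts D \<Longrightarrow> \<phi> u \<in> {1..p} \<and> u \<in> pverts (Ds (\<phi> u))"
    by metis
  have cls: "{u \<in> pverts D. \<phi> u = i} \<subseteq> pverts (Ds i)" if "i \<in> {1..p}" for i
    using \<phi> by auto
  have "degenerate_on (parcs D) {u \<in> pverts D. \<phi> u = i} (f i)" if i: "i \<in> {1..p}" for i
    using weakly_degenerate_induced_iff[OF fin Ds[OF i]] wd[OF i] cls[OF i]
    by (blast intro: degenerate_on_mono)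
  with \<phi> have "f_coloring p (parcs D) f (pverts D) \<phi>"
    unfolding f_coloring_def by blast
  then show "\<exists>\<phi>. f_coloring p (parcs D) f (pverts D) \<phi>" by blast
next
  interpret pair_digraph D by fact
  have fin: "pair_fin_digraph D" ..
  assume "\<exists>\<phi>. f_coloring p (parcs D) f (pverts D) \<phi>"
  then obtain \<phi> where \<phi>: "f_coloring p (parcs D) f (pverts D) \<phi>" by blast
  define S where "S i = {u \<in> pverts D. \<phi> u = i}" for i
  define Ds where "Ds i = \<lparr>pverts = S i, parcs = parcs D \<inter> S i \<times> S i\<rparr>" for i
  have "pair_wf_digraph (Ds i)" for i by unfold_locales (auto simp: Ds_def)
  then have ind: "induced_subgraph (with_proj (Ds i)) (with_proj D)" for i
    unfolding induced_subgraph_def subgraph_def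
    by (auto simp: Ds_def S_def wf_digraph_wp_iff pair_wf_digraph)
  have "digraph_partition p D Ds"
    unfolding digraph_partition_def disjoint_family_on_def
    using ind \<phi> by (auto simp: Ds_def S_def f_coloring_def)
  moreover have "weakly_degenerate (Ds i) (f i)" if "i \<in> {1..p}" for i
    using that \<phi> weakly_degenerate_induced_iff[OF fin ind]
    by (auto simp: f_coloring_def Ds_def S_def)
  ultimately show "partitionable p D f" unfolding partitionable_def by blast
qed

section \<open>Hard pairs are not partitionable\<close>

text \<open>
  Colours other than \<open>j\<close> have budget zero and cannot be used at all; and the whole digraph is not
  degenerate for the budget \<open>f j\<close>, which equals all its degrees.
\<close>

lemma type_M_not_colorable:
  assumes ne: "V \<noteq> {}" and j: "j \<in> {1..p}"
    and f: "\<And>v. v \<in> V \<Longrightarrow> f j v = deg E V v \<and> f j v = deg (E\<inverse>) V v \<and> (\<forall>i \<in> {1..p} - {j}. f i v = 0)"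
  shows "\<not> f_coloring p E f V \<phi>"
proof
  assume col: "f_coloring p E f V \<phi>"
  have "{u \<in> V. \<phi> u = i} = {}" if "i \<in> {1..p} - {j}" for i
    using that col f by (intro degenerate_on_zero[of E _ "f i"]) (auto simp: f_coloring_def)
  then have "V = {u \<in> V. \<phi> u = j}"
    using col unfolding f_coloring_def by blast
  then have "degenerate_on E V (f j)"
    using col j unfolding f_coloring_def by metis
  then show False
    using ne f unfolding degenerate_on_def by fastforce
qed

text \<open>
  In a complete digraph a class of more than \<open>ns i\<close> vertices has all degrees at least \<open>ns i\<close>.
  So the class sizes add up to at most \<open>card V - 1\<close>.
\<close>

lemma type_K_not_colorable:
  assumes fin: "finite V" and ne: "V \<noteq> {}"
    and E: "\<And>u v. u \<in> V \<Longrightarrow> v \<in> V \<Longrightarrow> (u, v) \<in> E \<longleftrightarrow> u \<noteq> v"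
    and ns: "(\<Sum>i = 1..p. ns i) = card V - 1"
    and f: "\<And>v i. v \<in> V \<Longrightarrow> i \<in> {1..p} \<Longrightarrow> f i v = ns i"
  shows "\<not> f_coloring p E f V \<phi>"
proof
  assume col: "f_coloring p E f V \<phi>"
  have "card {u \<in> V. \<phi> u = i} \<le> ns i" if i: "i \<in> {1..p}" for i
  proof (rule ccontr)
    define S where "S = {u \<in> V. \<phi> u = i}"
    assume "\<not> card {u \<in> V. \<phi> u = i} \<le> ns i"
    then have big: "card S > ns i" by (simp add: S_def)
    then have "S \<noteq> {}" by auto
    moreover have "degenerate_on E S (f i)" using col i by (auto simp: f_coloring_def S_def)
    ultimately obtain v where v: "v \<in> S" "deg E S v < f i v \<or> deg (E\<inverse>) S v < f i v"
      unfolding degenerate_on_def by blast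
    have "{u \<in> S. (v, u) \<in> E} = S - {v}" "{u \<in> S. (u, v) \<in> E} = S - {v}"
      using v E by (auto simp: S_def)
    then have "deg E S v = card S - 1" "deg (E\<inverse>) S v = card S - 1"
      using v fin by (auto simp: deg_def S_def)
    then show False using v big f[of v i] i by (auto simp: S_def)
  qed
  then have "(\<Sum>i = 1..p. card {u \<in> V. \<phi> u = i}) \<le> card V - 1"
    unfolding ns[symmetric] by (intro sum_mono)
  moreover have "(\<Sum>i = 1..p. card {u \<in> V. \<phi> u = i}) = card (\<Union>i\<in>{1..p}. {u \<in> V. \<phi> u = i})"
    using fin by (intro card_UN_disjoint[symmetric]) auto
  moreover have "(\<Union>i\<in>{1..p}. {u \<in> V. \<phi> u = i}) = V"
    using col by (auto simp: f_coloring_def)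
  moreover have "card V > 0" using fin ne by (simp add: card_gt_0_iff)
  ultimately show False by simp
qed

text \<open>
  With budget one, two vertices joined by opposite arcs cannot share a colour; a colouring would be a
  proper 2-colouring of an odd cycle.
\<close>

lemma type_C_not_colorable:
  assumes n: "n \<ge> 3" "odd n" and vs: "distinct vs" "length vs = n" "V = set vs"
    and E: "E = (\<Union>i<n. {(vs ! i, vs ! (Suc i mod n)), (vs ! (Suc i mod n), vs ! i)})"
    and kl: "k \<in> {1..p}" "l \<in> {1..p}" "k \<noteq> l"
    and f: "\<And>v i. v \<in> V \<Longrightarrow> i \<in> {1..p} \<Longrightarrow> f i v = (if i \<in> {k, l} then 1 else 0)"
  shows "\<not> f_coloring p E f V \<phi>"
proof
  assume col: "f_coloring p E f V \<phi>"
  have two: "\<phi> u \<in> {k, l}" if "u \<in> V" for u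
  proof (rule ccontr)
    assume "\<phi> u \<notin> {k, l}"
    moreover have p: "\<phi> u \<in> {1..p}" using col that by (auto simp: f_coloring_def)
    ultimately have "{w \<in> V. \<phi> w = \<phi> u} = {}"
      using col f by (intro degenerate_on_zero[of E _ "f (\<phi> u)"]) (auto simp: f_coloring_def)
    with that show False by auto
  qed
  have diff: "\<phi> (vs ! i) \<noteq> \<phi> (vs ! (Suc i mod n))" if i: "i < n" for i
  proof
    assume same: "\<phi> (vs ! i) = \<phi> (vs ! (Suc i mod n))"
    define u w where "u = vs ! i" and "w = vs ! (Suc i mod n)"
    have arcs: "(u, w) \<in> E" "(w, u) \<in> E"
      using i unfolding E u_def w_def by blast+
    have uw: "u \<in> V" "w \<in> V" using vs i n by (auto simp: u_def w_def)
    then have p: "\<phi> u \<in> {1..p}" using col by (auto simp: f_coloring_def)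
    then have "degenerate_on E {x \<in> V. \<phi> x = \<phi> u} (f (\<phi> u))" using col by (auto simp: f_coloring_def)
    moreover have "{u, w} \<subseteq> {x \<in> V. \<phi> x = \<phi> u}" using uw same by (auto simp: u_def w_def)
    ultimately obtain x where x: "x \<in> {u, w}"
      "deg E {u, w} x < f (\<phi> u) x \<or> deg (E\<inverse>) {u, w} x < f (\<phi> u) x"
      unfolding degenerate_on_def by (metis insert_not_empty)
    have one: "f (\<phi> u) x = 1" using x two uw f p by auto
    have "deg E {u, w} x > 0" "deg (E\<inverse>) {u, w} x > 0"
      using x arcs by (auto simp: deg_def card_gt_0_iff)
    with x one show False by auto
  qed
  have alt: "\<phi> (vs ! i) = \<phi> (vs ! 0) \<longleftrightarrow> even i" if "i < n" for i
    using that
  proof (induction i)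
    case (Suc i)
    then have "\<phi> (vs ! i) \<noteq> \<phi> (vs ! Suc i)" using diff[of i] by simp
    moreover have "\<phi> (vs ! i) \<in> {k, l}" "\<phi> (vs ! Suc i) \<in> {k, l}" "\<phi> (vs ! 0) \<in> {k, l}"
      using two vs Suc.prems by auto
    moreover have "\<phi> (vs ! i) = \<phi> (vs ! 0) \<longleftrightarrow> even i" using Suc by simp
    ultimately show ?case by (metis even_Suc insertE singletonD)
  qed simp
  have "\<phi> (vs ! (n - 1)) \<noteq> \<phi> (vs ! 0)" using diff[of "n - 1"] n by simp
  then show False using alt[of "n - 1"] n by simp
qed

text \<open>
  A set that violates degeneracy for the pulled back colouring has an image with degrees at least
  as large. Since the colouring of the big digraph is valid, the violating set must contain the
  vertex \<open>v1\<close>, the only one whose budget may grow.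
\<close>

lemma pullback_violation:
  assumes fin: "finite V" and inj: "inj_on g V1" and gV: "g ` V1 \<subseteq> V"
    and arcs: "map_prod g g ` E1 \<subseteq> E"
    and f: "\<And>i w. i \<in> {1..p} \<Longrightarrow> w \<in> V1 - {v1} \<Longrightarrow> f i (g w) = f1 i w"
    and col: "f_coloring p E f V \<phi>" and v1: "v1 \<in> V1"
    and bad: "\<not> f_coloring p E1 f1 V1 (\<phi> \<circ> g)"
  shows "\<exists>T \<subseteq> V1. v1 \<in> T \<and> (\<forall>u \<in> T. \<phi> (g u) = \<phi> (g v1) \<and>
    f1 (\<phi> (g v1)) u \<le> deg E (g ` T) (g u) \<and> f1 (\<phi> (g v1)) u \<le> deg (E\<inverse>) (g ` T) (g u))"
proof -
  from bad col gV obtain i where i: "i \<in> {1..p}"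
    and nd: "\<not> degenerate_on E1 {u \<in> V1. \<phi> (g u) = i} (f1 i)"
    unfolding f_coloring_def by auto
  from nd obtain T where T: "T \<subseteq> V1" "\<forall>u \<in> T. \<phi> (g u) = i" "T \<noteq> {}"
    and high: "\<And>u. u \<in> T \<Longrightarrow> f1 i u \<le> deg E1 T u \<and> f1 i u \<le> deg (E1\<inverse>) T u"
    unfolding degenerate_on_def by (auto simp: not_less subset_iff)
  have injT: "inj_on g T" using inj T(1) by (rule inj_on_subset)
  have finT: "finite (g ` T)" using fin gV T(1) by (meson finite_subset image_mono)
  have le: "deg R1 T u \<le> deg R (g ` T) (g u)" if "u \<in> T" "map_prod g g ` R1 \<subseteq> R" for R1 R u
  proof -
    have "card {w \<in> T. (u, w) \<in> R1} = card (g ` {w \<in> T. (u, w) \<in> R1})"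
      by (rule card_image[symmetric]) (rule inj_on_subset[OF injT], auto)
    also have "\<dots> \<le> card {w \<in> g ` T. (g u, w) \<in> R}"
      using finT that by (intro card_mono) force+
    finally show ?thesis by (simp add: deg_def)
  qed
  have "map_prod g g ` (E1\<inverse>) \<subseteq> E\<inverse>" using arcs by force
  with le arcs high have high': "f1 i u \<le> deg E (g ` T) (g u) \<and> f1 i u \<le> deg (E\<inverse>) (g ` T) (g u)"
    if "u \<in> T" for u using that by (meson order_trans)
  have "v1 \<in> T"
  proof (rule ccontr)
    assume "v1 \<notin> T"
    have "g ` T \<subseteq> {u \<in> V. \<phi> u = i}" using T gV by auto
    moreover have "degenerate_on E {u \<in> V. \<phi> u = i} (f i)" using col i by (auto simp: f_coloring_def)
    moreover have "g ` T \<noteq> {}" using T(3) by simp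
    ultimately obtain u where u: "u \<in> T" "deg E (g ` T) (g u) < f i (g u) \<or> deg (E\<inverse>) (g ` T) (g u) < f i (g u)"
      unfolding degenerate_on_def by (metis (no_types, lifting) imageE)
    have "f i (g u) = f1 i u" using f i u \<open>v1 \<notin> T\<close> T(1) by auto
    with high'[OF u(1)] u(2) show False by auto
  qed
  moreover from this T(2) have "i = \<phi> (g v1)" by simp
  ultimately show ?thesis using T(1,2) high' by blast
qed

text \<open>
  Both sides have a violating set containing the merged vertex, and these sets have the same
  colour. Their union violates degeneracy, because at the merged vertex the degrees in the two sets
  add up just as the budgets do.
\<close>

lemma merge_not_colorable:
  assumes id: "identification D1 v1 g1 D2 v2 g2 D v"
    and wf: "pair_digraph D" "pair_digraph D1" "pair_digraph D2"
    and f1: "\<forall>i \<in> {1..p}. \<forall>w \<in> pverts D1 - {v1}. f i (g1 w) = f1 i w"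
    and f2: "\<forall>i \<in> {1..p}. \<forall>w \<in> pverts D2 - {v2}. f i (g2 w) = f2 i w"
    and fv: "\<forall>i \<in> {1..p}. f i v = f1 i v1 + f2 i v2"
    and nc1: "\<And>\<phi>. \<not> f_coloring p (parcs D1) f1 (pverts D1) \<phi>"
    and nc2: "\<And>\<phi>. \<not> f_coloring p (parcs D2) f2 (pverts D2) \<phi>"
  shows "\<not> f_coloring p (parcs D) f (pverts D) \<phi>"
proof
  assume col: "f_coloring p (parcs D) f (pverts D) \<phi>"
  interpret D: pair_digraph D by fact
  interpret D1: pair_digraph D1 by fact
  interpret D2: pair_digraph D2 by fact
  let ?E = "parcs D"
  have v: "v1 \<in> pverts D1" "v2 \<in> pverts D2" "g1 v1 = v" "g2 v2 = v"
    and inj: "inj_on g1 (pverts D1)" "inj_on g2 (pverts D2)"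
    and int: "g1 ` pverts D1 \<inter> g2 ` pverts D2 = {v}"
    and V: "pverts D = g1 ` pverts D1 \<union> g2 ` pverts D2"
    and E: "?E = map_prod g1 g1 ` parcs D1 \<union> map_prod g2 g2 ` parcs D2"
    using id by (simp_all add: identification_def)
  define i where "i = \<phi> v"
  have vD: "v \<in> pverts D" using v V by auto
  have i: "i \<in> {1..p}" using col vD by (auto simp: f_coloring_def i_def)
  have fg1: "f i (g1 w) = f1 i w" if "i \<in> {1..p}" "w \<in> pverts D1 - {v1}" for i w
    using f1 that by blast
  have fg2: "f i (g2 w) = f2 i w" if "i \<in> {1..p}" "w \<in> pverts D2 - {v2}" for i w
    using f2 that by blast
  have sub1: "g1 ` pverts D1 \<subseteq> pverts D" "map_prod g1 g1 ` parcs D1 \<subseteq> ?E"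
    and sub2: "g2 ` pverts D2 \<subseteq> pverts D" "map_prod g2 g2 ` parcs D2 \<subseteq> ?E"
    unfolding V E by blast+
  obtain T1 where T1: "T1 \<subseteq> pverts D1" "v1 \<in> T1" "\<forall>u \<in> T1. \<phi> (g1 u) = i"
    "\<forall>u \<in> T1. f1 i u \<le> deg ?E (g1 ` T1) (g1 u) \<and> f1 i u \<le> deg (?E\<inverse>) (g1 ` T1) (g1 u)"
    using pullback_violation[OF D.pair_finite_verts inj(1) sub1 fg1 col v(1) nc1]
    unfolding v i_def by blast
  obtain T2 where T2: "T2 \<subseteq> pverts D2" "v2 \<in> T2" "\<forall>u \<in> T2. \<phi> (g2 u) = i"
    "\<forall>u \<in> T2. f2 i u \<le> deg ?E (g2 ` T2) (g2 u) \<and> f2 i u \<le> deg (?E\<inverse>) (g2 ` T2) (g2 u)"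
    using pullback_violation[OF D.pair_finite_verts inj(2) sub2 fg2 col v(2) nc2]
    unfolding v i_def by blast
  define T where "T = g1 ` T1 \<union> g2 ` T2"
  have TV: "T \<subseteq> {u \<in> pverts D. \<phi> u = i}" using T1 T2 V by (auto simp: T_def)
  have fin: "finite T" using TV D.pair_finite_verts by (auto intro: finite_subset)
  have "degenerate_on ?E {u \<in> pverts D. \<phi> u = i} (f i)"
    using col i by (auto simp: f_coloring_def)
  moreover have "T \<noteq> {}" using T1 by (auto simp: T_def)
  ultimately obtain u where u: "u \<in> T" "deg ?E T u < f i u \<or> deg (?E\<inverse>) T u < f i u"
    using TV unfolding degenerate_on_def by blast
  have sub: "deg R (g1 ` T1) w \<le> deg R T w" "deg R (g2 ` T2) w \<le> deg R T w" for R w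
    using fin by (auto intro!: deg_mono simp: T_def)
  show False
  proof (cases "u = v")
    case True
    have add: "deg R (g1 ` T1) v + deg R (g2 ` T2) v \<le> deg R T v" if "(v, v) \<notin> R" for R
    proof -
      have "g1 ` T1 \<inter> g2 ` T2 \<subseteq> {v}" using int T1(1) T2(1) by blast
      then have disj: "{u \<in> g1 ` T1. (v, u) \<in> R} \<inter> {u \<in> g2 ` T2. (v, u) \<in> R} = {}"
        using that by blast
      have "card {u \<in> g1 ` T1. (v, u) \<in> R} + card {u \<in> g2 ` T2. (v, u) \<in> R} =
            card ({u \<in> g1 ` T1. (v, u) \<in> R} \<union> {u \<in> g2 ` T2. (v, u) \<in> R})"
        using fin disj by (intro card_Un_disjoint[symmetric]) (simp_all add: T_def)
      also have "\<dots> \<le> card {u \<in> T. (v, u) \<in> R}"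
        using fin by (intro card_mono) (auto simp: T_def)
      finally show ?thesis by (simp add: deg_def)
    qed
    have "(v, v) \<notin> ?E" "(v, v) \<notin> ?E\<inverse>" using D.no_loops' by auto
    note add[OF this(1)] add[OF this(2)]
    moreover have "f i v = f1 i v1 + f2 i v2" using fv i by blast
    moreover have "f1 i v1 \<le> deg ?E (g1 ` T1) v" "f1 i v1 \<le> deg (?E\<inverse>) (g1 ` T1) v"
      "f2 i v2 \<le> deg ?E (g2 ` T2) v" "f2 i v2 \<le> deg (?E\<inverse>) (g2 ` T2) v"
      using T1(2,4) T2(2,4) v by metis+
    ultimately have "f i v \<le> deg ?E T v" "f i v \<le> deg (?E\<inverse>) T v"
      by linarith+
    then show False using u True by auto
  next
    case False
    with u(1) consider w where "w \<in> T1" "w \<noteq> v1" "u = g1 w" | w where "w \<in> T2" "w \<noteq> v2" "u = g2 w"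
      using v by (auto simp: T_def)
    then show False
    proof cases
      case 1
      then have "f i u = f1 i w" using f1 i T1(1) by auto
      with 1 T1(4) u(2) sub(1) show False by (metis leD order_trans)
    next
      case 2
      then have "f i u = f2 i w" using f2 i T2(1) by auto
      with 2 T2(4) u(2) sub(2) show False by (metis leD order_trans)
    qed
  qed
qed

lemma hard_pair_not_partitionable:
  assumes "hard_pair p D f"
  shows "\<not> partitionable p D f"
proof -
  have "\<nexists>\<phi>. f_coloring p (parcs D) f (pverts D) \<phi>"
    using assms
  proof (induction rule: hard_pair.induct)
    case (type_M D j f)
    then interpret pair_digraph D by simp
    have ne: "pverts D \<noteq> {}" using type_M(2) by (auto simp: block_def connected_pair_iff)
    have "f j v = deg (parcs D) (pverts D) v \<and> f j v = deg ((parcs D)\<inverse>) (pverts D) v \<and>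
        (\<forall>i \<in> {1..p} - {j}. f i v = 0)" if "v \<in> pverts D" for v
      using type_M(5) that
      unfolding out_degree_eq_deg[OF pair_wf_digraph] in_degree_eq_deg[OF pair_wf_digraph] by blast
    then show ?case using type_M_not_colorable[OF ne type_M(4)] by blast
  next
    case (type_K D ns f)
    then have "pverts D \<noteq> {}"
      using hard_pair_digraph[OF hard_pair.type_K[OF type_K]] by (simp add: connected_pair_iff)
    moreover have "finite (pverts D)" "parcs D = {(u, v). (u, v) \<in> pverts D \<times> pverts D \<and> u \<noteq> v}"
      using type_K(1) by (auto simp: bidirected_complete_def complete_digraph_pair_def)
    moreover from this have "(u, v) \<in> parcs D \<longleftrightarrow> u \<noteq> v"
      if "u \<in> pverts D" "v \<in> pverts D" for u v using that by blast
    moreover have "f i v = ns i" if "v \<in> pverts D" "i \<in> {1..p}" for i v using type_K(4) that by blast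
    ultimately show ?case
      using type_K_not_colorable[of "pverts D" "parcs D" ns p f] type_K(3) by blast
  next
    case (type_C n D k l f)
    then obtain vs where n: "n \<ge> 3" and vs: "distinct vs" "length vs = n" "pverts D = set vs"
      and E: "parcs D = (\<Union>i<n. {(vs ! i, vs ! (Suc i mod n)), (vs ! (Suc i mod n), vs ! i)})"
      unfolding bidirected_cycle_def by blast
    have "f i v = (if i \<in> {k, l} then 1 else 0)" if "v \<in> pverts D" "i \<in> {1..p}" for i v
      using type_C(6) that by blast
    then show ?case
      using type_C_not_colorable[OF n type_C(2) vs E type_C(3-5)] by blast
  next
    case (merge D1 f1 D2 f2 v1 g1 v2 g2 D v f)
    then have D12: "pair_digraph D1 \<and> connected (with_proj D1)" "pair_digraph D2 \<and> connected (with_proj D2)"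
      using hard_pair_digraph by blast+
    then have D: "pair_digraph D" using identification_digraph[OF merge(3)] by blast
    have "\<not> f_coloring p (parcs D1) f1 (pverts D1) \<phi>" "\<not> f_coloring p (parcs D2) f2 (pverts D2) \<phi>" for \<phi>
      using merge.IH by blast+
    from merge_not_colorable[OF merge(3) D _ _ merge(4-6) this]
    show ?case using D12 by blast
  qed
  then show ?thesis
    using partitionable_iff_f_coloring hard_pair_digraph[OF assms] by blast
qed

section \<open>Colouring greedily and moving the hole\<close>

lemma deg_split_by_colour:
  fixes \<phi> :: "'a \<Rightarrow> nat"
  assumes "finite T" "\<And>u. u \<in> T \<Longrightarrow> \<phi> u \<in> {1..p}"
  shows "(\<Sum>i = 1..p. deg R {u \<in> T. \<phi> u = i} v) = deg R T v"
proof -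
  have "(\<Sum>i = 1..p. deg R {u \<in> T. \<phi> u = i} v)
      = (\<Sum>i \<in> {1..p}. card {u \<in> {u \<in> T. (v, u) \<in> R}. \<phi> u = i})"
    unfolding deg_def by (intro sum.cong refl arg_cong[where f = card]) auto
  also have "\<dots> = card (\<Union>i\<in>{1..p}. {u \<in> {u \<in> T. (v, u) \<in> R}. \<phi> u = i})"
    using assms(1) by (intro card_UN_disjoint[symmetric]) auto
  also have "(\<Union>i\<in>{1..p}. {u \<in> {u \<in> T. (v, u) \<in> R}. \<phi> u = i}) = {u \<in> T. (v, u) \<in> R}"
    using assms(2) by blast
  finally show ?thesis by (simp add: deg_def)
qed

lemma deg_less_if_neighbour_lost:
  assumes "finite S" "w \<in> S" "(v, w) \<in> R" "T \<subseteq> S - {w}"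
  shows "deg R T v < deg R S v"
  unfolding deg_def by (rule psubset_card_mono) (use assms in auto)

text \<open>
  The new vertex is deleted first: sets that contain it have it as their vertex of small degree, and
  all other sets have been coloured before.
\<close>

lemma f_coloring_extend:
  assumes col: "f_coloring p E f U \<phi>" and fin: "finite U" and z: "z \<notin> U" "(z, z) \<notin> E" and i: "i \<in> {1..p}"
    and low: "deg E {u \<in> U. \<phi> u = i} z < f i z \<or> deg (E\<inverse>) {u \<in> U. \<phi> u = i} z < f i z"
  shows "f_coloring p E f (insert z U) (\<phi>(z := i))"
  unfolding f_coloring_def
proof (intro conjI ballI)
  show "(\<phi>(z := i)) u \<in> {1..p}" if "u \<in> insert z U" for u
    using that col i by (auto simp: f_coloring_def)
next
  fix j assume j: "j \<in> {1..p}"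
  have old: "degenerate_on E {u \<in> U. \<phi> u = j} (f j)" using col j by (auto simp: f_coloring_def)
  show "degenerate_on E {u \<in> insert z U. (\<phi>(z := i)) u = j} (f j)"
    unfolding degenerate_on_def
  proof (intro allI impI)
    fix T assume T: "T \<subseteq> {u \<in> insert z U. (\<phi>(z := i)) u = j}" "T \<noteq> {}"
    show "\<exists>v\<in>T. deg E T v < f j v \<or> deg (E\<inverse>) T v < f j v"
    proof (cases "z \<in> T")
      case True
      then have ij: "j = i" using T by auto
      have "deg R T z \<le> deg R {u \<in> U. \<phi> u = i} z" if "(z, z) \<notin> R" for R
        unfolding deg_def by (rule card_mono) (use fin T ij that in \<open>auto split: if_splits\<close>)
      with low True ij z show ?thesis by (meson converse_iff order_le_less_trans)
    next
      case False
      then have "T \<subseteq> {u \<in> U. \<phi> u = j}" using T by auto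
      then show ?thesis using old T(2) unfolding degenerate_on_def by blast
    qed
  qed
qed

text \<open>
  The vertex whose degree is below its total budget is coloured last; by the pigeonhole principle
  some colour class contains fewer of its neighbours than the budget for that colour allows.
\<close>

lemma greedy_colouring:
  assumes "finite U" "\<And>v. (v, v) \<notin> E" "degenerate_on E U (\<lambda>v. \<Sum>i = 1..p. f i v)"
  shows "\<exists>\<phi>. f_coloring p E f U \<phi>"
  using assms(1,3)
proof (induction U rule: finite_psubset_induct)
  case (psubset U)
  show ?case
  proof (cases "U = {}")
    case True
    then show ?thesis by (auto simp: f_coloring_def degenerate_on_def)
  next
    case False
    then obtain v where v: "v \<in> U"
      "deg E U v < (\<Sum>i = 1..p. f i v) \<or> deg (E\<inverse>) U v < (\<Sum>i = 1..p. f i v)"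
      using psubset.prems unfolding degenerate_on_def by blast
    have "degenerate_on E (U - {v}) (\<lambda>v. \<Sum>i = 1..p. f i v)"
      using psubset.prems by (rule degenerate_on_mono) auto
    then obtain \<phi> where \<phi>: "f_coloring p E f (U - {v}) \<phi>"
      using psubset.IH[of "U - {v}"] v(1) by blast
    define S where "S i = {u \<in> U - {v}. \<phi> u = i}" for i
    have pos: "\<exists>i \<in> {1..p}. deg R (S i) v < f i v" if "deg R U v < (\<Sum>i = 1..p. f i v)" for R
    proof (rule ccontr)
      assume "\<not> ?thesis"
      then have "(\<Sum>i = 1..p. f i v) \<le> (\<Sum>i = 1..p. deg R (S i) v)"
        by (intro sum_mono) (auto simp: not_less)
      also have "\<dots> = deg R (U - {v}) v"
        unfolding S_def using \<phi> psubset.hyps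
        by (intro deg_split_by_colour) (auto simp: f_coloring_def)
      also have "\<dots> \<le> deg R U v" using psubset.hyps by (intro deg_mono) auto
      finally show False using that by simp
    qed
    with v(2) obtain i where i: "i \<in> {1..p}" "deg E (S i) v < f i v \<or> deg (E\<inverse>) (S i) v < f i v"
      by blast
    have "finite (U - {v})" "v \<notin> U - {v}" using psubset.hyps by auto
    from f_coloring_extend[OF \<phi> this assms(2) i(1)] i(2)
    have "f_coloring p E f (insert v (U - {v})) (\<phi>(v := i))" unfolding S_def by blast
    then show ?thesis using v(1) by (auto simp: insert_absorb)
  qed
qed

text \<open>
  Connectedness is stated through cuts, because it is used to find an arc that leaves or enters a
  given vertex set.
\<close>

locale critical =
  fixes V :: "'a set" and E :: "('a \<times> 'a) set" and p :: nat and f :: "nat \<Rightarrow> 'a \<Rightarrow> nat"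
  assumes finite_V: "finite V" and E_subset: "E \<subseteq> V \<times> V" and no_loop: "\<And>v. (v, v) \<notin> E"
    and V_ne: "V \<noteq> {}"
    and cut: "\<And>T. T \<subseteq> V \<Longrightarrow> T \<noteq> {} \<Longrightarrow> T \<noteq> V \<Longrightarrow> \<exists>u \<in> T. \<exists>w \<in> V - T. (u, w) \<in> E \<union> E\<inverse>"
    and sum_ge: "\<And>v R. v \<in> V \<Longrightarrow> R \<in> {E, E\<inverse>} \<Longrightarrow> deg R V v \<le> (\<Sum>i = 1..p. f i v)"
    and not_colorable: "\<And>\<phi>. \<not> f_coloring p E f V \<phi>"
begin

definition adj :: "'a \<Rightarrow> 'a \<Rightarrow> bool" where
  "adj u w \<longleftrightarrow> (u, w) \<in> E \<or> (w, u) \<in> E"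

lemma adj_sym: "adj u w \<longleftrightarrow> adj w u"
  by (auto simp: adj_def)

lemma adj_irrefl [simp]: "\<not> adj u u"
  using no_loop by (simp add: adj_def)

lemma adj_V: "adj u w \<Longrightarrow> u \<in> V \<and> w \<in> V"
  using E_subset by (auto simp: adj_def)

lemma adj_dir: "adj u w \<longleftrightarrow> (\<exists>R \<in> {E, E\<inverse>}. (u, w) \<in> R)"
  by (auto simp: adj_def)

lemma dir_V: "R \<in> {E, E\<inverse>} \<Longrightarrow> (u, w) \<in> R \<Longrightarrow> u \<in> V \<and> w \<in> V \<and> u \<noteq> w"
  using E_subset no_loop by auto

lemma dir_converse: "R \<in> {E, E\<inverse>} \<Longrightarrow> R\<inverse> \<in> {E, E\<inverse>}"
  by auto

lemma connected_cut: "T \<subseteq> V \<Longrightarrow> T \<noteq> {} \<Longrightarrow> T \<noteq> V \<Longrightarrow> \<exists>u \<in> T. \<exists>w \<in> V - T. adj u w"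
  using cut[of T] by (auto simp: adj_def)

text \<open>
  A vertex of \<open>T\<close> with a neighbour outside has lost an arc in one of the two directions.
\<close>

lemma boundary_vertex_low:
  assumes "T \<subseteq> V" "T \<noteq> {}" "T \<noteq> V"
  shows "\<exists>v \<in> T. deg E T v < (\<Sum>i = 1..p. f i v) \<or> deg (E\<inverse>) T v < (\<Sum>i = 1..p. f i v)"
proof -
  obtain u w where uw: "u \<in> T" "w \<in> V - T" "adj u w" using connected_cut assms by blast
  then obtain R where R: "R \<in> {E, E\<inverse>}" "(u, w) \<in> R" by (auto simp: adj_dir)
  have "deg R T u < deg R V u"
    using finite_V uw R assms(1) by (intro deg_less_if_neighbour_lost[of V w]) auto
  also have "\<dots> \<le> (\<Sum>i = 1..p. f i u)" using sum_ge[of u R] R(1) uw assms(1) by blast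
  finally show ?thesis using uw(1) R(1) by blast
qed

text \<open>
  A vertex with slack would make the whole vertex set degenerate for the total budgets: proper
  subsets always are, by their boundary vertices.
\<close>

lemma degree_tight:
  assumes v: "v \<in> V" and R: "R \<in> {E, E\<inverse>}"
  shows "deg R V v = (\<Sum>i = 1..p. f i v)"
proof (rule ccontr)
  assume "deg R V v \<noteq> (\<Sum>i = 1..p. f i v)"
  then have "deg R V v < (\<Sum>i = 1..p. f i v)" using sum_ge[OF v R] by simp
  then have "degenerate_on E V (\<lambda>v. \<Sum>i = 1..p. f i v)"
    unfolding degenerate_on_def using v R boundary_vertex_low by blast
  then show False using greedy_colouring[OF finite_V no_loop] not_colorable by blast
qed

text \<open>
  The uncoloured vertex is called the hole because it is going to be moved through the digraph.
\<close>

definition hole :: "('a \<Rightarrow> nat) \<Rightarrow> 'a \<Rightarrow> bool" where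
  "hole \<phi> z \<longleftrightarrow> z \<in> V \<and> f_coloring p E f (V - {z}) \<phi>"

lemma hole_V: "hole \<phi> z \<Longrightarrow> z \<in> V"
  by (simp add: hole_def)

lemma hole_range: "hole \<phi> z \<Longrightarrow> u \<in> V \<Longrightarrow> u \<noteq> z \<Longrightarrow> \<phi> u \<in> {1..p}"
  by (auto simp: hole_def f_coloring_def)

lemma hole_exists:
  assumes "z \<in> V"
  shows "\<exists>\<phi>. hole \<phi> z"
proof -
  have "degenerate_on E (V - {z}) (\<lambda>v. \<Sum>i = 1..p. f i v)"
    unfolding degenerate_on_def
  proof (intro allI impI)
    fix T assume "T \<subseteq> V - {z}" "T \<noteq> {}"
    then show "\<exists>v \<in> T. deg E T v < (\<Sum>i = 1..p. f i v) \<or> deg (E\<inverse>) T v < (\<Sum>i = 1..p. f i v)"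
      using assms by (intro boundary_vertex_low) auto
  qed
  then show ?thesis
    using greedy_colouring[OF _ no_loop] finite_V assms by (auto simp: hole_def)
qed

lemma hole_cong:
  assumes "hole \<phi> z" and eq: "\<And>u. u \<in> V \<Longrightarrow> u \<noteq> z \<Longrightarrow> \<phi>' u = \<phi> u"
  shows "hole \<phi>' z"
proof -
  have "{u \<in> V - {z}. \<phi>' u = i} = {u \<in> V - {z}. \<phi> u = i}" for i using eq by auto
  then show ?thesis using assms by (auto simp: hole_def f_coloring_def)
qed

text \<open>
  No colour \<open>i\<close> can be given to \<open>z\<close>, so \<open>z\<close> has at least \<open>f i z\<close> out-neighbours and in-neighbours
  of that colour. The budgets sum up to the degree, so equality holds for every colour.
\<close>

lemma hole_degree:
  assumes h: "hole \<phi> z" and i: "i \<in> {1..p}" and R: "R \<in> {E, E\<inverse>}"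
  shows "deg R {u \<in> V - {z}. \<phi> u = i} z = f i z"
proof -
  define d where "d R i = deg R {u \<in> V - {z}. \<phi> u = i} z" for R i
  have z: "z \<in> V" and col: "f_coloring p E f (V - {z}) \<phi>" using h by (auto simp: hole_def)
  have ge: "f i z \<le> d R i" if "i \<in> {1..p}" "R \<in> {E, E\<inverse>}" for R i
  proof (rule ccontr)
    assume "\<not> f i z \<le> d R i"
    then have "f_coloring p E f (insert z (V - {z})) (\<phi>(z := i))"
      using that finite_V no_loop
      by (intro f_coloring_extend[OF col]) (auto simp: d_def not_le)
    then show False using not_colorable z by (simp add: insert_absorb)
  qed
  have "(\<Sum>i = 1..p. d R i) = deg R (V - {z}) z"
    unfolding d_def using finite_V col by (intro deg_split_by_colour) (auto simp: f_coloring_def)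
  also have "\<dots> = deg R V z"
    unfolding deg_def using R dir_V by (intro arg_cong[where f = card]) blast
  also have "\<dots> = (\<Sum>i = 1..p. f i z)" by (rule degree_tight[OF z R])
  finally have eq: "(\<Sum>i = 1..p. d R i) = (\<Sum>i = 1..p. f i z)" .
  have "d R i = f i z"
  proof (rule ccontr)
    assume "d R i \<noteq> f i z"
    then have "(\<Sum>i = 1..p. f i z) < (\<Sum>i = 1..p. d R i)"
      using ge R i by (intro sum_strict_mono_ex1) (auto intro!: bexI[of _ i] simp: order_less_le)
    then show False using eq by simp
  qed
  then show ?thesis by (simp add: d_def)
qed

text \<open>
  Uncolouring the neighbour \<open>u\<close> of \<open>z\<close> leaves \<open>z\<close> with too few neighbours of that colour in one
  direction to be blocked, so \<open>z\<close> can take it over. The new hole is \<open>u\<close>.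
\<close>

lemma hole_move:
  assumes h: "hole \<phi> z" and zu: "adj z u"
  shows "hole (\<phi>(z := \<phi> u)) u"
proof -
  have z: "z \<in> V" and u: "u \<in> V" and ne: "u \<noteq> z" using zu adj_V by auto
  have col: "f_coloring p E f (V - {z}) \<phi>" using h by (auto simp: hole_def)
  obtain R where R: "R \<in> {E, E\<inverse>}" "(z, u) \<in> R" using zu by (auto simp: adj_dir)
  define S where "S = {w \<in> V - {z}. \<phi> w = \<phi> u}"
  have pu: "\<phi> u \<in> {1..p}" using hole_range[OF h u ne] .
  have old: "f_coloring p E f (V - {z} - {u}) \<phi>"
    using col by (auto simp: f_coloring_def intro: degenerate_on_mono)
  have "deg R {w \<in> V - {z} - {u}. \<phi> w = \<phi> u} z < deg R S z"
    using finite_V R(2) u ne by (intro deg_less_if_neighbour_lost[of S u]) (auto simp: S_def)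
  also have "\<dots> = f (\<phi> u) z" unfolding S_def using hole_degree[OF h pu R(1)] .
  finally have low: "deg R {w \<in> V - {z} - {u}. \<phi> w = \<phi> u} z < f (\<phi> u) z" .
  have "f_coloring p E f (insert z (V - {z} - {u})) (\<phi>(z := \<phi> u))"
    using f_coloring_extend[OF old _ _ no_loop pu] finite_V low R(1) by auto
  moreover have "insert z (V - {z} - {u}) = V - {u}" using z ne by auto
  ultimately show ?thesis using u by (simp add: hole_def)
qed

text \<open>
  The number of neighbours of a given colour does not depend on the colouring, only on the position of
  the hole. So if one neighbour loses a colour, another one in the same direction gains it.
\<close>

lemma exchange:
  assumes h: "hole \<phi> z" and h': "hole \<phi>' z" and R: "R \<in> {E, E\<inverse>}"
    and a: "(z, a) \<in> R" "\<phi>' a \<noteq> \<phi> a"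
  shows "\<exists>b. (z, b) \<in> R \<and> \<phi>' b = \<phi> a \<and> \<phi> b \<noteq> \<phi> a"
proof -
  let ?i = "\<phi> a"
  define X where "X \<psi> = {u \<in> {u \<in> V - {z}. \<psi> u = ?i}. (z, u) \<in> R}" for \<psi> :: "'a \<Rightarrow> nat"
  have aV: "a \<in> V" "a \<noteq> z" using dir_V[OF R a(1)] by auto
  have i: "?i \<in> {1..p}" using hole_range[OF h aV] .
  have "card (X \<phi>) = card (X \<phi>')"
    using hole_degree[OF h i R] hole_degree[OF h' i R] by (simp add: deg_def X_def)
  moreover have "finite (X \<phi>)" "finite (X \<phi>')" using finite_V by (auto simp: X_def)
  moreover have "a \<in> X \<phi> - X \<phi>'" using a aV by (auto simp: X_def)
  ultimately have "\<not> X \<phi>' \<subseteq> X \<phi>" by (metis DiffD1 DiffD2 card_subset_eq)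
  then show ?thesis by (auto simp: X_def)
qed

end

section \<open>Rotating colours around induced cycles\<close>

context critical
begin

text \<open>
  An induced cycle of length \<open>n\<close> of the underlying graph, as an \<open>n\<close>-periodic function. Periodicity
  lets the hole run around the cycle for any number of turns and makes every vertex of the cycle a
  possible starting point.
\<close>

definition icycle :: "nat \<Rightarrow> (nat \<Rightarrow> 'a) \<Rightarrow> bool" where
  "icycle n v \<longleftrightarrow> n \<ge> 3 \<and> (\<forall>k. v k \<in> V) \<and> (\<forall>k. v (k + n) = v k) \<and>
     (\<forall>k t. 1 \<le> t \<and> t < n \<longrightarrow> v (k + t) \<noteq> v k \<and> (adj (v k) (v (k + t)) \<longleftrightarrow> t = 1 \<or> t = n - 1))"

lemma icycleI:
  assumes n: "n \<ge> 3" and V: "\<And>a. a < n \<Longrightarrow> w a \<in> V"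
    and w: "\<And>a b. a < b \<Longrightarrow> b < n \<Longrightarrow>
              w a \<noteq> w b \<and> (adj (w a) (w b) \<longleftrightarrow> b = a + 1 \<or> (a = 0 \<and> b = n - 1))"
  shows "icycle n (\<lambda>k. w (k mod n))"
  unfolding icycle_def
proof (intro conjI allI impI)
  fix k t assume t: "1 \<le> t \<and> t < n"
  define a where "a = k mod n"
  have a: "a < n" using n by (simp add: a_def)
  have "(k + t) mod n = (a + t) mod n" by (simp add: a_def mod_add_left_eq)
  also have "\<dots> = (if a + t < n then a + t else a + t - n)"
    using t a by (auto simp: not_less le_mod_geq)
  finally have kt: "(k + t) mod n = (if a + t < n then a + t else a + t - n)" .
  have "w ((k + t) mod n) \<noteq> w a \<and> (adj (w a) (w ((k + t) mod n)) \<longleftrightarrow> t = 1 \<or> t = n - 1)"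
  proof (cases "a + t < n")
    case True
    then show ?thesis using w[of a "a + t"] t unfolding kt by auto
  next
    case False
    then have lt: "a + t - n < a" using t by linarith
    have wrap: "(k + t) mod n = a + t - n" using False kt by simp
    have "a = a + t - n + 1 \<longleftrightarrow> t = n - 1" "a + t - n = 0 \<and> a = n - 1 \<longleftrightarrow> t = 1"
      using False t a n by linarith+
    with w[OF lt a] show ?thesis unfolding wrap using adj_sym[of "w a"] by metis
  qed
  then show "w ((k + t) mod n) \<noteq> w (k mod n)"
    and "adj (w (k mod n)) (w ((k + t) mod n)) \<longleftrightarrow> t = 1 \<or> t = n - 1"
    by (simp_all add: a_def)
qed (use n V in auto)

lemma icycle_periodic: "icycle n v \<Longrightarrow> v (k + n) = v k"
  by (simp add: icycle_def)

lemma icycle_mod: "icycle n v \<Longrightarrow> v (k mod n) = v k"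
proof -
  assume c: "icycle n v"
  have "v (j + i * n) = v j" for i j
  proof (induction i)
    case (Suc i)
    have eq: "j + Suc i * n = (j + i * n) + n" by simp
    show ?case unfolding eq icycle_periodic[OF c] by (rule Suc)
  qed simp
  then show ?thesis by (metis div_mult_mod_eq add.commute)
qed

lemma icycle_shift:
  assumes "icycle n v" shows "icycle n (\<lambda>j. v (j + k))"
proof -
  have "i + n + k = (i + k) + n" "i + t + k = (i + k) + t" for i t by simp_all
  then show ?thesis using assms unfolding icycle_def by presburger
qed

lemma icycle_range_from:
  assumes "icycle n v" "x \<in> range v"
  shows "\<exists>t < n. x = v (k + t)"
proof -
  obtain j where j: "x = v j" using assms(2) by auto
  have n: "n \<ge> 3" using assms(1) by (simp add: icycle_def)
  define t where "t = (j + (n - k mod n)) mod n"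
  have "(k + t) mod n = (k + (j + (n - k mod n))) mod n" by (simp add: t_def mod_add_right_eq)
  also have "\<dots> = (k mod n + (n - k mod n) + j) mod n"
    by (metis (no_types, opaque_lifting) add.assoc add.commute mod_add_left_eq)
  also have "k mod n + (n - k mod n) = n" using n by simp
  finally have "(k + t) mod n = j mod n" by simp
  then have "v (k + t) = v j" using icycle_mod[OF assms(1)] by metis
  moreover have "t < n" using n by (simp add: t_def)
  ultimately show ?thesis using j by auto
qed

lemma icycle_shift_range:
  assumes "icycle n v" shows "range (\<lambda>j. v (j + k)) = range v"
  using icycle_range_from[OF assms, of _ k] by (auto simp: image_iff) (metis add.commute)

text \<open>
  The hole runs along the cycle, with the hole of \<open>\<psi> k\<close> at \<open>v k\<close>. The \<open>n - 1\<close> colours form a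
  sequence \<open>c\<close> of period \<open>n - 1\<close>, placed on the \<open>n\<close>-periodic sequence \<open>v\<close>: after a full turn, every
  colour has moved by one vertex.
\<close>

lemma rotation:
  assumes cyc: "icycle n v" and h: "hole \<phi> (v 0)"
  shows "\<exists>(c :: nat \<Rightarrow> nat) \<psi>. (\<forall>k. c (k + (n - 1)) = c k) \<and> (\<forall>t \<in> {1..n - 1}. c t = \<phi> (v t)) \<and>
           (\<forall>k. hole (\<psi> k) (v k)) \<and> (\<forall>k. \<forall>t \<in> {1..n - 1}. \<psi> k (v (k + t)) = c (k + t)) \<and>
           (\<forall>k. \<forall>x. x \<notin> range v \<longrightarrow> \<psi> k x = \<phi> x)"
proof -
  have n: "n \<ge> 3" and dist: "\<And>k t. 1 \<le> t \<Longrightarrow> t < n \<Longrightarrow> v (k + t) \<noteq> v k"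
    and adjs: "\<And>k t. 1 \<le> t \<Longrightarrow> t < n \<Longrightarrow> adj (v k) (v (k + t)) \<longleftrightarrow> t = 1 \<or> t = n - 1"
    using cyc by (auto simp: icycle_def)
  have step: "adj (v k) (v (k + 1))" for k using adjs[of 1 k] n by simp
  define m where "m = n - 1"
  have m: "m \<ge> 2" "n = m + 1" using n by (auto simp: m_def)
  \<comment> \<open>the colours of \<open>v 1\<close>, ..., \<open>v m\<close>, continued with period \<open>m\<close>; the summand \<open>m\<close> avoids a
    truncated subtraction at \<open>k = 0\<close>\<close>
  define c where "c k = \<phi> (v (1 + (k + m - 1) mod m))" for k
  define \<psi> where "\<psi> = rec_nat \<phi> (\<lambda>k g. g(v k := g (v (k + 1))))"
  have \<psi>0: "\<psi> 0 = \<phi>" and \<psi>S: "\<psi> (Suc k) = (\<psi> k)(v k := \<psi> k (v (k + 1)))" for k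
    by (simp_all add: \<psi>_def)
  have per: "c (k + m) = c k" for k
  proof -
    have "k + m + m - 1 = (k + m - 1) + m" using m by simp
    then show ?thesis by (simp add: c_def)
  qed
  have c0: "c t = \<phi> (v t)" if "t \<in> {1..m}" for t
  proof -
    have "t + m - 1 = (t - 1) + m" "t - 1 < m" using that by auto
    then have "(t + m - 1) mod m = t - 1" by (metis mod_add_self2 mod_less)
    then show ?thesis using that by (simp add: c_def)
  qed
  have holes: "hole (\<psi> k) (v k)" for k
  proof (induction k)
    case (Suc k)
    show ?case using hole_move[OF Suc step] unfolding \<psi>S by (simp only: Suc_eq_plus1)
  qed (simp add: \<psi>0 h)
  have cols: "\<forall>t \<in> {1..m}. \<psi> k (v (k + t)) = c (k + t)" for k
  proof (induction k)
    case 0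
    then show ?case using c0 by (simp add: \<psi>0)
  next
    case (Suc k)
    show ?case
    proof
      fix t assume t: "t \<in> {1..m}"
      show "\<psi> (Suc k) (v (Suc k + t)) = c (Suc k + t)"
      proof (cases "t = m")
        case True
        then have "v (Suc k + t) = v k" using icycle_periodic[OF cyc, of k] m by simp
        moreover have "\<psi> k (v (k + 1)) = c (k + 1)" using bspec[OF Suc, of 1] m by simp
        moreover have "c (Suc k + t) = c (k + 1)" using per[of "k + 1"] True by simp
        ultimately show ?thesis by (simp add: \<psi>S)
      next
        case False
        then have "v (Suc k + t) \<noteq> v k" using dist[of "Suc t" k] t m by simp
        moreover have "\<psi> k (v (k + Suc t)) = c (k + Suc t)" using bspec[OF Suc, of "Suc t"] t False by simp
        ultimately show ?thesis by (simp add: \<psi>S)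
      qed
    qed
  qed
  have off: "x \<notin> range v \<longrightarrow> \<psi> k x = \<phi> x" for k x
    by (induction k) (auto simp: \<psi>0 \<psi>S)
  show ?thesis
    using per c0 holes cols off unfolding m_def by blast
qed

text \<open>
  The colourings \<open>\<psi> k\<close> and \<open>\<psi> (k + n)\<close> have the same hole \<open>v k\<close> and differ only on the cycle,
  where \<open>v k\<close> has just two neighbours. If \<open>v (k + n - 1)\<close> loses the colour \<open>c k\<close>, then by
  \<open>exchange\<close> the other neighbour \<open>v (k + 1)\<close> must gain it, and must be joined to \<open>v k\<close> in the same
  direction. The first fact says that \<open>c\<close> has period 2; as it also has period \<open>n - 1\<close>, the length
  is odd. The second says that an arc of the cycle pointing forward is followed by one pointing
  backward; after an odd number of steps the first arc is met again in the other direction.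
\<close>

lemma alternating_rotation:
  assumes cyc: "icycle n v" and h: "hole \<phi> (v 0)"
    and mixed: "s \<in> {1..n - 1}" "t \<in> {1..n - 1}" "\<phi> (v s) \<noteq> \<phi> (v t)"
  shows "\<exists>(c :: nat \<Rightarrow> nat) \<psi>. (\<forall>k. c (k + 1) \<noteq> c k \<and> c (k + 2) = c k) \<and> (\<forall>t \<in> {1..n - 1}. c t = \<phi> (v t)) \<and>
           (\<forall>k. hole (\<psi> k) (v k)) \<and> (\<forall>k. \<forall>t \<in> {1..n - 1}. \<psi> k (v (k + t)) = c (k + t)) \<and>
           (\<forall>k. \<forall>x. x \<notin> range v \<longrightarrow> \<psi> k x = \<phi> x)"
    and "odd n"
    and "(v k, v (k + 1)) \<in> E \<and> (v (k + 1), v k) \<in> E"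
proof -
  have n: "n \<ge> 3" and dist: "\<And>k t. 1 \<le> t \<Longrightarrow> t < n \<Longrightarrow> v (k + t) \<noteq> v k"
    and adjs: "\<And>k t. 1 \<le> t \<Longrightarrow> t < n \<Longrightarrow> adj (v k) (v (k + t)) \<longleftrightarrow> t = 1 \<or> t = n - 1"
    using cyc by (auto simp: icycle_def)
  define m where "m = n - 1"
  have m: "m \<ge> 2" "n = m + 1" using n by (auto simp: m_def)
  obtain c :: "nat \<Rightarrow> nat" and \<psi> where per: "\<And>k. c (k + m) = c k" and c0: "\<forall>t \<in> {1..m}. c t = \<phi> (v t)"
    and holes: "\<And>k. hole (\<psi> k) (v k)" and cols: "\<And>k t. t \<in> {1..m} \<Longrightarrow> \<psi> k (v (k + t)) = c (k + t)"
    and off: "\<And>k x. x \<notin> range v \<Longrightarrow> \<psi> k x = \<phi> x"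
    using rotation[OF cyc h] unfolding m_def by metis
  have step: "c (k + 2) = c k \<and> (v k, v (k + 1)) \<in> R"
    if ne: "c (k + 1) \<noteq> c k" and R: "R \<in> {E, E\<inverse>}" and arc: "(v k, v (k + m)) \<in> R" for k R
  proof -
    have h': "hole (\<psi> (k + n)) (v k)" using holes[of "k + n"] icycle_periodic[OF cyc, of k] by simp
    have col': "\<psi> (k + n) (v (k + t)) = c (k + t + 1)" if "t \<in> {1..m}" for t
    proof -
      have "v (k + n + t) = v (k + t)" using icycle_periodic[OF cyc, of "k + t"] by (simp add: ac_simps)
      moreover have "\<psi> (k + n) (v (k + n + t)) = c (k + n + t)" using cols that .
      moreover have "c (k + n + t) = c (k + t + 1)"
        using per[of "k + t + 1"] m by (simp add: ac_simps)
      ultimately show ?thesis by simp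
    qed
    have ck: "\<psi> k (v (k + m)) = c k" using cols[of m k] per m by simp
    have ck': "\<psi> (k + n) (v (k + m)) = c (k + 1)"
      using col'[of m] per[of "k + 1"] m by (simp add: ac_simps)
    obtain b where b: "(v k, b) \<in> R" "\<psi> (k + n) b = c k" "\<psi> k b \<noteq> c k"
      using exchange[OF holes h' R arc] ne ck ck' by auto
    then have "b \<in> range v" using off b(2,3) by metis
    then obtain t where t: "t < n" "b = v (k + t)" using icycle_range_from[OF cyc] by blast
    have "t \<noteq> 0" using b(1) dir_V[OF R b(1)] t by (cases t) auto
    moreover have "adj (v k) b" using b(1) R by (auto simp: adj_dir)
    ultimately have "t = 1 \<or> t = m" using adjs[of t k] t by (simp add: m_def)
    then have "t = 1" using b(3) ck t(2) by auto
    then show ?thesis using b t(2) col'[of 1] m by auto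
  qed
  have step_c: "c (k + 2) = c k" if "c (k + 1) \<noteq> c k" for k
  proof -
    have "adj (v k) (v (k + m))" using adjs[of m k] m by simp
    then show ?thesis using step[OF that] by (auto simp: adj_dir)
  qed
  \<comment> \<open>one change of colour propagates to all later positions, and by periodicity to all positions\<close>
  have "\<exists>k. c (k + 1) \<noteq> c k"
  proof (rule ccontr)
    assume "\<not> ?thesis"
    then have "c k = c 0" for k by (induction k) auto
    then show False using mixed c0 unfolding m_def by metis
  qed
  then obtain k0 where k0: "c (k0 + 1) \<noteq> c k0" by blast
  have later: "c (k0 + j + 1) \<noteq> c (k0 + j)" for j
  proof (induction j)
    case (Suc j)
    then show ?case using step_c[OF Suc] by (simp add: ac_simps)
  qed (use k0 in simp)
  have perk: "c (j + i * m) = c j" for i j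
  proof (induction i)
    case (Suc i)
    have eq: "j + Suc i * m = (j + i * m) + m" by simp
    show ?case unfolding eq per by (rule Suc)
  qed simp
  have ne: "c (k + 1) \<noteq> c k" for k
  proof -
    have "k0 * m = k0 + k0 * (m - 1)" using m by (cases m) auto
    then have "c (k + k0 * m + 1) \<noteq> c (k + k0 * m)"
      using later[of "k + k0 * (m - 1)"] by (simp add: ac_simps)
    then show ?thesis using perk[of k k0] perk[of "k + 1" k0] by (simp add: ac_simps)
  qed
  show "\<exists>(c :: nat \<Rightarrow> nat) \<psi>. (\<forall>k. c (k + 1) \<noteq> c k \<and> c (k + 2) = c k) \<and> (\<forall>t \<in> {1..n - 1}. c t = \<phi> (v t)) \<and>
           (\<forall>k. hole (\<psi> k) (v k)) \<and> (\<forall>k. \<forall>t \<in> {1..n - 1}. \<psi> k (v (k + t)) = c (k + t)) \<and>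
           (\<forall>k. \<forall>x. x \<notin> range v \<longrightarrow> \<psi> k x = \<phi> x)"
    using ne step_c c0 holes cols off unfolding m_def by blast
  have even_c: "c (2 * j) = c 0" "c (2 * j + 1) = c 1" for j
    by (induction j) (use step_c[OF ne] in \<open>auto simp: numeral_eq_Suc\<close>)
  show odd: "odd n"
  proof (rule ccontr)
    assume "\<not> odd n"
    then obtain j where "m = 2 * j + 1" using m by (metis even_add odd_one oddE)
    then have "c m = c 1" using even_c by simp
    then show False using per[of 0] ne[of 0] by simp
  qed
  have turn: "(v (k + 1), v (k + 2)) \<in> R\<inverse>" if R: "R \<in> {E, E\<inverse>}" and "(v k, v (k + 1)) \<in> R" for k R
  proof -
    have "v (k + 1 + m) = v k" using icycle_periodic[OF cyc, of k] m by (simp add: ac_simps)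
    then have "(v (k + 1), v (k + 1 + m)) \<in> R\<inverse>" using that by simp
    then show ?thesis using step[OF ne dir_converse[OF R], of "k + 1"] by (simp add: ac_simps)
  qed
  have turns: "(v (k + 2 * j), v (k + 2 * j + 1)) \<in> R" if R: "R \<in> {E, E\<inverse>}" and "(v k, v (k + 1)) \<in> R" for k R j
  proof (induction j)
    case (Suc j)
    define i where "i = k + 2 * j"
    have "(v (i + 1), v (i + 1 + 1)) \<in> R\<inverse>" using turn[OF R Suc] by (simp add: i_def)
    then have "(v (i + 1 + 1), v (i + 1 + 2)) \<in> R" using turn[OF dir_converse[OF R]] by blast
    moreover have "k + 2 * Suc j = i + 1 + 1" "k + 2 * Suc j + 1 = i + 1 + 2" by (simp_all add: i_def)
    ultimately show ?case by metis
  qed (use that in simp)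
  have both: "(v k, v (k + 1)) \<in> R\<inverse>" if R: "R \<in> {E, E\<inverse>}" and a: "(v k, v (k + 1)) \<in> R" for k R
  proof -
    obtain j where j: "n = 2 * j + 1" using odd by (rule oddE)
    have "(v (k + 2 * j + 1), v (k + 2 * j + 2)) \<in> R\<inverse>" using turn[OF R turns[OF R a, of j]] by simp
    moreover have "k + 2 * j + 1 = k + n" "k + 2 * j + 2 = k + 1 + n" using j by auto
    ultimately show ?thesis using icycle_periodic[OF cyc] by metis
  qed
  have "adj (v k) (v (k + 1))" using adjs[of 1 k] n by simp
  then show "(v k, v (k + 1)) \<in> E \<and> (v (k + 1), v k) \<in> E"
    using both[of E k] both[of "E\<inverse>" k] by (auto simp: adj_def)
qed

lemma alternating_colours:
  assumes cyc: "icycle n v" and h: "hole \<phi> (v 0)"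
    and mixed: "s \<in> {1..n - 1}" "t \<in> {1..n - 1}" "\<phi> (v s) \<noteq> \<phi> (v t)"
  shows "1 \<le> k \<Longrightarrow> k + 1 \<le> n - 1 \<Longrightarrow> \<phi> (v (k + 1)) \<noteq> \<phi> (v k)"
    and "1 \<le> k \<Longrightarrow> k + 2 \<le> n - 1 \<Longrightarrow> \<phi> (v (k + 2)) = \<phi> (v k)"
proof -
  obtain c :: "nat \<Rightarrow> nat" where c: "\<And>k. c (k + 1) \<noteq> c k \<and> c (k + 2) = c k" "\<And>t. t \<in> {1..n - 1} \<Longrightarrow> c t = \<phi> (v t)"
    using alternating_rotation(1)[OF assms] by blast
  show "\<phi> (v (k + 1)) \<noteq> \<phi> (v k)" if "1 \<le> k" "k + 1 \<le> n - 1"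
    using c(1)[of k] c(2)[of k] c(2)[of "k + 1"] that by simp
  show "\<phi> (v (k + 2)) = \<phi> (v k)" if "1 \<le> k" "k + 2 \<le> n - 1"
    using c(1)[of k] c(2)[of k] c(2)[of "k + 2"] that by simp
qed

text \<open>
  A full turn puts each colour on the neighbouring vertex, where by alternation a different colour was.
\<close>

lemma full_rotation:
  assumes cyc: "icycle n v" and h: "hole \<phi> (v 0)"
    and mixed: "s \<in> {1..n - 1}" "t \<in> {1..n - 1}" "\<phi> (v s) \<noteq> \<phi> (v t)"
  shows "\<exists>\<phi>'. hole \<phi>' (v 0) \<and> (\<forall>k \<in> {1..n - 1}. \<phi>' (v k) \<noteq> \<phi> (v k)) \<and>
           \<phi>' (v 1) \<noteq> \<phi>' (v 2) \<and> (\<forall>x. x \<notin> range v \<longrightarrow> \<phi>' x = \<phi> x)"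
proof -
  obtain c :: "nat \<Rightarrow> nat" and \<psi> where c: "\<And>k. c (k + 1) \<noteq> c k \<and> c (k + 2) = c k" "\<And>t. t \<in> {1..n - 1} \<Longrightarrow> c t = \<phi> (v t)"
    and \<psi>: "\<And>k. hole (\<psi> k) (v k)" "\<And>k t. t \<in> {1..n - 1} \<Longrightarrow> \<psi> k (v (k + t)) = c (k + t)"
    "\<And>k x. x \<notin> range v \<Longrightarrow> \<psi> k x = \<phi> x"
    using alternating_rotation(1)[OF assms] by metis
  obtain j where j: "n = 2 * j + 1" using alternating_rotation(2)[OF assms] by (rule oddE)
  have c2: "c (k + 2 * i) = c k" for k i
    by (induction i) (use c(1) in \<open>auto simp: numeral_eq_Suc\<close>)
  have after: "\<psi> n (v k) = c (k + 1)" if "k \<in> {1..n - 1}" for k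
  proof -
    have "\<psi> n (v k) = c (k + n)"
      using \<psi>(2)[OF that, of n] icycle_periodic[OF cyc, of k] by (simp add: ac_simps)
    also have "\<dots> = c (k + 1)" using c2[of "k + 1" j] by (simp add: j ac_simps)
    finally show ?thesis .
  qed
  have "\<psi> n (v k) \<noteq> \<phi> (v k)" if "k \<in> {1..n - 1}" for k
    using after[OF that] c(1)[of k] c(2)[OF that] by simp
  moreover have "\<psi> n (v 1) \<noteq> \<psi> n (v 2)"
  proof -
    have "n \<ge> 3" using cyc by (simp add: icycle_def)
    then show ?thesis using after[of 1] after[of 2] c(1)[of 2] by (simp add: numeral_eq_Suc)
  qed
  moreover have "hole (\<psi> n) (v 0)" using \<psi>(1)[of n] icycle_periodic[OF cyc, of 0] by simp
  ultimately show ?thesis using \<psi>(3) by blast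
qed

lemma shifted_hole:
  assumes cyc: "icycle n v" and h: "hole \<phi> (v 0)"
    and mixed: "s \<in> {1..n - 1}" "t \<in> {1..n - 1}" "\<phi> (v s) \<noteq> \<phi> (v t)"
  shows "\<exists>\<psi>. hole \<psi> (v k) \<and> \<psi> (v (1 + k)) \<noteq> \<psi> (v (2 + k)) \<and>
           {\<psi> (v (k + 1)), \<psi> (v (k + (n - 1)))} = {\<phi> (v 1), \<phi> (v (n - 1))}"
proof -
  obtain c :: "nat \<Rightarrow> nat" and \<psi> where c: "\<And>k. c (k + 1) \<noteq> c k" "\<And>k. c (k + 2) = c k" "\<And>t. t \<in> {1..n - 1} \<Longrightarrow> c t = \<phi> (v t)"
    and \<psi>: "\<And>k. hole (\<psi> k) (v k)" "\<And>k t. t \<in> {1..n - 1} \<Longrightarrow> \<psi> k (v (k + t)) = c (k + t)"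
    using alternating_rotation(1)[OF assms] by metis
  have n: "n \<ge> 3" using cyc by (simp add: icycle_def)
  obtain j where j: "n = 2 * j + 1" using alternating_rotation(2)[OF assms] by (rule oddE)
  have c2: "c (k + 2 * i) = c k" for k i
    by (induction i) (use c in \<open>auto simp: numeral_eq_Suc\<close>)
  have "{c (k + 1), c k} = {c 1, c 0}"
    by (induction k) (use c in \<open>auto simp: numeral_eq_Suc\<close>)
  moreover have "\<psi> k (v (k + 1)) = c (k + 1)" "\<psi> k (v (k + 2)) = c (k + 2)" "\<psi> k (v (k + (n - 1))) = c (k + (n - 1))"
    using \<psi>(2)[of 1 k] \<psi>(2)[of 2 k] \<psi>(2)[of "n - 1" k] n by simp_all
  moreover have "c (k + (n - 1)) = c k" "c (n - 1) = c 0" using c2[of k j] c2[of 0 j] j by simp_all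
  moreover have "c 1 = \<phi> (v 1)" "c (n - 1) = \<phi> (v (n - 1))" using c(3) n by simp_all
  moreover have "c (k + 1) \<noteq> c (k + 2)" using c(1)[of k] c(2)[of k] by simp
  ultimately show ?thesis using \<psi>(1)[of k] by (metis add.commute)
qed

end

section \<open>Ears and triangles on a mixed cycle\<close>

context critical
begin

lemma icycle_inj:
  assumes cyc: "icycle n v" and ij: "i < n" "j < n"
  shows "v (k + i) = v (k + j) \<longleftrightarrow> i = j"
proof -
  have dist: "v (k + t) \<noteq> v k" if "1 \<le> t" "t < n" for k t using cyc that unfolding icycle_def by blast
  have "v (k + i) \<noteq> v (k + j)" if "i < j" "j < n" for i j
  proof -
    have "1 \<le> j - i" "j - i < n" "k + j = (k + i) + (j - i)" using that by linarith+
    then show ?thesis using dist by metis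
  qed
  then show ?thesis using ij by (cases i j rule: linorder_cases) metis+
qed

lemma icycle_step: "icycle n v \<Longrightarrow> adj (v k) (v (k + 1))"
proof -
  assume cyc: "icycle n v"
  then have "(1::nat) \<le> 1 \<and> 1 < n" by (simp add: icycle_def)
  then show ?thesis using cyc unfolding icycle_def by blast
qed

text \<open>
  The path \<open>v 0\<close>, ..., \<open>v s\<close> and the ear \<open>q\<close> form a second induced cycle \<open>A\<close> through the hole. A full rotation of
  the first cycle changes all colours on the path and none on the ear. But on \<open>A\<close> the colours
  alternate before and after: for three consecutive coloured vertices the outer two have the same
  colour, although just one of them has changed.
\<close>

lemma no_ear:
  assumes cyc: "icycle n v" and h: "hole \<phi> (v 0)"
    and mixed: "s0 \<in> {1..n - 1}" "t0 \<in> {1..n - 1}" "\<phi> (v s0) \<noteq> \<phi> (v t0)"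
    and s: "1 \<le> s" "s \<le> n - 2" "2 \<le> s + r"
    and q: "\<And>j. j \<le> r \<Longrightarrow> q j \<in> V - range v"
    and qq: "\<And>i j. i < j \<Longrightarrow> j \<le> r \<Longrightarrow> q i \<noteq> q j \<and> (adj (q i) (q j) \<longleftrightarrow> j = i + 1)"
    and vq: "\<And>t j. t \<le> s \<Longrightarrow> j \<le> r \<Longrightarrow> adj (v t) (q j) \<longleftrightarrow> t = 0 \<and> j = 0 \<or> t = s \<and> j = r"
  shows False
proof -
  have n: "n \<ge> 3" and vV: "\<And>k. v k \<in> V"
    and vv: "\<And>k t. 1 \<le> t \<Longrightarrow> t < n \<Longrightarrow> v (k + t) \<noteq> v k \<and> (adj (v k) (v (k + t)) \<longleftrightarrow> t = 1 \<or> t = n - 1)"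
    using cyc by (auto simp: icycle_def)
  define N where "N = s + r + 2"
  \<comment> \<open>the ear is traversed backwards, from its end at \<open>v s\<close> to its end at \<open>v 0\<close>\<close>
  define w where "w a = (if a \<le> s then v a else q (s + r + 1 - a))" for a
  define A where "A k = w (k mod N)" for k
  have A: "A a = w a" if "a < N" for a using that by (simp add: A_def)
  have A0: "A 0 = v 0" and As: "A s = v s" "A (s - 1) = v (s - 1)" "A 1 = v 1"
    and Aq: "A (s + 1) = q r" "A (N - 1) = q 0"
    using s by (simp_all add: A w_def N_def)
  have cycA: "icycle N A"
    unfolding A_def
  proof (rule icycleI)
    show "N \<ge> 3" using s by (simp add: N_def)
    show "w a \<in> V" if "a < N" for a using that q[of "s + r + 1 - a"] vV by (auto simp: w_def N_def)
    fix a b assume ab: "a < b" "b < N"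
    consider "b \<le> s" | "a \<le> s" "s < b" | "s < a" using ab by linarith
    then show "w a \<noteq> w b \<and> (adj (w a) (w b) \<longleftrightarrow> b = a + 1 \<or> (a = 0 \<and> b = N - 1))"
    proof cases
      case 1
      then have t: "1 \<le> b - a" "b - a < n" "a + (b - a) = b" "b - a \<noteq> n - 1" using ab s n by linarith+
      have "b \<noteq> N - 1" "b - a = 1 \<longleftrightarrow> b = a + 1" using 1 ab by (auto simp: N_def)
      then show ?thesis using vv[OF t(1,2), of a] 1 ab t(3,4) by (auto simp: w_def)
    next
      case 2
      then have j: "s + r + 1 - b \<le> r" by linarith
      have "(a = 0 \<and> s + r + 1 - b = 0 \<or> a = s \<and> s + r + 1 - b = r) \<longleftrightarrow> (b = a + 1 \<or> a = 0 \<and> b = N - 1)"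
        using 2 ab s by (auto simp: N_def)
      moreover have "w a = v a" "w b = q (s + r + 1 - b)" using 2 by (auto simp: w_def)
      moreover have "v a \<noteq> q (s + r + 1 - b)" using q[OF j] by (metis DiffD2 rangeI)
      ultimately show ?thesis using vq[OF 2(1) j] by simp
    next
      case 3
      define i j where "i = s + r + 1 - b" and "j = s + r + 1 - a"
      have ij: "i < j" "j \<le> r" using 3 ab by (auto simp: i_def j_def N_def)
      have "j = i + 1 \<longleftrightarrow> b = a + 1" using 3 ab by (auto simp: i_def j_def N_def)
      moreover have "w a = q j" "w b = q i" using 3 ab by (auto simp: w_def i_def j_def)
      ultimately show ?thesis using qq[OF ij] 3 by (auto simp: adj_sym[of "q i"])
    qed
  qed
  obtain \<phi>' where h': "hole \<phi>' (v 0)" and turned: "\<And>k. k \<in> {1..n - 1} \<Longrightarrow> \<phi>' (v k) \<noteq> \<phi> (v k)"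
    and mixed': "\<phi>' (v 1) \<noteq> \<phi>' (v 2)" and off: "\<And>x. x \<notin> range v \<Longrightarrow> \<phi>' x = \<phi> x"
    using full_rotation[OF cyc h mixed] by blast
  have same: "\<phi>' (q j) = \<phi> (q j)" if "j \<le> r" for j using off q[OF that] by blast
  have hA: "hole \<phi> (A 0)" "hole \<phi>' (A 0)" using h h' A0 by simp_all
  show False
  proof (cases "s \<ge> 2")
    case True
    have "\<phi> (v s) \<noteq> \<phi> (v (s - 1))"
      using alternating_colours(1)[OF cyc h mixed, of "s - 1"] True s by simp
    moreover have "\<phi>' (v s) \<noteq> \<phi>' (v (s - 1))"
      using alternating_colours(1)[OF cyc h' _ _ mixed', of "s - 1"] True s by simp
    ultimately have m: "\<phi> (A s) \<noteq> \<phi> (A (s - 1))" "\<phi>' (A s) \<noteq> \<phi>' (A (s - 1))" by (simp_all only: As not_False_eq_True)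
    have rng: "s \<in> {1..N - 1}" "s - 1 \<in> {1..N - 1}" using True by (auto simp: N_def)
    have "\<chi> (q r) = \<chi> (v (s - 1))" if "hole \<chi> (A 0)" "\<chi> (A s) \<noteq> \<chi> (A (s - 1))" for \<chi>
    proof -
      have "1 \<le> s - 1" "s - 1 + 2 \<le> N - 1" "s - 1 + 2 = s + 1" using True by (simp_all add: N_def)
      then show ?thesis using alternating_colours(2)[OF cycA that(1) rng that(2), of "s - 1"] As Aq by metis
    qed
    moreover have "\<phi>' (v (s - 1)) \<noteq> \<phi> (v (s - 1))"
      using True s by (intro turned) auto
    ultimately show False using hA m same[of r] by (metis order_refl)
  next
    case False
    then have s1: "s = 1" and r: "r \<ge> 1" using s by auto
    \<comment> \<open>\<open>A 1\<close> changes while \<open>A 2\<close> and \<open>A 3\<close> do not; one of the two colourings has two colours on \<open>A\<close>,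
      which by alternation shows in \<open>A 2\<close> and \<open>A 3\<close>, hence the other one has two colours as well\<close>
    have A23: "A 2 = q r" "A 3 = q (r - 1)" using s1 r Aq by (simp_all add: A w_def N_def)
    have rng: "1 \<in> {1..N - 1}" "N - 1 \<in> {1..N - 1}" "2 \<in> {1..N - 1}" "3 \<in> {1..N - 1}"
      using r s1 by (auto simp: N_def)
    have turned1: "\<phi>' (v 1) \<noteq> \<phi> (v 1)" using turned[of 1] n by simp
    then consider "\<phi> (A 1) \<noteq> \<phi> (A (N - 1))" | "\<phi>' (A 1) \<noteq> \<phi>' (A (N - 1))"
      using same[of 0] As Aq by fastforce
    then have "\<phi> (q r) \<noteq> \<phi> (q (r - 1))"
    proof cases
      case 1
      show ?thesis
        using alternating_colours(1)[OF cycA hA(1) rng(1,2) 1, of 2] rng A23 by (simp add: numeral_eq_Suc)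
    next
      case 2
      show ?thesis
        using alternating_colours(1)[OF cycA hA(2) rng(1,2) 2, of 2] rng A23 same[of r] same[of "r - 1"]
        by (simp add: numeral_eq_Suc)
    qed
    then have m: "\<phi> (A 2) \<noteq> \<phi> (A 3)" "\<phi>' (A 2) \<noteq> \<phi>' (A 3)"
      using same[of r] same[of "r - 1"] by (simp_all add: A23)
    have "\<chi> (q (r - 1)) = \<chi> (v 1)" if "hole \<chi> (A 0)" "\<chi> (A 2) \<noteq> \<chi> (A 3)" for \<chi>
      using alternating_colours(2)[OF cycA that(1) rng(3,4) that(2), of 1] rng As A23
      by (simp add: numeral_eq_Suc)
    from this[OF hA(1) m(1)] this[OF hA(2) m(2)] same[of "r - 1"] turned1 show False by simp
  qed
qed

lemma no_ear_from:
  assumes cyc: "icycle n v" and h: "hole \<phi> (v 0)"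
    and mixed: "s0 \<in> {1..n - 1}" "t0 \<in> {1..n - 1}" "\<phi> (v s0) \<noteq> \<phi> (v t0)"
    and s: "1 \<le> s" "s \<le> n - 2" "2 \<le> s + r"
    and q: "\<And>j. j \<le> r \<Longrightarrow> q j \<in> V - range v"
    and qq: "\<And>i j. i < j \<Longrightarrow> j \<le> r \<Longrightarrow> q i \<noteq> q j \<and> (adj (q i) (q j) \<longleftrightarrow> j = i + 1)"
    and vq: "\<And>t j. t \<le> s \<Longrightarrow> j \<le> r \<Longrightarrow> adj (v (k + t)) (q j) \<longleftrightarrow> t = 0 \<and> j = 0 \<or> t = s \<and> j = r"
  shows False
proof -
  have "n \<ge> 3" using cyc by (simp add: icycle_def)
  then have n: "1 \<in> {1..n - 1}" "2 \<in> {1..n - 1}" by auto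
  define v' where "v' j = v (j + k)" for j
  obtain \<psi> where "hole \<psi> (v k)" "\<psi> (v (1 + k)) \<noteq> \<psi> (v (2 + k))"
    using shifted_hole[OF cyc h mixed] by blast
  then have "hole \<psi> (v' 0)" "\<psi> (v' 1) \<noteq> \<psi> (v' 2)" by (simp_all add: v'_def)
  moreover have "icycle n v'" "range v' = range v"
    using icycle_shift[OF cyc] icycle_shift_range[OF cyc] by (simp_all add: v'_def[abs_def])
  moreover have "adj (v' t) (q j) \<longleftrightarrow> t = 0 \<and> j = 0 \<or> t = s \<and> j = r" if "t \<le> s" "j \<le> r" for t j
    using vq[OF that] by (simp add: v'_def add.commute)
  ultimately show False
    using no_ear[of n v' \<psi> 1 2 s r q] s q qq n by simp
qed

text \<open>
  The two ends of the ear are interchangeable, so the arc of the cycle between them may always be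
  chosen to miss a vertex of the cycle.
\<close>

lemma no_long_ear:
  assumes cyc: "icycle n v" and h: "hole \<phi> (v 0)"
    and mixed: "s0 \<in> {1..n - 1}" "t0 \<in> {1..n - 1}" "\<phi> (v s0) \<noteq> \<phi> (v t0)"
    and ab: "a \<in> range v" "b \<in> range v" "a \<noteq> b" and r: "r \<ge> (1 :: nat)"
    and q: "\<And>j. j \<le> r \<Longrightarrow> q j \<in> V - range v"
    and qq: "\<And>i j. i < j \<Longrightarrow> j \<le> r \<Longrightarrow> q i \<noteq> q j \<and> (adj (q i) (q j) \<longleftrightarrow> j = i + 1)"
    and vq: "\<And>d j. d \<in> range v \<Longrightarrow> j \<le> r \<Longrightarrow> adj d (q j) \<longleftrightarrow> d = a \<and> j = 0 \<or> d = b \<and> j = r"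
  shows False
proof -
  have n: "n \<ge> 3" using cyc by (simp add: icycle_def)
  note inj = icycle_inj[OF cyc]
  obtain k where k: "a = v k" using ab(1) by blast
  obtain t where t: "t < n" "b = v (k + t)" using icycle_range_from[OF cyc ab(2)] by blast
  have t1: "t \<ge> 1" using t k ab(3) by (cases t) auto
  show False
  proof (cases "t \<le> n - 2")
    case True
    have "adj (v (k + i)) (q j) \<longleftrightarrow> i = 0 \<and> j = 0 \<or> i = t \<and> j = r" if "i \<le> t" "j \<le> r" for i j
      using vq[of "v (k + i)" j] inj[of i 0 k] inj[of i t k] that t k by simp
    moreover have "2 \<le> t + r" using t1 r by simp
    ultimately show False
      using no_ear_from[OF cyc h mixed t1 True, of r q k] q qq by blast
  next
    case False
    then have "k + t + 1 = k + n" using t by simp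
    then have a': "a = v (k + t + 1)" using icycle_periodic[OF cyc, of k] k by (simp only:)
    define q' where "q' j = q (r - j)" for j
    have q'1: "q' j \<in> V - range v" if "j \<le> r" for j using q by (simp add: q'_def)
    have q'2: "q' i \<noteq> q' j \<and> (adj (q' i) (q' j) \<longleftrightarrow> j = i + 1)" if "i < j" "j \<le> r" for i j
    proof -
      have "r - j < r - i" "r - i \<le> r" "r - i = r - j + 1 \<longleftrightarrow> j = i + 1" using that by linarith+
      then show ?thesis using qq[of "r - j" "r - i"] by (auto simp: q'_def adj_sym[of "q (r - i)"])
    qed
    have q'3: "adj (v (k + t + i)) (q' j) \<longleftrightarrow> i = 0 \<and> j = 0 \<or> i = 1 \<and> j = r" if "i \<le> 1" "j \<le> r" for i j
      using vq[of "v (k + t + i)" "r - j"] inj[of i 0 "k + t"] inj[of i 1 "k + t"] that t a' n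
      by (auto simp: q'_def)
    have "(1::nat) \<le> 1" "1 \<le> n - 2" "2 \<le> 1 + r" using n r by linarith+
    then show False
      using no_ear_from[OF cyc h mixed, of 1 r q' "k + t"] q'1 q'2 q'3 by blast
  qed
qed

text \<open>
  Moving the hole once around a triangle exchanges the colours of the other two vertices.
\<close>

lemma swap_in_triangle:
  assumes h: "hole \<phi> z" and t: "adj z u" "adj u x" "adj x z"
  shows "hole (\<phi>(u := \<phi> x, x := \<phi> u)) z"
proof -
  have ne: "z \<noteq> u" "u \<noteq> x" "x \<noteq> z" using t by auto
  have "hole (\<phi>(z := \<phi> u)) u" using hole_move[OF h t(1)] .
  from hole_move[OF this t(2)] have "hole (\<phi>(z := \<phi> u, u := \<phi> x)) x" using ne by simp
  from hole_move[OF this t(3)] have "hole (\<phi>(z := \<phi> u, u := \<phi> x, x := \<phi> u)) z" using ne by simp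
  then show ?thesis by (rule hole_cong) (use ne in auto)
qed

text \<open>
  Exchanging the colours of \<open>x\<close> and of its neighbour \<open>w 1\<close> on the cycle keeps the colours of \<open>w 2\<close> and \<open>w 3\<close>,
  and by alternation \<open>w 3\<close> determines the colour of \<open>w 1\<close>. So \<open>x\<close> has the colour of \<open>w 1\<close>.
  This holds also after a full rotation, which changes the colour of \<open>w 1\<close> but not that of \<open>x\<close>.
  On a cycle of length three, \<open>w 3\<close> would be the hole.
\<close>

lemma no_triangle_on_long_cycle:
  assumes cyc: "icycle n v" and h: "hole \<phi> (v 0)"
    and mixed: "s0 \<in> {1..n - 1}" "t0 \<in> {1..n - 1}" "\<phi> (v s0) \<noteq> \<phi> (v t0)"
    and n: "n \<ge> 5" and x: "x \<notin> range v" "adj x (v k)" "adj x (v (k + 1))"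
  shows False
proof -
  define w where "w j = v (j + k)" for j
  have cycw: "icycle n w" and rw: "range w = range v"
    using icycle_shift[OF cyc] icycle_shift_range[OF cyc] by (simp_all add: w_def[abs_def])
  have adjw: "adj (w 0) (w 1)" "adj (w 1) x" "adj x (w 0)"
    using icycle_step[OF cyc, of k] x by (simp_all add: w_def adj_sym[of _ x])
  obtain \<psi> where hw: "hole \<psi> (w 0)" and mw: "\<psi> (w 1) \<noteq> \<psi> (w 2)"
    using shifted_hole[OF cyc h mixed, of k] by (auto simp: w_def)
  have rng: "1 \<in> {1..n - 1}" "2 \<in> {1..n - 1}" "3 \<in> {1..n - 1}" using n by auto
  have key: "\<chi> x = \<chi> (w 1)" if hc: "hole \<chi> (w 0)" and mc: "\<chi> (w 1) \<noteq> \<chi> (w 2)" for \<chi>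
  proof -
    define \<chi>' where "\<chi>' = \<chi>(w 1 := \<chi> x, x := \<chi> (w 1))"
    have h': "hole \<chi>' (w 0)" unfolding \<chi>'_def by (rule swap_in_triangle[OF hc adjw])
    have "w (1 + t) \<noteq> w 1" if "1 \<le> t" "t < n" for t using cycw that unfolding icycle_def by blast
    from this[of 1] this[of 2] have "w 2 \<noteq> w 1" "w 3 \<noteq> w 1" using n by (simp_all add: numeral_eq_Suc)
    then have same: "\<chi>' (w 2) = \<chi> (w 2)" "\<chi>' (w 3) = \<chi> (w 3)" "\<chi>' (w 1) = \<chi> x"
      using x(1) rw by (auto simp: \<chi>'_def)
    have "\<chi> (w 3) = \<chi> (w 1)"
      using alternating_colours(2)[OF cycw hc rng(1,2) mc, of 1] n by (simp add: numeral_eq_Suc)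
    moreover from this have "\<chi>' (w 3) \<noteq> \<chi>' (w 2)" using mc same by simp
    then have "\<chi>' (w 3) = \<chi>' (w 1)"
      using alternating_colours(2)[OF cycw h' rng(3,2), of 1] n by (simp add: numeral_eq_Suc)
    ultimately show ?thesis using same by simp
  qed
  obtain \<psi>' where "hole \<psi>' (w 0)" "\<psi>' (w 1) \<noteq> \<psi>' (w 2)" "\<psi>' (w 1) \<noteq> \<psi> (w 1)" "\<psi>' x = \<psi> x"
    using full_rotation[OF cycw hw rng(1,2) mw] rng x(1) rw by blast
  then show False using key[OF hw mw] key[of \<psi>'] by simp
qed

end

section \<open>Shortest walks\<close>

text \<open>
  A shortest walk among those with ends related by \<open>Q\<close> admits no shortcut, and no proper part of it
  can compete. Letting the ends vary within a relation covers both shortest ears and shortest paths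
  between neighbours of different colours.
\<close>

lemma shortest_walk:
  assumes walk: "(x, y) \<in> G\<^sup>*" and ends: "Q x y"
  shows "\<exists>(r :: nat) q. Q (q 0) (q r) \<and> (\<forall>i < r. (q i, q (Suc i)) \<in> G) \<and>
    (\<forall>a b. a < b \<longrightarrow> b \<le> r \<longrightarrow> q a \<noteq> q b \<and> ((q a, q b) \<in> G \<longleftrightarrow> b = a + 1)) \<and>
    (\<forall>a b. a \<le> b \<longrightarrow> b \<le> r \<longrightarrow> b - a < r \<longrightarrow> \<not> Q (q a) (q b))"
proof -
  define P where "P r \<longleftrightarrow> (\<exists>x y. Q x y \<and> (x, y) \<in> G ^^ r)" for r
  define r where "r = (LEAST r. P r)"
  have "\<exists>r. P r" using rtrancl_imp_relpow[OF walk] ends unfolding P_def by blast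
  then have Pr: "P r" unfolding r_def by (metis LeastI)
  have least: "\<not> P r'" if "r' < r" for r' using that not_less_Least unfolding r_def by blast
  obtain x y where "Q x y" "(x, y) \<in> G ^^ r" using Pr by (auto simp: P_def)
  then obtain q where q: "Q (q 0) (q r)" "\<And>i. i < r \<Longrightarrow> (q i, q (Suc i)) \<in> G"
    by (metis relpow_fun_conv)
  have sub: "(q a, q b) \<in> G ^^ (b - a)" if "a \<le> b" "b \<le> r" for a b
    unfolding relpow_fun_conv by (rule exI[of _ "\<lambda>i. q (a + i)"]) (use that q(2) in auto)
  \<comment> \<open>a shortcut from \<open>q a\<close> to \<open>q b\<close> would give a shorter walk with the same ends\<close>
  have no_shortcut: "(q a, q b) \<notin> G ^^ e" if "a \<le> b" "b \<le> r" "e < b - a" for a b e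
  proof
    assume "(q a, q b) \<in> G ^^ e"
    moreover have "(q 0, q a) \<in> G ^^ a" "(q b, q r) \<in> G ^^ (r - b)"
      using sub[of 0 a] sub[of b r] that by simp_all
    ultimately have "(q 0, q r) \<in> (G ^^ a O G ^^ e) O G ^^ (r - b)" by blast
    then have "(q 0, q r) \<in> G ^^ (a + e + (r - b))" by (simp only: relpow_add)
    then have "P (a + e + (r - b))" using q(1) by (auto simp: P_def)
    moreover have "a + e + (r - b) < r" using that by linarith
    ultimately show False using least by blast
  qed
  have "q a \<noteq> q b \<and> ((q a, q b) \<in> G \<longleftrightarrow> b = a + 1)" if "a < b" "b \<le> r" for a b
  proof
    show "q a \<noteq> q b" using no_shortcut[of a b 0] that by auto
    show "(q a, q b) \<in> G \<longleftrightarrow> b = a + 1"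
      using no_shortcut[of a b 1] q(2)[of a] that by (cases "b = a + 1") auto
  qed
  moreover have "\<not> Q (q a) (q b)" if "a \<le> b" "b \<le> r" "b - a < r" for a b
    using least[OF that(3)] sub[OF that(1,2)] by (auto simp: P_def)
  ultimately show ?thesis using q by blast
qed

section \<open>Blocks\<close>

locale critical_block = critical +
  assumes block_cut: "\<And>z T. z \<in> V \<Longrightarrow> T \<subseteq> V - {z} \<Longrightarrow> T \<noteq> {} \<Longrightarrow> T \<noteq> V - {z} \<Longrightarrow>
    \<exists>u \<in> T. \<exists>w \<in> V - {z} - T. (u, w) \<in> E \<union> E\<inverse>"
begin

lemma connected_minus_vertex:
  assumes "z \<in> V" "T \<subseteq> V - {z}" "T \<noteq> {}" "w0 \<in> V - {z} - T"
  obtains u w where "u \<in> T" "w \<in> V - {z} - T" "adj u w"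
proof -
  have "T \<noteq> V - {z}" using assms(4) by blast
  then show ?thesis using block_cut[OF assms(1-3)] that by (auto simp: adj_def)
qed

text \<open>
  An induced path outside \<open>C\<close> attached to two different vertices \<open>a\<close> and \<open>b\<close> of \<open>C\<close>. A path with a
  single vertex may have further neighbours in \<open>C\<close>.
\<close>

definition ear :: "'a set \<Rightarrow> nat \<Rightarrow> (nat \<Rightarrow> 'a) \<Rightarrow> 'a \<Rightarrow> 'a \<Rightarrow> bool" where
  "ear C r q a b \<longleftrightarrow> a \<in> C \<and> b \<in> C \<and> a \<noteq> b \<and> adj a (q 0) \<and> adj b (q r) \<and>
    (\<forall>j \<le> r. q j \<in> V - C) \<and>
    (\<forall>i j. i < j \<longrightarrow> j \<le> r \<longrightarrow> q i \<noteq> q j \<and> (adj (q i) (q j) \<longleftrightarrow> j = i + 1)) \<and>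
    (r \<ge> 1 \<longrightarrow> (\<forall>d \<in> C. \<forall>j \<le> r. adj d (q j) \<longleftrightarrow> d = a \<and> j = 0 \<or> d = b \<and> j = r))"

lemma ear_attached_at_ends:
  assumes "ear C r q a b" "r \<ge> 1" "d \<in> C" "j \<le> r"
  shows "adj d (q j) \<longleftrightarrow> d = a \<and> j = 0 \<or> d = b \<and> j = r"
  using assms by (simp add: ear_def)

text \<open>
  Such paths exist because no vertex of \<open>C\<close> separates the others from the outside; a shortest one
  is an ear.
\<close>

lemma ear_exists:
  assumes C: "C \<subseteq> V" "C \<noteq> V" "c \<in> C" "c' \<in> C" "c \<noteq> c'"
  shows "\<exists>r q a b. ear C r q a b"
proof -
  define G where "G = {(u, w). u \<in> V - C \<and> w \<in> V - C \<and> adj u w}"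
  define Q where "Q x y \<longleftrightarrow> x \<in> V - C \<and> y \<in> V - C \<and> (\<exists>a \<in> C. \<exists>b \<in> C. a \<noteq> b \<and> adj a x \<and> adj b y)" for x y

  have QI: "Q x y" if "a \<in> C" "b \<in> C" "a \<noteq> b" "adj a x" "adj b y" "x \<in> V - C" "y \<in> V - C" for a b x y
    using that unfolding Q_def by blast
  obtain a0 x where a0: "a0 \<in> C" "x \<in> V - C" "adj a0 x"
    using connected_cut[of C] C by blast
  have "\<exists>y. (x, y) \<in> G\<^sup>* \<and> Q x y"
  proof -
    define T where "T = {y. (x, y) \<in> G\<^sup>*}"
    have TV: "T \<subseteq> V - C"
    proof
      fix y assume "y \<in> T"
      then have "(x, y) \<in> G\<^sup>*" by (simp add: T_def)
      then show "y \<in> V - C" by (cases rule: rtranclE) (use a0 in \<open>auto simp: G_def\<close>)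
    qed
    obtain b0 where b0: "b0 \<in> C" "b0 \<noteq> a0" using C by metis
    have "a0 \<in> V" "T \<subseteq> V - {a0}" "T \<noteq> {}" "b0 \<in> V - {a0} - T"
      using a0 b0 C TV by (auto simp: T_def)
    then obtain u w where uw: "u \<in> T" "w \<in> V - {a0} - T" "adj u w"
      by (rule connected_minus_vertex)
    have "w \<in> C"
    proof (rule ccontr)
      assume "w \<notin> C"
      then have "(u, w) \<in> G" using uw TV by (auto simp: G_def)
      then have "w \<in> T" using uw(1) by (auto simp: T_def)
      then show False using uw(2) by blast
    qed
    moreover have "adj w u" using uw(3) adj_sym by blast
    moreover have "u \<in> V - C" "a0 \<noteq> w" using uw(1,2) TV by blast+
    ultimately have "Q x u" using a0 by (intro QI[of a0 w])
    then show ?thesis using uw(1) by (auto simp: T_def)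
  qed
  then obtain y where "(x, y) \<in> G\<^sup>*" "Q x y" by blast
  then obtain r :: nat and q where Q: "Q (q 0) (q r)" and walk: "\<And>i. i < r \<Longrightarrow> (q i, q (Suc i)) \<in> G"
    and ind: "\<And>a b. a < b \<Longrightarrow> b \<le> r \<Longrightarrow> q a \<noteq> q b \<and> ((q a, q b) \<in> G \<longleftrightarrow> b = a + 1)"
    and short: "\<And>a b. a \<le> b \<Longrightarrow> b \<le> r \<Longrightarrow> b - a < r \<Longrightarrow> \<not> Q (q a) (q b)"
    using shortest_walk[of x y G Q] by metis
  have qV: "q j \<in> V - C" if "j \<le> r" for j
    using that Q walk[of "j - 1"] by (cases j) (auto simp: Q_def G_def)
  obtain a b where ab: "a \<in> C" "b \<in> C" "a \<noteq> b" "adj a (q 0)" "adj b (q r)"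
    using Q by (auto simp: Q_def)
  have qq: "q i \<noteq> q j \<and> (adj (q i) (q j) \<longleftrightarrow> j = i + 1)" if "i < j" "j \<le> r" for i j
    using ind[OF that] qV[of i] qV[of j] that by (auto simp: G_def)
  have "adj d (q j) \<longleftrightarrow> d = a \<and> j = 0 \<or> d = b \<and> j = r" if r: "r \<ge> 1" and d: "d \<in> C" and j: "j \<le> r" for d j
  proof
    assume dj: "adj d (q j)"
    \<comment> \<open>otherwise an initial or a final part of the ear would be a shorter ear\<close>
    have left: "d = a" if "j < r"
    proof (rule ccontr)
      assume "d \<noteq> a"
      then have "Q (q 0) (q j)" using ab d dj qV[of 0] qV[OF j] by (intro QI[of a d]) simp_all
      then show False using short[of 0 j] that by simp
    qed
    have right: "d = b" if "0 < j"
    proof (rule ccontr)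
      assume "d \<noteq> b"
      then have "Q (q j) (q r)" using ab d dj qV[of r] qV[OF j] by (intro QI[of d b]) simp_all
      then show False using short[of j r] that j by simp
    qed
    show "d = a \<and> j = 0 \<or> d = b \<and> j = r"
      using left right ab(3) j r by (cases "j = 0"; cases "j = r") auto
  qed (use ab in auto)
  then have "ear C r q a b" unfolding ear_def using ab qV qq by blast
  then show ?thesis by blast
qed

text \<open>
  A shortest path avoiding \<open>z\<close> between two neighbours of \<open>z\<close> of different colours has no inner
  neighbour of \<open>z\<close>, as that would differ in colour from one of the ends. Together with \<open>z\<close> it
  forms an induced cycle.
\<close>

lemma mixed_cycle_exists:
  assumes h: "hole \<phi> z" and nb: "adj z u" "adj z w" "\<phi> u \<noteq> \<phi> w"
  shows "\<exists>n v. icycle n v \<and> v 0 = z \<and> \<phi> (v 1) \<noteq> \<phi> (v (n - 1))"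
proof -
  have z: "z \<in> V" and uV: "u \<in> V - {z}" and wV: "w \<in> V - {z}" using nb adj_V by auto
  define G where "G = {(a, b). a \<in> V - {z} \<and> b \<in> V - {z} \<and> adj a b}"
  define Q where "Q x y \<longleftrightarrow> adj z x \<and> adj z y \<and> \<phi> x \<noteq> \<phi> y" for x y
  have "(u, w) \<in> G\<^sup>*"
  proof (rule ccontr)
    assume nw: "(u, w) \<notin> G\<^sup>*"
    define T where "T = {y. (u, y) \<in> G\<^sup>*}"
    have TV: "T \<subseteq> V - {z}"
    proof
      fix y assume "y \<in> T"
      then have "(u, y) \<in> G\<^sup>*" by (simp add: T_def)
      then show "y \<in> V - {z}" by (cases rule: rtranclE) (use uV in \<open>auto simp: G_def\<close>)
    qed
    moreover have "T \<noteq> {}" "w \<in> V - {z} - T" using wV nw by (auto simp: T_def)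
    ultimately obtain a b where ab: "a \<in> T" "b \<in> V - {z} - T" "adj a b"
      using connected_minus_vertex[OF z] by metis
    then have "(a, b) \<in> G" using TV by (auto simp: G_def)
    then have "b \<in> T" using ab(1) by (auto simp: T_def)
    then show False using ab(2) by blast
  qed
  moreover have "Q u w" using nb by (simp add: Q_def)
  ultimately obtain r :: nat and q where Q: "Q (q 0) (q r)" and walk: "\<And>i. i < r \<Longrightarrow> (q i, q (Suc i)) \<in> G"
    and ind: "\<And>a b. a < b \<Longrightarrow> b \<le> r \<Longrightarrow> q a \<noteq> q b \<and> ((q a, q b) \<in> G \<longleftrightarrow> b = a + 1)"
    and short: "\<And>a b. a \<le> b \<Longrightarrow> b \<le> r \<Longrightarrow> b - a < r \<Longrightarrow> \<not> Q (q a) (q b)"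
    using shortest_walk[of u w G Q] by metis
  have qV: "q j \<in> V - {z}" if "j \<le> r" for j
    using that Q walk[of "j - 1"] adj_V[of z "q 0"] by (cases j) (auto simp: Q_def G_def)
  have r: "r \<ge> 1" using Q by (cases r) (auto simp: Q_def)
  have inner: "\<not> adj z (q j)" if "0 < j" "j < r" for j
  proof
    assume "adj z (q j)"
    then have "Q (q 0) (q j) \<or> Q (q j) (q r)" using Q by (auto simp: Q_def)
    then show False using short[of 0 j] short[of j r] that by auto
  qed
  define w where "w a = (if a = 0 then z else q (a - 1))" for a
  have "icycle (r + 2) (\<lambda>k. w (k mod (r + 2)))"
  proof (rule icycleI)
    show "r + 2 \<ge> 3" using r by simp
    show "w a \<in> V" if "a < r + 2" for a using that z qV[of "a - 1"] by (auto simp: w_def)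
    fix a b assume ab: "a < b" "b < r + 2"
    then have b: "w b = q (b - 1)" "b - 1 \<le> r" by (auto simp: w_def)
    show "w a \<noteq> w b \<and> (adj (w a) (w b) \<longleftrightarrow> b = a + 1 \<or> (a = 0 \<and> b = r + 2 - 1))"
    proof (cases "a = 0")
      case True
      have "adj z (q (b - 1)) \<longleftrightarrow> b = 1 \<or> b = r + 1"
        using Q inner[of "b - 1"] ab b True by (cases "b = 1"; cases "b = r + 1") (auto simp: Q_def)
      then show ?thesis using True b qV[OF b(2)] by (auto simp: w_def)
    next
      case False
      then have lt: "a - 1 < b - 1" and a: "w a = q (a - 1)" using ab by (auto simp: w_def)
      have "adj (q (a - 1)) (q (b - 1)) \<longleftrightarrow> b - 1 = a - 1 + 1"
        using ind[OF lt b(2)] qV[of "a - 1"] qV[of "b - 1"] lt b(2) by (auto simp: G_def)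
      moreover have "b - 1 = a - 1 + 1 \<longleftrightarrow> b = a + 1" using False ab by linarith
      ultimately show ?thesis using ind[OF lt b(2)] a b False by simp
    qed
  qed
  moreover have "w (0 mod (r + 2)) = z" "w (1 mod (r + 2)) = q 0" "w ((r + 2 - 1) mod (r + 2)) = q r"
    by (auto simp: w_def)
  moreover have "\<phi> (q 0) \<noteq> \<phi> (q r)" using Q by (simp add: Q_def)
  ultimately show ?thesis by metis
qed

text \<open>
  If vertices were left over, there would be an ear. It can only have one vertex \<open>x\<close>. Take two neighbours of
  \<open>x\<close> on the cycle that are closest to each other along the cycle: either they are adjacent and
  form a triangle with \<open>x\<close>, or \<open>x\<close> is an ear without further neighbours between them.
\<close>

lemma long_mixed_cycle_spans:
  assumes cyc: "icycle n v" and h: "hole \<phi> (v 0)"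
    and mixed: "s0 \<in> {1..n - 1}" "t0 \<in> {1..n - 1}" "\<phi> (v s0) \<noteq> \<phi> (v t0)" and n: "n \<ge> 5"
  shows "range v = V"
proof (rule ccontr)
  assume "range v \<noteq> V"
  moreover have "range v \<subseteq> V" "v 0 \<noteq> v 1"
    using cyc icycle_step[OF cyc, of 0] by (auto simp: icycle_def)
  ultimately obtain r q a b where ear: "ear (range v) r q a b"
    using ear_exists[of "range v" "v 0" "v 1"] by blast
  have ab: "a \<in> range v" "b \<in> range v" "a \<noteq> b" "adj a (q 0)" "adj b (q r)"
    and q: "\<And>j. j \<le> r \<Longrightarrow> q j \<in> V - range v"
    and qq: "\<And>i j. i < j \<Longrightarrow> j \<le> r \<Longrightarrow> q i \<noteq> q j \<and> (adj (q i) (q j) \<longleftrightarrow> j = i + 1)"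
    using ear unfolding ear_def by simp_all
  have vq: "adj d (q j) \<longleftrightarrow> d = a \<and> j = 0 \<or> d = b \<and> j = r" if "r \<ge> 1" "d \<in> range v" "j \<le> r" for d j
    using ear_attached_at_ends[OF ear] that by blast
  show False
  proof (cases "r \<ge> 1")
    case True
    show False
      by (rule no_long_ear[OF cyc h mixed ab(1-3) True, of q]) (fact q, fact qq, fact vq[OF True])
  next
    case False
    then have r0: "r = 0" by simp
    define x where "x = q 0"
    have x: "x \<in> V - range v" "adj a x" "adj b x" using q[of 0] ab r0 by (simp_all add: x_def)
    define P where "P t \<longleftrightarrow> 1 \<le> t \<and> t \<le> n - 2 \<and> (\<exists>k. adj (v k) x \<and> adj (v (k + t)) x)" for t
    have "\<exists>t. P t"
    proof -
      obtain k where k: "a = v k" using ab(1) by blast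
      obtain t where t: "t < n" "b = v (k + t)" using icycle_range_from[OF cyc ab(2)] by blast
      have "t \<noteq> 0" using t k ab(3) by (cases t) auto
      show ?thesis
      proof (cases "t \<le> n - 2")
        case True
        then have "P t" unfolding P_def using \<open>t \<noteq> 0\<close> k t x by (intro conjI exI[of _ k]) auto
        then show ?thesis ..
      next
        case False
        \<comment> \<open>the other way round, \<open>a\<close> is the successor of \<open>b\<close>\<close>
        then have "k + t + 1 = k + n" using t by simp
        then have "a = v (k + t + 1)" using icycle_periodic[OF cyc, of k] k by (simp only:)
        then have "P 1" using x t n unfolding P_def by (intro conjI exI[of _ "k + t"]) auto
        then show ?thesis ..
      qed
    qed
    define t where "t = (LEAST t. P t)"
    have Pt: "P t" and least: "\<And>t'. t' < t \<Longrightarrow> \<not> P t'"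
      using \<open>\<exists>t. P t\<close> unfolding t_def by (metis LeastI, metis not_less_Least)
    obtain k where t: "1 \<le> t" "t \<le> n - 2" and k: "adj (v k) x" "adj (v (k + t)) x"
      using Pt by (auto simp: P_def)
    show False
    proof (cases "t = 1")
      case True
      then show False
        using no_triangle_on_long_cycle[OF cyc h mixed n, of x k] x k by (auto simp: adj_sym[of x])
    next
      case False
      have "\<not> adj (v (k + i)) x" if "0 < i" "i < t" for i
        using least[OF that(2)] that t k(1) by (auto simp: P_def)
      then have "adj (v (k + i)) x \<longleftrightarrow> i = 0 \<or> i = t" if "i \<le> t" for i
        using k that by (cases "i = 0"; cases "i = t") auto
      moreover have "2 \<le> t + 0" using False t by simp
      ultimately show False
        using no_ear_from[OF cyc h mixed t, of 0 "\<lambda>_. x" k] x(1) by simp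
    qed
  qed
qed

end

section \<open>Mixed cliques\<close>

context critical_block
begin

definition mixed_clique :: "'a set \<Rightarrow> bool" where
  "mixed_clique K \<longleftrightarrow> K \<subseteq> V \<and> (\<forall>u \<in> K. \<forall>w \<in> K. u \<noteq> w \<longrightarrow> adj u w) \<and>
     (\<exists>\<phi> z. \<exists>u \<in> K. \<exists>w \<in> K. hole \<phi> z \<and> z \<in> K \<and> u \<noteq> z \<and> w \<noteq> z \<and> \<phi> u \<noteq> \<phi> w)"

lemma mixed_cliqueI:
  assumes "K \<subseteq> V" "\<And>u w. u \<in> K \<Longrightarrow> w \<in> K \<Longrightarrow> u \<noteq> w \<Longrightarrow> adj u w"
    and "hole \<phi> z" "z \<in> K" "u \<in> K" "w \<in> K" "u \<noteq> z" "w \<noteq> z" "\<phi> u \<noteq> \<phi> w"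
  shows "mixed_clique K"
  using assms unfolding mixed_clique_def by metis

lemma triangle_icycle:
  assumes "adj a b" "adj b d" "adj a d"
  shows "\<exists>v. icycle 3 v \<and> v 0 = a \<and> v 1 = b \<and> v 2 = d \<and> range v = {a, b, d}"
proof -
  define w where "w j = (if j = 0 then a else if j = 1 then b else d)" for j :: nat
  have V: "a \<in> V" "b \<in> V" "d \<in> V" and ne: "a \<noteq> b" "b \<noteq> d" "a \<noteq> d" using assms adj_V by auto
  have "icycle 3 (\<lambda>k. w (k mod 3))"
  proof (rule icycleI)
    show "w a \<in> V" for a using V by (simp add: w_def)
    fix i j :: nat assume "i < j" "j < 3"
    then have "i = 0 \<and> j = 1 \<or> i = 0 \<and> j = 2 \<or> i = 1 \<and> j = 2" by linarith
    then show "w i \<noteq> w j \<and> (adj (w i) (w j) \<longleftrightarrow> j = i + 1 \<or> i = 0 \<and> j = 3 - 1)"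
      using assms ne by (auto simp: w_def)
  qed simp
  moreover have "range (\<lambda>k. w (k mod 3)) = {a, b, d}"
  proof
    show "range (\<lambda>k. w (k mod 3)) \<subseteq> {a, b, d}" by (auto simp: w_def)
    have "a = w (0 mod 3)" "b = w (1 mod 3)" "d = w (2 mod 3)" by (simp_all add: w_def)
    then show "{a, b, d} \<subseteq> range (\<lambda>k. w (k mod 3))" by blast
  qed
  moreover have "w (0 mod 3) = a" "w (1 mod 3) = b" "w (2 mod 3) = d" by (simp_all add: w_def)
  ultimately show ?thesis by blast
qed

text \<open>
  Exchanges in triangles permute the colours of a clique at will, with the hole at any of its vertices.
\<close>

lemma mixed_clique_recolour:
  assumes K: "mixed_clique K" and abd: "a \<in> K" "b \<in> K" "d \<in> K" "a \<noteq> b" "b \<noteq> d" "a \<noteq> d"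
  shows "\<exists>\<phi>. hole \<phi> a \<and> \<phi> b \<noteq> \<phi> d"
proof -
  have adjK: "adj x y" if "x \<in> K" "y \<in> K" "x \<noteq> y" for x y using K that by (auto simp: mixed_clique_def)
  obtain \<phi> z u w where h: "hole \<phi> z" and zuw: "z \<in> K" "u \<in> K" "w \<in> K" "u \<noteq> z" "w \<noteq> z" "\<phi> u \<noteq> \<phi> w"
    using K by (auto simp: mixed_clique_def)
  have "\<exists>\<phi>1 u1 w1. hole \<phi>1 a \<and> u1 \<in> K \<and> w1 \<in> K \<and> u1 \<noteq> a \<and> w1 \<noteq> a \<and> \<phi>1 u1 \<noteq> \<phi>1 w1"
  proof (cases "z = a")
    case True
    then show ?thesis using h zuw by blast
  next
    case False
    have h1: "hole (\<phi>(z := \<phi> a)) a" using hole_move[OF h adjK] zuw(1) abd(1) False by blast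
    consider "u = a" | "w = a" | "u \<noteq> a" "w \<noteq> a" by blast
    then show ?thesis
    proof cases
      case 1
      then show ?thesis using h1 zuw False by (intro exI[of _ "\<phi>(z := \<phi> a)"] exI[of _ z] exI[of _ w]) auto
    next
      case 2
      then show ?thesis using h1 zuw False by (intro exI[of _ "\<phi>(z := \<phi> a)"] exI[of _ z] exI[of _ u]) auto
    next
      case 3
      then show ?thesis using h1 zuw False by (intro exI[of _ "\<phi>(z := \<phi> a)"] exI[of _ u] exI[of _ w]) auto
    qed
  qed
  then obtain \<phi>1 u1 w1 where h1: "hole \<phi>1 a" and uw: "u1 \<in> K" "w1 \<in> K" "u1 \<noteq> a" "w1 \<noteq> a" "\<phi>1 u1 \<noteq> \<phi>1 w1"
    by blast
  show ?thesis
  proof (cases "\<phi>1 b = \<phi>1 d")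
    case False
    then show ?thesis using h1 by blast
  next
    case True
    obtain e where e: "e \<in> K" "e \<noteq> a" "\<phi>1 e \<noteq> \<phi>1 b" using uw by metis
    then have ne: "e \<noteq> b" "e \<noteq> d" using True by auto
    have "hole (\<phi>1(b := \<phi>1 e, e := \<phi>1 b)) a"
      using swap_in_triangle[OF h1, of b e] adjK abd e ne by auto
    moreover have "(\<phi>1(b := \<phi>1 e, e := \<phi>1 b)) b \<noteq> (\<phi>1(b := \<phi>1 e, e := \<phi>1 b)) d"
      using e ne abd True by auto
    ultimately show ?thesis by blast
  qed
qed

lemma mixed_triangle_bidirected:
  assumes h: "hole \<phi> a" and t: "adj a b" "adj b d" "adj a d" and ne: "\<phi> b \<noteq> \<phi> d"
  shows "(a, b) \<in> E \<and> (b, a) \<in> E"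
proof -
  obtain v where v: "icycle 3 v" "v 0 = a" "v 1 = b" "v 2 = d" using triangle_icycle[OF t] by blast
  have "(v 0, v (0 + 1)) \<in> E \<and> (v (0 + 1), v 0) \<in> E"
    by (rule alternating_rotation(3)[OF v(1), of \<phi> 1 2]) (use v h ne in auto)
  then show ?thesis using v by simp
qed

text \<open>
  With the hole moved to \<open>a\<close>, the colours of \<open>b\<close> and \<open>x\<close> are exchanged in the triangle \<open>a b x\<close>,
  and the hole returns to \<open>d\<close>. Of the two only \<open>b\<close> is a neighbour of \<open>d\<close>, so \<open>exchange\<close> forbids
  that this changes a colour.
\<close>

lemma diamond_colour:
  assumes h: "hole \<phi> d" and t: "adj a b" "adj b d" "adj d a" and x: "adj x a" "adj x b" "\<not> adj x d" "x \<noteq> d"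
  shows "\<phi> x = \<phi> b"
proof (rule ccontr)
  assume ne: "\<phi> x \<noteq> \<phi> b"
  have dist: "a \<noteq> b" "b \<noteq> d" "d \<noteq> a" "x \<noteq> a" "x \<noteq> b" using t x(1,2) by auto
  have h1: "hole (\<phi>(d := \<phi> a)) a" using hole_move[OF h t(3)] .
  define \<phi>2 where "\<phi>2 = \<phi>(d := \<phi> a, b := \<phi> x, x := \<phi> b)"
  have "hole \<phi>2 a"
    using swap_in_triangle[OF h1 t(1), of x] x(1,2) dist x(4) by (simp add: \<phi>2_def adj_sym[of b])
  from hole_move[OF this, of d] have h3: "hole (\<phi>2(a := \<phi>2 d)) d" using t(3) by (simp add: adj_sym[of a])
  obtain R where R: "R \<in> {E, E\<inverse>}" "(d, b) \<in> R" using t(2) by (auto simp: adj_dir adj_sym[of b])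
  have "(\<phi>2(a := \<phi>2 d)) b \<noteq> \<phi> b" using ne dist by (simp add: \<phi>2_def)
  from exchange[OF h h3 R this] obtain y where y: "(d, y) \<in> R" "(\<phi>2(a := \<phi>2 d)) y = \<phi> b" "\<phi> y \<noteq> \<phi> b"
    by blast
  have "adj d y" using y(1) R(1) by (auto simp: adj_dir)
  then have "y \<noteq> x" "y \<noteq> d" using x(3) by (auto simp: adj_sym[of d])
  then show False using y(2,3) dist x(4) by (auto simp: \<phi>2_def split: if_splits)
qed

text \<open>
  Otherwise the hole is placed at \<open>d\<close> with different colours on \<open>a\<close> and \<open>b\<close>, and \<open>x\<close> would have to
  have both.
\<close>

lemma mixed_clique_neighbour:
  assumes K: "mixed_clique K" and card: "card K \<ge> 3" and x: "x \<notin> K"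
    and ab: "a \<in> K" "b \<in> K" "a \<noteq> b" "adj x a" "adj x b" and d: "d \<in> K"
  shows "adj x d"
proof (rule ccontr)
  assume nd: "\<not> adj x d"
  have adjK: "adj u w" if "u \<in> K" "w \<in> K" "u \<noteq> w" for u w using K that by (auto simp: mixed_clique_def)
  have ne: "a \<noteq> d" "b \<noteq> d" "x \<noteq> d" using ab nd x d by auto
  obtain \<phi> where h: "hole \<phi> d" "\<phi> a \<noteq> \<phi> b"
    using mixed_clique_recolour[OF K d ab(1,2)] ab(3) ne by metis
  have "\<phi> x = \<phi> b" "\<phi> x = \<phi> a"
    using diamond_colour[OF h(1), of a b x] diamond_colour[OF h(1), of b a x] adjK ab d ne nd by auto
  then show False using h(2) by simp
qed

lemma third_element:
  assumes "card K \<ge> 3"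
  shows "\<exists>d \<in> K. d \<noteq> a \<and> d \<noteq> b"
proof (rule ccontr)
  assume "\<not> ?thesis"
  then have "K \<subseteq> {a, b}" by blast
  then have "card K \<le> card {a, b}" by (intro card_mono) auto
  also have "card {a, b} \<le> 2" by (simp add: card_insert_if)
  finally show False using assms by simp
qed

text \<open>
  Otherwise there is an ear. If it has several vertices, it is excluded by a triangle in the clique
  containing its two ends; if it is a single vertex, that vertex extends the clique.
\<close>

lemma maximal_mixed_clique_spans:
  assumes K: "mixed_clique K" and card: "card K \<ge> 3"
    and max: "\<And>K'. mixed_clique K' \<Longrightarrow> card K' \<le> card K"
  shows "K = V"
proof (rule ccontr)
  assume KV: "K \<noteq> V"
  have KsubV: "K \<subseteq> V" using K by (simp add: mixed_clique_def)
  have finK: "finite K" using KsubV finite_V finite_subset by blast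
  have adjK: "adj u w" if "u \<in> K" "w \<in> K" "u \<noteq> w" for u w using K that by (auto simp: mixed_clique_def)
  obtain c where c: "c \<in> K" using card by fastforce
  obtain c' where "c' \<in> K" "c' \<noteq> c" using third_element[OF card, of c c] by blast
  then obtain r q a b where ear: "ear K r q a b" using ear_exists[OF KsubV KV c] by metis
  have ab: "a \<in> K" "b \<in> K" "a \<noteq> b" "adj a (q 0)" "adj b (q r)"
    and q: "\<And>j. j \<le> r \<Longrightarrow> q j \<in> V - K"
    and qq: "\<And>i j. i < j \<Longrightarrow> j \<le> r \<Longrightarrow> q i \<noteq> q j \<and> (adj (q i) (q j) \<longleftrightarrow> j = i + 1)"
    using ear unfolding ear_def by simp_all
  have vq: "adj d (q j) \<longleftrightarrow> d = a \<and> j = 0 \<or> d = b \<and> j = r" if "r \<ge> 1" "d \<in> K" "j \<le> r" for d j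
    using ear_attached_at_ends[OF ear] that by blast
  obtain d where d: "d \<in> K" "d \<noteq> a" "d \<noteq> b" using third_element[OF card] by blast
  show False
  proof (cases "r \<ge> 1")
    case True
    obtain \<phi> where h: "hole \<phi> a" "\<phi> b \<noteq> \<phi> d"
      using mixed_clique_recolour[OF K ab(1,2) d(1) ab(3)] d by metis
    obtain v where v: "icycle 3 v" "v 0 = a" "v 1 = b" "v 2 = d" "range v = {a, b, d}"
      using triangle_icycle[of a b d] adjK ab d by metis
    have sub: "range v \<subseteq> K" unfolding v(5) using ab(1,2) d(1) by simp
    have abv: "a \<in> range v" "b \<in> range v" unfolding v(5) by simp_all
    have mixed: "hole \<phi> (v 0)" "\<phi> (v 1) \<noteq> \<phi> (v 2)" unfolding v(2-4) by (fact h)+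
    have idx: "1 \<in> {1..3 - 1 :: nat}" "2 \<in> {1..3 - 1 :: nat}" by simp_all
    show False
    proof (rule no_long_ear[OF v(1) mixed(1) idx mixed(2) abv ab(3) True, of q])
      show "q j \<in> V - range v" if "j \<le> r" for j using q[OF that] sub by blast
      show "q i \<noteq> q j \<and> (adj (q i) (q j) \<longleftrightarrow> j = i + 1)" if "i < j" "j \<le> r" for i j
        using qq that .
      show "adj d (q j) \<longleftrightarrow> d = a \<and> j = 0 \<or> d = b \<and> j = r" if "d \<in> range v" "j \<le> r" for d j
        using vq[OF True] subsetD[OF sub that(1)] that(2) .
    qed
  next
    case False
    then have r0: "r = 0" by simp
    define x where "x = q 0"
    have x: "x \<in> V - K" "adj x a" "adj x b"
      using q[of 0] ab r0 by (simp_all add: x_def adj_sym[of "q 0"])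
    have "adj x e" if "e \<in> K" for e
      using mixed_clique_neighbour[OF K card _ ab(1-3) x(2,3) that] x(1) by blast
    then have adj_insert: "adj u w" if "u \<in> insert x K" "w \<in> insert x K" "u \<noteq> w" for u w
      using that adjK adj_sym by blast
    obtain \<phi> z u w where "hole \<phi> z" "z \<in> K" "u \<in> K" "w \<in> K" "u \<noteq> z" "w \<noteq> z" "\<phi> u \<noteq> \<phi> w"
      using K by (auto simp: mixed_clique_def)
    then have "mixed_clique (insert x K)"
      using KsubV x(1) adj_insert by (intro mixed_cliqueI[of _ \<phi> z u w]) auto
    then have "card (insert x K) \<le> card K" by (rule max)
    then show False using x(1) finK by simp
  qed
qed

lemma mixed_triangle_complete:
  assumes h: "hole \<phi> a" and t: "adj a b" "adj b d" "adj a d" and ne: "\<phi> b \<noteq> \<phi> d"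
  shows "mixed_clique V" "card V \<ge> 3"
proof -
  have dist: "a \<noteq> b" "b \<noteq> d" "a \<noteq> d" using t by auto
  have V3: "{a, b, d} \<subseteq> V" using t adj_V by blast
  have tri: "mixed_clique {a, b, d}"
  proof (rule mixed_cliqueI[OF V3 _ h])
    show "adj u w" if "u \<in> {a, b, d}" "w \<in> {a, b, d}" "u \<noteq> w" for u w
      using that t adj_sym by blast
  qed (use ne dist in auto)
  have c3: "card {a, b, d} = 3" using dist by simp
  have bound: "\<forall>K. mixed_clique K \<longrightarrow> card K < Suc (card V)"
    using finite_V by (auto simp: mixed_clique_def less_Suc_eq_le intro: card_mono)
  obtain K where K: "mixed_clique K" and max: "\<And>K'. mixed_clique K' \<Longrightarrow> card K' \<le> card K"
    using ex_has_greatest_nat[OF tri bound] by (elim exE conjE) auto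
  have "card K \<ge> 3" using max[OF tri] c3 by simp
  with maximal_mixed_clique_spans[OF K this max] K show "mixed_clique V" "card V \<ge> 3" by simp_all
qed

end

section \<open>Classification of the blocks\<close>

context critical
begin

lemma one_colour_around:
  assumes h: "hole \<phi> z" and one: "\<And>u. adj z u \<Longrightarrow> \<phi> u = j" and j: "j \<in> {1..p}"
  shows "i \<in> {1..p} \<Longrightarrow> i \<noteq> j \<Longrightarrow> f i z = 0" and "R \<in> {E, E\<inverse>} \<Longrightarrow> f j z = deg R V z"
proof -
  show zero: "f i z = 0" if "i \<in> {1..p}" "i \<noteq> j" for i
  proof -
    have "{u \<in> {u \<in> V - {z}. \<phi> u = i}. (z, u) \<in> E} = {}"
      using one that(2) by (auto simp: adj_def)
    then have "deg E {u \<in> V - {z}. \<phi> u = i} z = 0" by (simp only: deg_def card.empty)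
    then show ?thesis using hole_degree[OF h that(1), of E] by simp
  qed
  assume R: "R \<in> {E, E\<inverse>}"
  have "(\<Sum>i = 1..p. f i z) = f j z + (\<Sum>i \<in> {1..p} - {j}. f i z)"
    using j by (intro sum.remove) auto
  also have "(\<Sum>i \<in> {1..p} - {j}. f i z) = 0" using zero by (intro sum.neutral) auto
  finally show "f j z = deg R V z" using degree_tight[OF hole_V[OF h] R] by simp
qed

text \<open>
  If the hole sees only the colour \<open>j\<close> and moves to a neighbour, it leaves the colour \<open>j\<close> behind, so it sees
  \<open>j\<close>, and hence only \<open>j\<close>, at the new position. By connectedness this holds at every vertex.
\<close>

lemma unmixed_type_M:
  assumes p: "p \<ge> 1" and unmixed: "\<And>\<phi> z u w. hole \<phi> z \<Longrightarrow> adj z u \<Longrightarrow> adj z w \<Longrightarrow> \<phi> u = \<phi> w"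
  shows "\<exists>j \<in> {1..p}. \<forall>v \<in> V. f j v = deg E V v \<and> f j v = deg (E\<inverse>) V v \<and> (\<forall>i \<in> {1..p} - {j}. f i v = 0)"
proof -
  obtain z0 where z0: "z0 \<in> V" using V_ne by blast
  obtain \<phi>0 where h0: "hole \<phi>0 z0" using hole_exists[OF z0] by blast
  obtain j where j: "j \<in> {1..p}" "\<And>u. adj z0 u \<Longrightarrow> \<phi>0 u = j"
  proof (cases "\<exists>u. adj z0 u")
    case True
    then obtain u0 where u0: "adj z0 u0" by blast
    show ?thesis
    proof (rule that)
      show "\<phi>0 u0 \<in> {1..p}" using u0 adj_V by (intro hole_range[OF h0]) auto
      show "\<phi>0 u = \<phi>0 u0" if "adj z0 u" for u using unmixed[OF h0 that u0] .
    qed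
  next
    case False
    \<comment> \<open>a single vertex: any colour will do\<close>
    then show ?thesis using that[of 1] p by auto
  qed
  define W where "W = {z \<in> V. \<exists>\<phi>. hole \<phi> z \<and> (\<forall>u. adj z u \<longrightarrow> \<phi> u = j)}"
  have "W = V"
  proof (rule ccontr)
    assume "W \<noteq> V"
    moreover have "W \<subseteq> V" "W \<noteq> {}" using z0 h0 j(2) by (auto simp: W_def)
    ultimately obtain z w where zw: "z \<in> W" "w \<in> V - W" "adj z w" using connected_cut by blast
    then obtain \<phi> where \<phi>: "hole \<phi> z" "\<And>u. adj z u \<Longrightarrow> \<phi> u = j" by (auto simp: W_def)
    have h: "hole (\<phi>(z := j)) w" using hole_move[OF \<phi>(1) zw(3)] \<phi>(2)[OF zw(3)] by simp
    have "(\<phi>(z := j)) u = j" if "adj w u" for u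
      using unmixed[OF h that, of z] zw(3) adj_sym[of w z] by simp
    then have "w \<in> W" using h zw(2) by (auto simp: W_def)
    then show False using zw(2) by blast
  qed
  have "f j v = deg E V v \<and> f j v = deg (E\<inverse>) V v \<and> (\<forall>i \<in> {1..p} - {j}. f i v = 0)" if "v \<in> V" for v
  proof -
    have "v \<in> W" using that \<open>W = V\<close> by simp
    then obtain \<phi> where \<phi>: "hole \<phi> v" "\<And>u. adj v u \<Longrightarrow> \<phi> u = j" by (auto simp: W_def)
    note one_colour_around[OF \<phi> j(1)]
    from this(1) this(2)[of E] this(2)[of "E\<inverse>"] show ?thesis by blast
  qed
  then show ?thesis using j(1) by blast
qed

end

context critical_block
begin

text \<open>
  The hole sees every other vertex, so \<open>f i z\<close> is the size of the colour class \<open>i\<close>; moving the hole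
  preserves the class sizes.
\<close>

lemma mixed_clique_type_K:
  assumes K: "mixed_clique V" and card: "card V \<ge> 3"
  shows "\<forall>u \<in> V. \<forall>w \<in> V. (u, w) \<in> E \<longleftrightarrow> u \<noteq> w"
    and "\<exists>ns. card {i \<in> {1..p}. ns i \<noteq> 0} \<ge> 2 \<and> (\<Sum>i = 1..p. ns i) = card V - 1 \<and>
           (\<forall>v \<in> V. \<forall>i \<in> {1..p}. f i v = ns i)"
proof -
  have adjV: "adj u w" if "u \<in> V" "w \<in> V" "u \<noteq> w" for u w using K that by (auto simp: mixed_clique_def)
  have arc: "(a, b) \<in> E" if ab: "a \<in> V" "b \<in> V" "a \<noteq> b" for a b
  proof -
    obtain d where d: "d \<in> V" "d \<noteq> a" "d \<noteq> b" using third_element[OF card] by blast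
    obtain \<phi> where "hole \<phi> a" "\<phi> b \<noteq> \<phi> d" using mixed_clique_recolour[OF K ab(1,2) d(1)] ab d by metis
    then show ?thesis using mixed_triangle_bidirected[of \<phi> a b d] adjV ab d by metis
  qed
  show E: "\<forall>u \<in> V. \<forall>w \<in> V. (u, w) \<in> E \<longleftrightarrow> u \<noteq> w" using arc no_loop by metis
  have deg_card: "deg E S z = card S" if "S \<subseteq> V - {z}" "z \<in> V" for S z
    unfolding deg_def using that E by (intro arg_cong[where f = card]) blast
  obtain \<phi> z b d where h: "hole \<phi> z" and zbd: "z \<in> V" "b \<in> V" "d \<in> V" "b \<noteq> z" "d \<noteq> z" "\<phi> b \<noteq> \<phi> d"
    using K unfolding mixed_clique_def by blast
  have cls: "f i z = card {u \<in> V - {z}. \<phi> u = i}" if "i \<in> {1..p}" for i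
    using hole_degree[OF h that, of E] deg_card[of "{u \<in> V - {z}. \<phi> u = i}" z] zbd(1) by auto
  have const: "f i a = f i z" if a: "a \<in> V" and i: "i \<in> {1..p}" for a i
  proof (cases "a = z")
    case False
    define \<phi>' where "\<phi>' = \<phi>(z := \<phi> a)"
    have h': "hole \<phi>' a" unfolding \<phi>'_def using hole_move[OF h] adjV zbd(1) a False by blast
    define g where "g u = (if u = a then z else u)" for u
    have "{u \<in> V - {a}. \<phi>' u = i} = g ` {u \<in> V - {z}. \<phi> u = i}"
    proof (intro equalityI subsetI)
      fix u assume u: "u \<in> {u \<in> V - {a}. \<phi>' u = i}"
      show "u \<in> g ` {u \<in> V - {z}. \<phi> u = i}"
        using u a False by (cases "u = z") (auto simp: \<phi>'_def g_def image_iff)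
    qed (use a zbd(1) False in \<open>auto simp: \<phi>'_def g_def\<close>)
    moreover have "inj_on g {u \<in> V - {z}. \<phi> u = i}" by (auto simp: g_def inj_on_def)
    ultimately have "card {u \<in> V - {a}. \<phi>' u = i} = f i z"
      using cls[OF i] by (simp add: card_image)
    then show ?thesis
      using hole_degree[OF h' i, of E] deg_card[of "{u \<in> V - {a}. \<phi>' u = i}" a] a by auto
  qed simp
  have pos: "f (\<phi> u) z \<noteq> 0" "\<phi> u \<in> {1..p}" if "u \<in> V" "u \<noteq> z" for u
  proof -
    show p: "\<phi> u \<in> {1..p}" using hole_range[OF h that] .
    have "u \<in> {w \<in> V - {z}. \<phi> w = \<phi> u}" "finite {w \<in> V - {z}. \<phi> w = \<phi> u}" using that finite_V by auto
    then show "f (\<phi> u) z \<noteq> 0" unfolding cls[OF p] by (metis card_0_eq empty_iff)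
  qed
  have "{\<phi> b, \<phi> d} \<subseteq> {i \<in> {1..p}. f i z \<noteq> 0}" using pos zbd by auto
  then have "card {\<phi> b, \<phi> d} \<le> card {i \<in> {1..p}. f i z \<noteq> 0}" by (intro card_mono) auto
  then have two: "card {i \<in> {1..p}. f i z \<noteq> 0} \<ge> 2" using zbd(6) by simp
  have "(\<Sum>i = 1..p. f i z) = deg E V z" using degree_tight[OF zbd(1), of E] by simp
  also have "\<dots> = deg E (V - {z}) z" unfolding deg_def using no_loop by (intro arg_cong[where f = card]) blast
  also have "\<dots> = card V - 1" using deg_card[of "V - {z}" z] zbd(1) finite_V by simp
  finally have "(\<Sum>i = 1..p. f i z) = card V - 1" .
  then show "\<exists>ns. card {i \<in> {1..p}. ns i \<noteq> 0} \<ge> 2 \<and> (\<Sum>i = 1..p. ns i) = card V - 1 \<and>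
           (\<forall>v \<in> V. \<forall>i \<in> {1..p}. f i v = ns i)"
    using two const by (intro exI[of _ "\<lambda>i. f i z"]) auto
qed

text \<open>
  Wherever the hole is on the cycle, it sees exactly two vertices, and these carry the two
  alternating colours.
\<close>

lemma spanning_cycle_type_C:
  assumes cyc: "icycle n v" and h: "hole \<phi> (v 0)" and ends: "\<phi> (v 1) \<noteq> \<phi> (v (n - 1))" and span: "range v = V"
  shows "\<phi> (v 1) \<in> {1..p}" "\<phi> (v (n - 1)) \<in> {1..p}"
    and "\<forall>x \<in> V. \<forall>i \<in> {1..p}. f i x = (if i \<in> {\<phi> (v 1), \<phi> (v (n - 1))} then 1 else 0)"
proof -
  have n: "n \<ge> 3" and vV: "\<And>k. v k \<in> V" using cyc by (auto simp: icycle_def)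
  have idx: "1 \<in> {1..n - 1}" "n - 1 \<in> {1..n - 1}" using n by auto
  have ne: "v 1 \<noteq> v 0" "v (n - 1) \<noteq> v 0" using icycle_inj[OF cyc, of _ 0 0] n by auto
  show "\<phi> (v 1) \<in> {1..p}" "\<phi> (v (n - 1)) \<in> {1..p}" using hole_range[OF h vV] ne by blast+
  show "\<forall>x \<in> V. \<forall>i \<in> {1..p}. f i x = (if i \<in> {\<phi> (v 1), \<phi> (v (n - 1))} then 1 else 0)"
  proof (intro ballI)
    fix x i assume "x \<in> V" and i: "i \<in> {1..p}"
    then obtain k where k: "x = v k" using span by blast
    obtain \<psi> where hk: "hole \<psi> (v k)"
      and cols: "{\<psi> (v (k + 1)), \<psi> (v (k + (n - 1)))} = {\<phi> (v 1), \<phi> (v (n - 1))}"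
      using shifted_hole[OF cyc h idx ends, of k] by blast
    define a b where "a = v (k + 1)" and "b = v (k + (n - 1))"
    have ab: "\<psi> a \<noteq> \<psi> b" using cols ends by (auto simp: a_def b_def doubleton_eq_iff)
    have arcs: "(v k, a) \<in> E" "(v k, b) \<in> E"
    proof -
      show "(v k, a) \<in> E" using alternating_rotation(3)[OF cyc h idx ends, of k] by (simp add: a_def)
      have "v (k + (n - 1) + 1) = v k" using icycle_periodic[OF cyc, of k] n by simp
      then show "(v k, b) \<in> E"
        using alternating_rotation(3)[OF cyc h idx ends, of "k + (n - 1)"] unfolding b_def by metis
    qed
    have only: "u = a \<or> u = b" if u: "(v k, u) \<in> E" for u
    proof -
      have uV: "u \<in> range v" "u \<noteq> v k" "adj (v k) u" using dir_V[of E "v k" u] u span by (auto simp: adj_def)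
      then obtain t where t: "t < n" "u = v (k + t)" using icycle_range_from[OF cyc] by blast
      have "1 \<le> t" using t uV(2) by (cases t) auto
      then have "t = 1 \<or> t = n - 1" using cyc t uV(3) unfolding icycle_def by blast
      then show ?thesis using t(2) by (auto simp: a_def b_def)
    qed
    have abV: "a \<in> V" "b \<in> V" "a \<noteq> v k" "b \<noteq> v k" using arcs dir_V[of E] by auto
    have nbrs: "{u \<in> {u \<in> V - {v k}. \<psi> u = i}. (v k, u) \<in> E} = {u \<in> {a, b}. \<psi> u = i}"
      using only arcs abV by blast
    have "f i (v k) = card {u \<in> {a, b}. \<psi> u = i}"
      using hole_degree[OF hk i, of E] unfolding deg_def nbrs by simp
    also have "\<dots> = (if i \<in> {\<psi> a, \<psi> b} then 1 else 0)"
    proof -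
      have "{u \<in> {a, b}. \<psi> u = i} = (if i = \<psi> a then {a} else if i = \<psi> b then {b} else {})"
        using ab by auto
      then show ?thesis by simp
    qed
    finally show "f i x = (if i \<in> {\<phi> (v 1), \<phi> (v (n - 1))} then 1 else 0)"
      unfolding k cols[folded a_def b_def, symmetric] .
  qed
qed

end

section \<open>Splitting at a separating vertex\<close>

lemma sum_out_eq_sum_in:
  assumes "finite T"
  shows "(\<Sum>u \<in> T. deg R T u) = (\<Sum>u \<in> T. deg (R\<inverse>) T u)"
proof -
  have d: "deg R T u = (\<Sum>w \<in> T. if (u, w) \<in> R then 1 else 0)" for R :: "('a \<times> 'a) set" and u
    unfolding deg_def using assms by (simp add: sum.If_cases Int_def)
  show ?thesis unfolding d by (subst sum.swap) simp
qed

lemma degenerate_on_restrict: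
  assumes "S \<subseteq> V1"
  shows "degenerate_on (E \<inter> V1 \<times> V1) S h \<longleftrightarrow> degenerate_on E S h"
proof -
  have "deg (E \<inter> V1 \<times> V1) T u = deg E T u \<and> deg ((E \<inter> V1 \<times> V1)\<inverse>) T u = deg (E\<inverse>) T u"
    if "T \<subseteq> S" "u \<in> T" for T u
    using that assms by (auto intro!: deg_cong)
  then show ?thesis unfolding degenerate_on_def by (metis (no_types, lifting))
qed

context critical
begin

text \<open>
  At the separating vertex \<open>v\<close>, the side \<open>V1\<close> gets that part of the budget which a hole at \<open>v\<close> sees in
  \<open>V1\<close>. Counting out-neighbours is no restriction by \<open>side_balanced\<close>.
\<close>

definition side_f :: "'a \<Rightarrow> 'a set \<Rightarrow> ('a \<Rightarrow> nat) \<Rightarrow> nat \<Rightarrow> 'a \<Rightarrow> nat" where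
  "side_f v V1 \<phi> i x = (if x = v then deg E {u \<in> V1 - {v}. \<phi> u = i} v else f i x)"

context
  fixes v V1 V2 \<phi>
  assumes V12: "V1 \<union> V2 = V" "V1 \<inter> V2 = {v}"
    and no_cross: "\<And>u w. u \<in> V1 - {v} \<Longrightarrow> w \<in> V2 - {v} \<Longrightarrow> \<not> adj u w"
    and h: "hole \<phi> v"
begin

text \<open>
  Let \<open>Q\<close> be the set of all vertices of colour \<open>i\<close>, with \<open>v\<close> included, that can take over the hole
  when the others have that colour. It is closed under neighbours of colour \<open>i\<close>, and all its members
  have both degrees inside \<open>Q\<close> equal to the budget. On the side \<open>V1\<close> this remains true for all
  members except \<open>v\<close>; as out-degrees and in-degrees have the same total, \<open>v\<close> is balanced too.
\<close>

lemma side_balanced: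
  assumes i: "i \<in> {1..p}"
  shows "deg E {u \<in> V1 - {v}. \<phi> u = i} v = deg (E\<inverse>) {u \<in> V1 - {v}. \<phi> u = i} v"
proof -
  define \<psi> where "\<psi> = \<phi>(v := i)"
  define Q where "Q = {u \<in> V. \<psi> u = i \<and> hole \<psi> u}"
  define Q1 where "Q1 = Q \<inter> V1"
  have v: "v \<in> V" "v \<in> V1" using V12 by auto
  have fin: "finite Q1" using finite_V by (auto simp: Q1_def Q_def)
  have "hole \<psi> v" by (rule hole_cong[OF h]) (simp add: \<psi>_def)
  then have vQ: "v \<in> Q" using v by (simp add: Q_def \<psi>_def)
  have closed: "w \<in> Q" if "u \<in> Q" "adj u w" "\<psi> w = i" for u w
  proof -
    have "\<psi>(u := \<psi> w) = \<psi>" using that by (auto simp: Q_def)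
    then have "hole \<psi> w" using hole_move[of \<psi> u w] that by (auto simp: Q_def)
    then show ?thesis using that adj_V by (auto simp: Q_def)
  qed
  have degQ: "deg R Q u = f i u" if u: "u \<in> Q" and R: "R \<in> {E, E\<inverse>}" for u R
  proof -
    have "w \<in> Q \<longleftrightarrow> w \<in> V - {u} \<and> \<psi> w = i" if "(u, w) \<in> R" for w
      using closed[OF u, of w] dir_V[OF R that] that R by (auto simp: Q_def adj_dir)
    then have "{w \<in> Q. (u, w) \<in> R} = {w \<in> {w \<in> V - {u}. \<psi> w = i}. (u, w) \<in> R}" by blast
    then show ?thesis
      using hole_degree[OF _ i R, of \<psi> u] u unfolding deg_def by (simp add: Q_def)
  qed
  have deg1: "deg R Q1 u = f i u" if u: "u \<in> Q1 - {v}" and R: "R \<in> {E, E\<inverse>}" for u R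
  proof -
    have "w \<in> V1" if "(u, w) \<in> R" "w \<in> Q" for w
      using no_cross[of u w] that u R V12 by (auto simp: Q1_def Q_def adj_dir)
    then have "{w \<in> Q1. (u, w) \<in> R} = {w \<in> Q. (u, w) \<in> R}" by (auto simp: Q1_def)
    then show ?thesis using degQ[of u R] u R unfolding deg_def by (simp add: Q1_def)
  qed
  have "(\<Sum>u \<in> Q1. deg R Q1 u) = deg R Q1 v + (\<Sum>u \<in> Q1 - {v}. f i u)" if "R \<in> {E, E\<inverse>}" for R
  proof -
    have "(\<Sum>u \<in> Q1. deg R Q1 u) = deg R Q1 v + (\<Sum>u \<in> Q1 - {v}. deg R Q1 u)"
      using fin vQ v by (intro sum.remove) (auto simp: Q1_def)
    then show ?thesis using deg1[OF _ that] by simp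
  qed
  from this[of E] this[of "E\<inverse>"] have bal: "deg E Q1 v = deg (E\<inverse>) Q1 v"
    using sum_out_eq_sum_in[OF fin, of E] by simp
  have "deg R Q1 v = deg R {u \<in> V1 - {v}. \<phi> u = i} v" if R: "R \<in> {E, E\<inverse>}" for R
  proof -
    have "w \<in> Q1 \<longleftrightarrow> w \<in> V1 - {v} \<and> \<phi> w = i" if "(v, w) \<in> R" for w
      using closed[OF vQ, of w] dir_V[OF R that] that R by (auto simp: Q1_def Q_def adj_dir \<psi>_def)
    then show ?thesis unfolding deg_def by (intro arg_cong[where f = card]) blast
  qed
  from this[of E] this[of "E\<inverse>"] bal show ?thesis by simp
qed

lemma side_f_v: "i \<in> {1..p} \<Longrightarrow> R \<in> {E, E\<inverse>} \<Longrightarrow> side_f v V1 \<phi> i v = deg R {u \<in> V1 - {v}. \<phi> u = i} v"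
  using side_balanced by (auto simp: side_f_def)

lemma sides_add:
  assumes i: "i \<in> {1..p}" and R: "R \<in> {E, E\<inverse>}"
  shows "deg R {u \<in> V1 - {v}. \<phi> u = i} v + deg R {u \<in> V2 - {v}. \<phi> u = i} v = f i v"
proof -
  have "f i v = card {w \<in> {u \<in> V - {v}. \<phi> u = i}. (v, w) \<in> R}"
    using hole_degree[OF h i R] by (simp add: deg_def)
  also have "{w \<in> {u \<in> V - {v}. \<phi> u = i}. (v, w) \<in> R} =
      {w \<in> {u \<in> V1 - {v}. \<phi> u = i}. (v, w) \<in> R} \<union> {w \<in> {u \<in> V2 - {v}. \<phi> u = i}. (v, w) \<in> R}"
    using V12 by blast
  also have "card \<dots> = deg R {u \<in> V1 - {v}. \<phi> u = i} v + deg R {u \<in> V2 - {v}. \<phi> u = i} v"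
    unfolding deg_def using V12 finite_V by (intro card_Un_disjoint) (auto intro: finite_subset)
  finally show ?thesis by simp
qed

text \<open>
  A colouring of this side, continued by \<open>\<phi>\<close> on the other one, would colour the whole digraph: the
  other side adds to the degree of \<open>v\<close> at most its own share of the budget, in both directions.
\<close>

lemma side_not_colorable: "\<not> f_coloring p (E \<inter> V1 \<times> V1) (side_f v V1 \<phi>) V1 \<chi>"
proof
  assume \<chi>: "f_coloring p (E \<inter> V1 \<times> V1) (side_f v V1 \<phi>) V1 \<chi>"
  define \<psi> where "\<psi> x = (if x \<in> V1 then \<chi> x else \<phi> x)" for x
  have v: "v \<in> V" "v \<in> V1" using V12 by auto
  have "f_coloring p E f V \<psi>"
    unfolding f_coloring_def
  proof (intro conjI ballI)
    show "\<psi> u \<in> {1..p}" if "u \<in> V" for u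
      using that \<chi> hole_range[OF h, of u] v by (auto simp: \<psi>_def f_coloring_def)
    fix i assume i: "i \<in> {1..p}"
    show "degenerate_on E {u \<in> V. \<psi> u = i} (f i)"
      unfolding degenerate_on_def
    proof (intro allI impI)
      fix T assume T: "T \<subseteq> {u \<in> V. \<psi> u = i}" "T \<noteq> {}"
      have outside: "x \<in> V2 - {v} \<and> \<phi> x = i" if "x \<in> T" "x \<notin> V1" for x
        using subsetD[OF T(1) that(1)] that(2) v V12 by (auto simp: \<psi>_def)
      show "\<exists>u \<in> T. deg E T u < f i u \<or> deg (E\<inverse>) T u < f i u"
      proof (cases "T \<inter> V1 = {}")
        case True
        then have "T \<subseteq> {u \<in> V - {v}. \<phi> u = i}" using outside V12 by blast
        moreover have "degenerate_on E {u \<in> V - {v}. \<phi> u = i} (f i)"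
          using h i by (auto simp: hole_def f_coloring_def)
        ultimately show ?thesis using T(2) unfolding degenerate_on_def by blast
      next
        case False
        have "degenerate_on (E \<inter> V1 \<times> V1) {u \<in> V1. \<chi> u = i} (side_f v V1 \<phi> i)"
          using \<chi> i by (auto simp: f_coloring_def)
        then have "degenerate_on E {u \<in> V1. \<chi> u = i} (side_f v V1 \<phi> i)"
          by (subst (asm) degenerate_on_restrict) auto
        moreover have "T \<inter> V1 \<subseteq> {u \<in> V1. \<chi> u = i}" using T(1) by (auto simp: \<psi>_def)
        ultimately obtain u where u: "u \<in> T \<inter> V1"
          and "deg E (T \<inter> V1) u < side_f v V1 \<phi> i u \<or> deg (E\<inverse>) (T \<inter> V1) u < side_f v V1 \<phi> i u"
          using False unfolding degenerate_on_def by blast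
        then obtain R where R: "R \<in> {E, E\<inverse>}" and low: "deg R (T \<inter> V1) u < side_f v V1 \<phi> i u"
          by blast
        have "deg R T u < f i u"
        proof (cases "u = v")
          case False
          have "w \<in> V1" if "w \<in> T" "(u, w) \<in> R" for w
            using no_cross[of u w] that T(1) u R V12 False by (auto simp: adj_dir)
          then have "{w \<in> T. (u, w) \<in> R} = {w \<in> T \<inter> V1. (u, w) \<in> R}" by blast
          then show ?thesis using low False by (simp add: deg_def side_f_def)
        next
          case True
          have "deg R T v \<le> deg R (T \<inter> V1) v + deg R (T - V1) v"
          proof -
            have eq: "{w \<in> T. (v, w) \<in> R} = {w \<in> T \<inter> V1. (v, w) \<in> R} \<union> {w \<in> T - V1. (v, w) \<in> R}" by blast
            show ?thesis unfolding deg_def eq by (rule card_Un_le)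
          qed
          also have "deg R (T - V1) v \<le> deg R {u \<in> V2 - {v}. \<phi> u = i} v"
            using outside V12 finite_V by (intro deg_mono) (auto intro: finite_subset)
          also have "deg R (T \<inter> V1) v < deg R {u \<in> V1 - {v}. \<phi> u = i} v"
            using low True side_f_v[OF i R] by simp
          finally show ?thesis using sides_add[OF i R] True by simp
        qed
        then show ?thesis using u R by blast
      qed
    qed
  qed
  then show False using not_colorable by blast
qed

lemma side_critical: "critical V1 (E \<inter> V1 \<times> V1) p (side_f v V1 \<phi>)"
proof
  have v: "v \<in> V" "v \<in> V1" "V1 \<subseteq> V" using V12 by auto
  show "finite V1" using finite_V v finite_subset by blast
  show "E \<inter> V1 \<times> V1 \<subseteq> V1 \<times> V1" "\<And>u. (u, u) \<notin> E \<inter> V1 \<times> V1" "V1 \<noteq> {}" using v no_loop by auto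
  show "\<not> f_coloring p (E \<inter> V1 \<times> V1) (side_f v V1 \<phi>) V1 \<chi>" for \<chi> by (rule side_not_colorable)
  show "\<exists>u \<in> T. \<exists>w \<in> V1 - T. (u, w) \<in> E \<inter> V1 \<times> V1 \<union> (E \<inter> V1 \<times> V1)\<inverse>"
    if T: "T \<subseteq> V1" "T \<noteq> {}" "T \<noteq> V1" for T
  proof -
    have stay: "w \<in> V1" if "u \<in> V1 - {v}" "adj u w" for u w
      using no_cross[of u w] that V12 adj_V by blast
    have "\<exists>u \<in> T. \<exists>w \<in> V1 - T. adj u w"
    proof (cases "v \<in> T")
      case False
      obtain u w where "u \<in> T" "w \<in> V - T" "adj u w" using connected_cut[of T] T v False by blast
      then show ?thesis using stay[of u w] T False by blast
    next
      case True
      have "V1 - T \<subseteq> V" "V1 - T \<noteq> {}" "V1 - T \<noteq> V" using T v True by blast+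
      then obtain u w where uw: "u \<in> V1 - T" "w \<in> V - (V1 - T)" "adj u w" using connected_cut by blast
      then have "w \<in> V1" using stay[of u w] True by blast
      then show ?thesis using uw adj_sym by blast
    qed
    then show ?thesis using T(1) by (auto simp: adj_def)
  qed
  show "deg R V1 u \<le> (\<Sum>i = 1..p. side_f v V1 \<phi> i u)" if u: "u \<in> V1" and R: "R \<in> {E \<inter> V1 \<times> V1, (E \<inter> V1 \<times> V1)\<inverse>}" for u R
  proof -
    obtain R' where R': "R' \<in> {E, E\<inverse>}" "R = R' \<inter> V1 \<times> V1" using R by auto
    then have "deg R V1 u = deg R' V1 u" using u by (intro deg_cong) auto
    also have "\<dots> \<le> (\<Sum>i = 1..p. side_f v V1 \<phi> i u)"
    proof (cases "u = v")
      case True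
      have "deg R' V1 v = deg R' (V1 - {v}) v"
        unfolding deg_def using dir_V[OF R'(1)] by (intro arg_cong[where f = card]) blast
      also have "\<dots> = (\<Sum>i = 1..p. deg R' {u \<in> V1 - {v}. \<phi> u = i} v)"
        using finite_V v hole_range[OF h] by (intro deg_split_by_colour[symmetric]) (auto intro: finite_subset)
      also have "\<dots> = (\<Sum>i = 1..p. side_f v V1 \<phi> i v)" using side_f_v R'(1) by (intro sum.cong) auto
      finally show ?thesis using True by simp
    next
      case False
      have "deg R' V1 u \<le> deg R' V u" using finite_V v by (intro deg_mono) auto
      also have "\<dots> = (\<Sum>i = 1..p. f i u)" using degree_tight[OF _ R'(1)] u v by blast
      finally show ?thesis using False by (simp add: side_f_def)
    qed
    finally show ?thesis .
  qed
qed

end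

lemma split_at_separating_vertex:
  assumes V12: "V1 \<union> V2 = V" "V1 \<inter> V2 = {v}"
    and no_cross: "\<And>u w. u \<in> V1 - {v} \<Longrightarrow> w \<in> V2 - {v} \<Longrightarrow> \<not> adj u w"
  shows "\<exists>f1 f2. critical V1 (E \<inter> V1 \<times> V1) p f1 \<and> critical V2 (E \<inter> V2 \<times> V2) p f2 \<and>
    (\<forall>i \<in> {1..p}. (\<forall>w \<in> V1 - {v}. f i w = f1 i w) \<and> (\<forall>w \<in> V2 - {v}. f i w = f2 i w) \<and> f i v = f1 i v + f2 i v)"
proof -
  have "v \<in> V" using V12 by blast
  then obtain \<phi> where h: "hole \<phi> v" using hole_exists by blast
  have V21: "V2 \<union> V1 = V" "V2 \<inter> V1 = {v}" using V12 by auto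
  have no_cross': "\<not> adj u w" if "u \<in> V2 - {v}" "w \<in> V1 - {v}" for u w
    using no_cross[OF that(2,1)] adj_sym by blast
  note c1 = side_critical[OF V12 no_cross h] and c2 = side_critical[OF V21 no_cross' h]
  have "side_f v V1 \<phi> i v + side_f v V2 \<phi> i v = f i v" if "i \<in> {1..p}" for i
    using sides_add[OF V12 no_cross h that, of E]
    by (simp add: side_f_def)
  then show ?thesis
    using c1 c2
    by (intro exI[of _ "side_f v V1 \<phi>"] exI[of _ "side_f v V2 \<phi>"])
       (auto simp: side_f_def)
qed

end

section \<open>From critical digraphs to hard pairs\<close>

text \<open>
  The set of vertices reachable from a given one has no leaving arc, so it is everything when all
  cuts are crossed.
\<close>

lemma all_reachable_iff_cut:
  "(\<forall>u \<in> V. \<forall>w \<in> V. (u, w) \<in> rtrancl_on V r) \<longleftrightarrow>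
     (\<forall>T. T \<subseteq> V \<longrightarrow> T \<noteq> {} \<longrightarrow> T \<noteq> V \<longrightarrow> (\<exists>u \<in> T. \<exists>w \<in> V - T. (u, w) \<in> r))"
proof
  assume reach: "\<forall>u \<in> V. \<forall>w \<in> V. (u, w) \<in> rtrancl_on V r"
  show "\<forall>T. T \<subseteq> V \<longrightarrow> T \<noteq> {} \<longrightarrow> T \<noteq> V \<longrightarrow> (\<exists>u \<in> T. \<exists>w \<in> V - T. (u, w) \<in> r)"
  proof (intro allI impI, rule ccontr)
    fix T assume T: "T \<subseteq> V" "T \<noteq> {}" "T \<noteq> V" and no: "\<not> (\<exists>u \<in> T. \<exists>w \<in> V - T. (u, w) \<in> r)"
    obtain u w where uw: "u \<in> T" "w \<in> V - T" using T by blast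
    then have "(u, w) \<in> rtrancl_on V r" using reach T(1) by blast
    then have "w \<in> T" by (induction rule: rtrancl_on_induct) (use uw no in auto)
    then show False using uw(2) by blast
  qed
next
  assume cut: "\<forall>T. T \<subseteq> V \<longrightarrow> T \<noteq> {} \<longrightarrow> T \<noteq> V \<longrightarrow> (\<exists>u \<in> T. \<exists>w \<in> V - T. (u, w) \<in> r)"
  show "\<forall>u \<in> V. \<forall>w \<in> V. (u, w) \<in> rtrancl_on V r"
  proof (intro ballI, rule ccontr)
    fix u w assume uw: "u \<in> V" "w \<in> V" "(u, w) \<notin> rtrancl_on V r"
    define T where "T = {x \<in> V. (u, x) \<in> rtrancl_on V r}"
    have "T \<subseteq> V" "T \<noteq> {}" "T \<noteq> V" using uw by (auto simp: T_def)
    then obtain x y where xy: "x \<in> T" "y \<in> V - T" "(x, y) \<in> r" using cut by blast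
    then have "(u, y) \<in> rtrancl_on V r" by (auto simp: T_def intro: rtrancl_on_into_rtrancl_on)
    then show False using xy(2) by (auto simp: T_def)
  qed
qed

lemma connected_iff_cut:
  "connected (with_proj D) \<longleftrightarrow> pverts D \<noteq> {} \<and>
     (\<forall>T. T \<subseteq> pverts D \<longrightarrow> T \<noteq> {} \<longrightarrow> T \<noteq> pverts D \<longrightarrow>
        (\<exists>u \<in> T. \<exists>w \<in> pverts D - T. (u, w) \<in> parcs D \<union> (parcs D)\<inverse>))"
  unfolding connected_pair_iff all_reachable_iff_cut ..

lemma del_vert_with_proj:
  "pre_digraph.del_vert (with_proj D) z =
     with_proj \<lparr>pverts = pverts D - {z}, parcs = {a \<in> parcs D. fst a \<noteq> z \<and> snd a \<noteq> z}\<rparr>"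
  by (simp add: pre_digraph.del_vert_def with_proj_def)

lemma separating_vertex_iff_cut:
  "separating_vertex D z \<longleftrightarrow> z \<in> pverts D \<and>
     (\<exists>T. T \<subseteq> pverts D - {z} \<and> T \<noteq> {} \<and> T \<noteq> pverts D - {z} \<and>
        (\<forall>u \<in> T. \<forall>w \<in> pverts D - {z} - T. (u, w) \<notin> parcs D \<union> (parcs D)\<inverse>))"
proof -
  have "(u, w) \<in> {a \<in> parcs D. fst a \<noteq> z \<and> snd a \<noteq> z} \<union> {a \<in> parcs D. fst a \<noteq> z \<and> snd a \<noteq> z}\<inverse> \<longleftrightarrow>
      (u, w) \<in> parcs D \<union> (parcs D)\<inverse>" if "u \<in> T" "w \<in> pverts D - {z} - T" "T \<subseteq> pverts D - {z}" for u w T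
    using that by auto
  then show ?thesis
    unfolding separating_vertex_def del_vert_with_proj connected_iff_cut
    by simp blast
qed

context critical
begin

definition as_digraph :: "'a pair_pre_digraph" where
  "as_digraph = \<lparr>pverts = V, parcs = E\<rparr>"

lemma as_digraph_simps [simp]: "pverts as_digraph = V" "parcs as_digraph = E"
  by (simp_all add: as_digraph_def)

lemma pair_digraph_as_digraph: "pair_digraph as_digraph"
proof
  show "fst e \<in> pverts as_digraph" "snd e \<in> pverts as_digraph" "fst e \<noteq> snd e" if "e \<in> parcs as_digraph" for e
    using that E_subset no_loop by (cases e; auto)+
  show "finite (pverts as_digraph)" "finite (parcs as_digraph)"
    using finite_V E_subset by (auto intro: finite_subset)
qed

lemma connected_as_digraph: "connected (with_proj as_digraph)"
  unfolding connected_iff_cut using V_ne cut by simp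

lemma pair_wf_digraph_as_digraph: "pair_wf_digraph as_digraph"
  using pair_digraph_as_digraph by (simp add: pair_digraph_def pair_fin_digraph_def)

lemma eulerian_as_digraph: "eulerian as_digraph"
  unfolding eulerian_def out_degree_eq_deg[OF pair_wf_digraph_as_digraph] in_degree_eq_deg[OF pair_wf_digraph_as_digraph]
  using degree_tight[of _ E] degree_tight[of _ "E\<inverse>"] by simp

end

context critical_block
begin

lemma block_as_digraph: "block as_digraph"
proof -
  have "\<not> separating_vertex as_digraph z" for z
  proof
    assume "separating_vertex as_digraph z"
    then obtain T where "z \<in> V" "T \<subseteq> V - {z}" "T \<noteq> {}" "T \<noteq> V - {z}"
      "\<forall>u \<in> T. \<forall>w \<in> V - {z} - T. (u, w) \<notin> E \<union> E\<inverse>"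
      unfolding separating_vertex_iff_cut by auto
    then show False using block_cut[of z T] by blast
  qed
  then show ?thesis using connected_as_digraph by (simp add: block_def)
qed

lemma hard_as_digraph:
  assumes p: "p \<ge> 1"
  shows "hard_pair p as_digraph f"
proof (cases "\<exists>\<phi> z u w. hole \<phi> z \<and> adj z u \<and> adj z w \<and> \<phi> u \<noteq> \<phi> w")
  case False
  then obtain j where "j \<in> {1..p}"
    "\<forall>v \<in> V. f j v = deg E V v \<and> f j v = deg (E\<inverse>) V v \<and> (\<forall>i \<in> {1..p} - {j}. f i v = 0)"
    using unmixed_type_M[OF p] by metis
  then show ?thesis
    using hard_pair.type_M[OF pair_digraph_as_digraph block_as_digraph eulerian_as_digraph]
    unfolding out_degree_eq_deg[OF pair_wf_digraph_as_digraph] in_degree_eq_deg[OF pair_wf_digraph_as_digraph] by simp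
next
  case True
  then obtain \<phi> z u w where "hole \<phi> z" "adj z u" "adj z w" "\<phi> u \<noteq> \<phi> w" by blast
  then obtain n v where cyc: "icycle n v" and h: "hole \<phi> (v 0)" and ends: "\<phi> (v 1) \<noteq> \<phi> (v (n - 1))"
    using mixed_cycle_exists[of \<phi> z u w] by metis
  have n: "n \<ge> 3" using cyc by (simp add: icycle_def)
  have idx: "1 \<in> {1..n - 1}" "n - 1 \<in> {1..n - 1}" using n by auto
  have odd: "odd n" using alternating_rotation(2)[OF cyc h idx ends] .
  have bidir: "(v k, v (k + 1)) \<in> E \<and> (v (k + 1), v k) \<in> E" for k
    using alternating_rotation(3)[OF cyc h idx ends] .
  show ?thesis
  proof (cases "n = 3")
    case True
    have adjs: "adj (v 0) (v 1)" "adj (v 1) (v 2)" "adj (v 0) (v 2)"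
      using icycle_step[OF cyc, of 0] icycle_step[OF cyc, of 1] icycle_step[OF cyc, of 2]
        icycle_periodic[OF cyc, of 0] True adj_sym[of "v 0" "v 2"] by (simp_all add: numeral_eq_Suc)
    have "\<phi> (v 1) \<noteq> \<phi> (v 2)" using ends True by simp
    from mixed_triangle_complete[OF h adjs this]
    have K: "mixed_clique V" "card V \<ge> 3" .
    have "E = {(u, w). (u, w) \<in> V \<times> V \<and> u \<noteq> w}"
      using mixed_clique_type_K(1)[OF K] E_subset by blast
    then have "bidirected_complete as_digraph"
      unfolding bidirected_complete_def complete_digraph_pair_def as_digraph_simps using finite_V by simp
    moreover obtain ns where "card {i \<in> {1..p}. ns i \<noteq> 0} \<ge> 2" "(\<Sum>i = 1..p. ns i) = card (pverts as_digraph) - 1"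
      "\<forall>v \<in> pverts as_digraph. \<forall>i \<in> {1..p}. f i v = ns i"
      using mixed_clique_type_K(2)[OF K] by auto
    ultimately show ?thesis by (rule hard_pair.type_K)
  next
    case False
    have n5: "n \<ge> 5"
    proof (rule ccontr)
      assume "\<not> n \<ge> 5"
      then have "n = 4" using n False by linarith
      then show False using odd by simp
    qed
    have span: "range v = V" using long_mixed_cycle_spans[OF cyc h idx ends n5] .
    define vs where "vs = map v [0..<n]"
    have nth: "vs ! i = v i" "vs ! (Suc i mod n) = v (i + 1)" if "i < n" for i
      using that n icycle_mod[OF cyc, of "Suc i"] by (simp_all add: vs_def)
    have "distinct vs"
      using icycle_inj[OF cyc, of _ _ 0] by (auto simp: vs_def distinct_map inj_on_def)
    moreover have "V = set vs"
    proof -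
      have "x \<in> v ` {0..<n}" if x: "x \<in> range v" for x
        using icycle_range_from[OF cyc x, of 0] by auto
      then show ?thesis using span by (auto simp: vs_def)
    qed
    moreover have "E = (\<Union>i<n. {(vs ! i, vs ! (Suc i mod n)), (vs ! (Suc i mod n), vs ! i)})" (is "_ = ?R")
    proof
      show "?R \<subseteq> E" using bidir by (auto simp: nth icycle_mod[OF cyc])
      show "E \<subseteq> ?R"
      proof
        fix e assume e: "e \<in> E"
        obtain x y where xy: "e = (x, y)" by (cases e)
        then have V: "x \<in> range v" "y \<in> range v" "x \<noteq> y" "adj x y"
          using e dir_V[of E x y] span by (auto simp: adj_def)
        obtain i where i: "i < n" "x = v (0 + i)" using icycle_range_from[OF cyc V(1)] by blast
        obtain t where t: "t < n" "y = v (i + t)" using icycle_range_from[OF cyc V(2)] by blast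
        have "1 \<le> t" using t i V(3) by (cases t) auto
        then consider "t = 1" | "t = n - 1" using cyc t i V(4) unfolding icycle_def by auto
        then show "e \<in> ?R"
        proof cases
          case 1
          then have "e = (vs ! i, vs ! (Suc i mod n))" using xy i t by (simp add: nth icycle_mod[OF cyc])
          then show ?thesis using i(1) by blast
        next
          case 2
          obtain j where j: "j < n" "y = v (0 + j)" using icycle_range_from[OF cyc V(2)] by blast
          have "v (j + 1) = v (i + t + 1)"
          proof -
            have "j = (i + t) mod n"
            proof -
              have "v (0 + j) = v (0 + (i + t) mod n)" using j t icycle_mod[OF cyc, of "i + t"] by simp
              moreover have "(i + t) mod n < n" using n by simp
              ultimately show ?thesis using icycle_inj[OF cyc j(1)] by blast
            qed
            then show ?thesis using icycle_mod[OF cyc] by (metis mod_add_left_eq)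
          qed
          also have "\<dots> = x" using icycle_periodic[OF cyc, of i] 2 n i by simp
          finally have "e = (vs ! (Suc j mod n), vs ! j)" using xy j by (simp add: nth icycle_mod[OF cyc])
          then show ?thesis using j(1) by blast
        qed
      qed
    qed
    moreover have "length vs = n" by (simp add: vs_def)
    ultimately have "bidirected_cycle n as_digraph"
      unfolding bidirected_cycle_def as_digraph_simps using n by blast
    moreover note tC = spanning_cycle_type_C[OF cyc h ends span]
    from tC(3) have "\<forall>x \<in> pverts as_digraph. \<forall>i \<in> {1..p}. f i x = (if i \<in> {\<phi> (v 1), \<phi> (v (n - 1))} then 1 else 0)"
      by (simp only: as_digraph_simps)
    ultimately show ?thesis using hard_pair.type_C[OF _ odd tC(1,2) ends] by blast
  qed
qed

end

text \<open>
  Induction on the number of vertices: a separating vertex splits the digraph into two smaller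
  critical ones, and identity maps witness that it is recovered from them by merging.
\<close>

lemma critical_imp_hard_pair:
  assumes "critical V E p f" and p: "p \<ge> 1"
  shows "hard_pair p \<lparr>pverts = V, parcs = E\<rparr> f"
  using assms(1)
proof (induction "card V" arbitrary: V E f rule: less_induct)
  case less
  interpret critical V E p f by fact
  show ?case
  proof (cases "critical_block V E p f")
    case True
    then show ?thesis using critical_block.hard_as_digraph[OF True p] by (simp add: as_digraph_def)
  next
    case False
    then obtain v T where v: "v \<in> V" and T: "T \<subseteq> V - {v}" "T \<noteq> {}" "T \<noteq> V - {v}"
      and no: "\<And>u w. u \<in> T \<Longrightarrow> w \<in> V - {v} - T \<Longrightarrow> (u, w) \<notin> E \<union> E\<inverse>"
      using less.prems unfolding critical_block_def critical_block_axioms_def by blast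
    define V1 V2 where "V1 = insert v T" and "V2 = V - T"
    have V12: "V1 \<union> V2 = V" "V1 \<inter> V2 = {v}" using v T by (auto simp: V1_def V2_def)
    have no_cross: "\<not> adj u w" if "u \<in> V1 - {v}" "w \<in> V2 - {v}" for u w
      using no[of u w] that by (auto simp: V1_def V2_def adj_def)
    obtain f1 f2 where c1: "critical V1 (E \<inter> V1 \<times> V1) p f1" and c2: "critical V2 (E \<inter> V2 \<times> V2) p f2"
      and f12: "\<forall>i \<in> {1..p}. (\<forall>w \<in> V1 - {v}. f i w = f1 i w) \<and> (\<forall>w \<in> V2 - {v}. f i w = f2 i w) \<and> f i v = f1 i v + f2 i v"
      using split_at_separating_vertex[OF V12 no_cross] by blast
    have "V1 \<subset> V" "V2 \<subset> V" using V12 T v by (auto simp: V1_def V2_def)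
    then have "card V1 < card V" "card V2 < card V" using finite_V by (auto intro: psubset_card_mono)
    then have h1: "hard_pair p \<lparr>pverts = V1, parcs = E \<inter> V1 \<times> V1\<rparr> f1"
      and h2: "hard_pair p \<lparr>pverts = V2, parcs = E \<inter> V2 \<times> V2\<rparr> f2"
      using less.hyps c1 c2 by blast+
    have "E = E \<inter> V1 \<times> V1 \<union> E \<inter> V2 \<times> V2"
    proof -
      have "e \<in> V1 \<times> V1 \<union> V2 \<times> V2" if "e \<in> E" for e
      proof -
        obtain x y where e: "e = (x, y)" by (cases e)
        then have "x \<in> V1 \<union> V2" "y \<in> V1 \<union> V2" "adj x y" "adj y x"
          using that E_subset V12(1) by (auto simp: adj_def)
        then show ?thesis using no_cross[of x y] no_cross[of y x] V12(2) e by blast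
      qed
      then show ?thesis by blast
    qed
    then have "identification \<lparr>pverts = V1, parcs = E \<inter> V1 \<times> V1\<rparr> v id \<lparr>pverts = V2, parcs = E \<inter> V2 \<times> V2\<rparr> v id
        \<lparr>pverts = V, parcs = E\<rparr> v"
      unfolding identification_def using V12 by (auto simp: prod.map_id0)
    from hard_pair.merge[OF h1 h2 this] show ?thesis using f12 by simp
  qed
qed

theorem theorem3:
  fixes D :: "'a pair_pre_digraph" and p :: nat and f :: "nat \<Rightarrow> 'a \<Rightarrow> nat"
  assumes "pair_digraph D"
    and "connected (with_proj D)"
    and "p \<ge> 1"
    and "\<And>v. v \<in> pverts D \<Longrightarrow>
           (\<Sum>i = 1..p. f i v) \<ge> max (out_degree (with_proj D) v) (in_degree (with_proj D) v)"
  shows "\<not> partitionable p D f \<longleftrightarrow> hard_pair p D f"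
proof
  assume "\<not> partitionable p D f"
  then have nc: "\<not> f_coloring p (parcs D) f (pverts D) \<phi>" for \<phi>
    using partitionable_iff_f_coloring[OF assms(1)] by blast
  interpret D: pair_digraph D by fact
  have "critical (pverts D) (parcs D) p f"
  proof
    show "parcs D \<subseteq> pverts D \<times> pverts D" using D.in_arcsD1 D.in_arcsD2 by auto
    show "(v, v) \<notin> parcs D" for v using D.no_loops' by blast
    show "deg R (pverts D) v \<le> (\<Sum>i = 1..p. f i v)" if "v \<in> pverts D" "R \<in> {parcs D, (parcs D)\<inverse>}" for v R
      using assms(4)[OF that(1)] that(2)
      unfolding out_degree_eq_deg[OF D.pair_wf_digraph] in_degree_eq_deg[OF D.pair_wf_digraph] by auto
    show "\<exists>u \<in> T. \<exists>w \<in> pverts D - T. (u, w) \<in> parcs D \<union> (parcs D)\<inverse>"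
      if "T \<subseteq> pverts D" "T \<noteq> {}" "T \<noteq> pverts D" for T
      using assms(2) that unfolding connected_iff_cut by blast
  qed (use assms(2) nc D.pair_finite_verts in \<open>auto simp: connected_iff_cut\<close>)
  then have "hard_pair p \<lparr>pverts = pverts D, parcs = parcs D\<rparr> f" using assms(3) by (rule critical_imp_hard_pair)
  moreover have "\<lparr>pverts = pverts D, parcs = parcs D\<rparr> = D" by (cases D) simp
  ultimately show "hard_pair p D f" by simp
qed (rule hard_pair_not_partitionable)

end
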